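(* Let $W$ be the $2|1$-dimensional complex $\mathbb Z_2$-graded vector space with basis $w_1$ (odd), $w_2,w_3$ (even), and let $d_0=\psi^{1,1,0}_2$. Put $$\xi=\psi^{1,0,0}_2,\quad\sigma=\varphi^{0,1,0}_2,\quad\psi_k=\psi^{1,0,k-1}_3,\quad\phi_k=\varphi^{0,0,k}_3\qquad(k\ge1).$$ Let $s,t^k$ ($k\ge1$) be even and $\eta,\theta^k$ ($k\ge1$) odd parameters. Then the universal infinitesimal deformation $$d^1=d_0+\xi s+\sigma\eta+\sum_{k\ge1}\psi_kt^k+\sum_{k\ge1}\phi_k\theta^k$$ is a miniversal deformation of $d_0$, with base the quotient of the formal power series algebra $\mathbb C[[s,\eta,t^k,\theta^k: k\ge1]]$ by the relations $$s\eta=0,\qquad\sum_{k+l=n+1}(k-l-1)t^k\theta^l=0,\qquad\sum_{k+l=n+1}(k-l)\theta^k\theta^l=0,\qquad n=1,2,\dots$$ (superscripts are indices, not powers, and $k,l\ge1$ in the sums).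
   Context: All spaces are $\mathbb Z_2$-graded over $\mathbb C$. $S(W)=\bigoplus_{n\ge1}S^n(W)$ is the symmetric coalgebra of $W$ (so $w_1^2=0$). $L_n=\mathrm{Hom}(S^n(W),W)$, and $L=\prod_{n\ge1}L_n$ is identified with the coderivations of $S(W)$, a $\mathbb Z_2$-graded Lie algebra under the graded commutator. An $L_\infty$ structure (codifferential) is an odd $d\in L$ with $[d,d]=0$. For a multi-index $I=(i_1,i_2,i_3)$ with $i_1\in\{0,1\}$, $i_2,i_3\ge0$, put $w_I=w_1^{i_1}w_2^{i_2}w_3^{i_3}$, $I!=i_1!i_2!i_3!$, and let $\varphi^I_j(w_J)=I!\,\delta^I_J\,w_j$, an element of $L_{|I|}$; when odd it is written $\psi^I_j$. Rings are $\mathbb Z_2$-graded commutative (even parameters commute, odd parameters anticommute and square to zero). For an augmented local ring $\mathcal A$ with maximal ideal $\mathfrak m$ and augmentation $\epsilon:\mathcal A\to\mathbb C$: $\mathcal A$ is an infinitesimal base if $\mathfrak m^2=0$, a formal base if $\mathcal A=\varprojlim_n\mathcal A/\mathfrak m^n$. A deformation of $d$ with base $\mathcal A$ is an $\mathcal A$-linear $L_\infty$ structure $\tilde d$ (odd, $[\tilde d,\tilde d]=0$) on the completed tensor product $W\hat\otimes\mathcal A$, i.e. an element of the completion of $L\otimes\mathcal A$ with the $\mathcal A$-linearly extended bracket, such that $(1\otimes\epsilon)(\tilde d)=d$. It is infinitesimal/formal if $\mathcal A$ is. Two deformations with base $\mathcal A$ are equivalent ($\sim$) if they are conjugate by an $\mathcal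 A$-linear coalgebra automorphism that reduces to the identity under $\epsilon$. A homomorphism $f:\mathcal A\to\mathcal B$ of such bases induces $f_*=1\otimes f$. A deformation $d^\infty$ with formal base $\mathcal A$ is versal if for every formal deformation $\tilde d$ with base $\mathcal B$ there is $f:\mathcal A\to\mathcal B$ with $f_*(d^\infty)\sim\tilde d$; it is miniversal if moreover $f$ is unique whenever $\mathcal B$ is infinitesimal. The universal infinitesimal deformation of $d$ is $d+\sum_i\delta_iu^i$, where the $\delta_i$ are cocycles representing a basis of the cohomology of $D=[\cdot,d]$ and $u^i$ is a parameter of parity opposite to $\delta_i$.
   Formalization: Formal bases are taken complete for closed powers of the maximal ideal, homomorphisms are required continuous, and power series have finite homogeneous parts; with infinitely many parameters the literal m-adic reading fails (m² is not closed, and uniqueness fails for discontinuous maps). *)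

theory Defs
  imports Complex_Main "HOL-Library.Product_Plus"
begin

section \<open>Augmented local superalgebras and formal bases\<close>

text \<open>
  A base is a complex \<open>\<int>\<^sub>2\<close>-graded commutative algebra on a type of class \<open>ring_1\<close>.  The field
  \<open>filt A n\<close> is the \<open>n\<close>-th power of the maximal ideal \<open>\<mm>\<close> in the topological sense, i.e. the closure
  of the algebraic power \<open>mpow A n\<close>; see the locale \<open>formal_base\<close>.
\<close>

record 'a salg =
  scale :: "complex \<Rightarrow> 'a \<Rightarrow> 'a"
  even_part :: "'a set"
  odd_part :: "'a set"
  aug :: "'a \<Rightarrow> complex"
  filt :: "nat \<Rightarrow> 'a set"

definition hpart :: "('a, 'z) salg_scheme \<Rightarrow> nat \<Rightarrow> 'a set" where
  "hpart A p = (if even p then even_part A else odd_part A)"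

definition mideal :: "('a, 'z) salg_scheme \<Rightarrow> 'a set" where
  "mideal A = {a. aug A a = 0}"

primrec mpow :: "('a::ring_1, 'z) salg_scheme \<Rightarrow> nat \<Rightarrow> 'a set" where
  "mpow A 0 = UNIV"
| "mpow A (Suc n) = module.span (scale A) {a * b | a b. a \<in> mideal A \<and> b \<in> mpow A n}"

locale local_superalgebra = vector_space "scale A"
  for A :: "'a::ring_1 salg" +
  assumes scale_mult_left: "scale A c (x * y) = scale A c x * y"
    and scale_mult_right: "scale A c (x * y) = x * scale A c y"
    and subspace_hpart: "module.subspace (scale A) (hpart A p)"
    and parts_disjoint: "even_part A \<inter> odd_part A = {0}"
    and parts_span: "\<exists>a\<in>even_part A. \<exists>b\<in>odd_part A. x = a + b"
    and hpart_mult: "x \<in> hpart A p \<Longrightarrow> y \<in> hpart A q \<Longrightarrow> x * y \<in> hpart A (p + q)"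
    and supercommute: "x \<in> hpart A p \<Longrightarrow> y \<in> hpart A q \<Longrightarrow> x * y = (-1) ^ (p * q) * (y * x)"
    and aug_linear: "Vector_Spaces.linear (scale A) (*) (aug A)"
    and aug_mult: "aug A (x * y) = aug A x * aug A y"
    and aug_one: "aug A 1 = 1"
    and aug_odd: "x \<in> odd_part A \<Longrightarrow> aug A x = 0"
    and local_ring: "x \<notin> mideal A \<Longrightarrow> \<exists>y. x * y = 1 \<and> y * x = 1"

text \<open>
  \<open>A = lim A/\<mm>\<^sup>n\<close>.  With infinitely many parameters the algebraic powers of \<open>\<mm>\<close> are not closed and
  already \<open>\<complex>[[x\<^sub>1, x\<^sub>2, \<dots>]]\<close> is not complete for them (\<open>x\<^sub>1\<^sup>2 + x\<^sub>2\<^sup>3 + x\<^sub>3\<^sup>4 + \<dots>\<close> is not in the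
  algebraic \<open>\<mm>\<^sup>2\<close>), so \<open>\<mm>\<^sup>n\<close> has to be read as the closed power.  \<open>filt_closure\<close> says that
  \<open>filt A n\<close> is the closure of \<open>mpow A n\<close> in the topology with the \<open>filt A k\<close> as neighbourhoods of
  zero.  An algebra complete for the algebraic powers is the case \<open>filt A = mpow A\<close>.
\<close>

locale formal_base = local_superalgebra A for A :: "'a::ring_1 salg" +
  assumes filt_subspace: "module.subspace (scale A) (filt A n)"
    and filt_ideal: "x \<in> filt A n \<Longrightarrow> y * x \<in> filt A n \<and> x * y \<in> filt A n"
    and filt_graded: "a \<in> even_part A \<Longrightarrow> b \<in> odd_part A \<Longrightarrow> a + b \<in> filt A n \<Longrightarrow> a \<in> filt A n"
    and filt_antimono: "filt A (Suc n) \<subseteq> filt A n"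
    and filt_closure: "filt A n = (\<Inter>k. {x + y | x y. x \<in> mpow A n \<and> y \<in> filt A k})"
    and complete: "(\<And>n. s (Suc n) - s n \<in> filt A n) \<Longrightarrow> \<exists>!l. \<forall>n. l - s n \<in> filt A n"

definition infinitesimal :: "'a::ring_1 salg \<Rightarrow> bool" where
  "infinitesimal A \<longleftrightarrow> mpow A 2 = {0}"

definition base_hom :: "'a::ring_1 salg \<Rightarrow> 'b::ring_1 salg \<Rightarrow> ('a \<Rightarrow> 'b) \<Rightarrow> bool" where
  "base_hom A B f \<longleftrightarrow>
     Vector_Spaces.linear (scale A) (scale B) f \<and>
     (\<forall>x y. f (x * y) = f x * f y) \<and> f 1 = 1 \<and>
     (\<forall>p. f ` hpart A p \<subseteq> hpart B p) \<and>
     (\<forall>x. aug B (f x) = aug A x) \<and>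
     (\<forall>n. f ` filt A n \<subseteq> filt B n)"

definition trivial_base :: "complex salg" where
  "trivial_base = \<lparr>scale = (*), even_part = UNIV, odd_part = {0}, aug = (\<lambda>x. x),
     filt = (\<lambda>n. if n = 0 then UNIV else {0})\<rparr>"


section \<open>The symmetric coalgebra of \<open>W\<close> with coefficients in a base\<close>

text \<open>
  \<open>(i\<^sub>1, i\<^sub>2, i\<^sub>3) \<in> MI\<close> stands for the basis vector \<open>w\<^sub>1^i\<^sub>1 w\<^sub>2^i\<^sub>2 w\<^sub>3^i\<^sub>3\<close> of \<open>S(W)\<close>,
  with \<open>w\<^sub>1\<close> odd and \<open>w\<^sub>2, w\<^sub>3\<close> even.
\<close>

type_synonym mi = "nat \<times> nat \<times> nat"

definition MI :: "mi set" where
  "MI = {(a, b, c). a \<le> 1 \<and> (a, b, c) \<noteq> (0, 0, 0)}"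

definition par :: "mi \<Rightarrow> nat" where
  "par I = fst I"

definition deg :: "mi \<Rightarrow> nat" where
  "deg I = fst I + fst (snd I) + snd (snd I)"

definition mfact :: "mi \<Rightarrow> nat" where
  "mfact I = fact (fst I) * fact (fst (snd I)) * fact (snd (snd I))"

definition mbinom :: "mi \<Rightarrow> mi \<Rightarrow> nat" where
  "mbinom J I = (fst J choose fst I) * (fst (snd J) choose fst (snd I)) * (snd (snd J) choose snd (snd I))"

definition evec :: "nat \<Rightarrow> mi" where
  "evec j = (if j = 1 then 1 else 0, if j = 2 then 1 else 0, if j = 3 then 1 else 0)"

text \<open>
  An \<open>A\<close>-linear endomorphism \<open>T\<close> of the right \<open>A\<close>-module \<open>S(W) \<otimes> A\<close> is given by its matrix,
  \<open>T(w_J) = \<Sum>\<^sub>K w_K (T K J)\<close>.  It has parity \<open>p\<close> if \<open>T K J\<close> has parity \<open>p + |w_K| + |w_J|\<close>.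
\<close>

type_synonym 'a opr = "mi \<Rightarrow> mi \<Rightarrow> 'a"

definition oprs :: "'a::ring_1 salg \<Rightarrow> nat \<Rightarrow> 'a opr set" where
  "oprs A p = {T. (\<forall>K J. T K J \<in> hpart A (p + par K + par J)) \<and>
                  (\<forall>K J. K \<notin> MI \<or> J \<notin> MI \<longrightarrow> T K J = 0) \<and>
                  (\<forall>J. finite {K. T K J \<noteq> 0})}"

definition oid :: "'a::ring_1 opr" where
  "oid K J = (if K = J \<and> J \<in> MI then 1 else 0)"

definition ocomp :: "'a::ring_1 opr \<Rightarrow> 'a opr \<Rightarrow> 'a opr" where
  "ocomp T U K J = (\<Sum>M | U M J \<noteq> 0. T K M * U M J)"

text \<open>Graded commutator of operators of parities \<open>p\<close> and \<open>q\<close>.\<close>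

definition brk :: "nat \<Rightarrow> nat \<Rightarrow> 'a::ring_1 opr \<Rightarrow> 'a opr \<Rightarrow> 'a opr" where
  "brk p q T U K J = ocomp T U K J - (-1) ^ (p * q) * ocomp U T K J"

text \<open>
  Coefficient of \<open>w_K \<otimes> w_L\<close> in the comultiplication of \<open>w_J\<close>, which is the sum over all
  unshuffles into two nonempty parts.  There are no Koszul signs, since \<open>w\<^sub>1\<close> occurs at most once and
  moves only past even vectors.
\<close>

definition cop :: "mi \<Rightarrow> mi \<Rightarrow> mi \<Rightarrow> 'a::ring_1" where
  "cop K L J = (if K \<in> MI \<and> L \<in> MI \<and> J \<in> MI \<and> K + L = J then of_nat (mbinom J K) else 0)"

text \<open>
  Coefficient of \<open>w_K \<otimes> w_L\<close> in \<open>(T \<otimes> U)(w_M \<otimes> w_N) = (-1)^(|U||w_M|) T(w_M) \<otimes> U(w_N)\<close>, for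
  \<open>T\<close>, \<open>U\<close> of parities \<open>p\<close>, \<open>q\<close>; the second sign comes from moving \<open>T K M\<close> to the right past \<open>w_L\<close>.
\<close>

definition otens :: "nat \<Rightarrow> nat \<Rightarrow> 'a::ring_1 opr \<Rightarrow> 'a opr \<Rightarrow> mi \<Rightarrow> mi \<Rightarrow> mi \<Rightarrow> mi \<Rightarrow> 'a" where
  "otens p q T U K L M N = (-1) ^ (q * par M + (p + par K + par M) * par L) * T K M * U L N"

definition splits :: "mi \<Rightarrow> (mi \<times> mi) set" where
  "splits J = {(M, N). M \<in> MI \<and> N \<in> MI \<and> M + N = J}"

definition coderivation :: "'a::ring_1 salg \<Rightarrow> nat \<Rightarrow> 'a opr \<Rightarrow> bool" where
  "coderivation A p T \<longleftrightarrow> T \<in> oprs A p \<and>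
     (\<forall>J\<in>MI. \<forall>K\<in>MI. \<forall>L\<in>MI.
        (\<Sum>M | T M J \<noteq> 0. cop K L M * T M J) =
        (\<Sum>(M, N)\<in>splits J. (otens p 0 T oid K L M N + otens 0 p oid T K L M N) * cop M N J))"

definition coalgebra_automorphism :: "'a::ring_1 salg \<Rightarrow> 'a opr \<Rightarrow> bool" where
  "coalgebra_automorphism A g \<longleftrightarrow> g \<in> oprs A 0 \<and>
     (\<exists>h\<in>oprs A 0. ocomp g h = oid \<and> ocomp h g = oid) \<and>
     (\<forall>J\<in>MI. \<forall>K\<in>MI. \<forall>L\<in>MI.
        (\<Sum>M | g M J \<noteq> 0. cop K L M * g M J) =
        (\<Sum>(M, N)\<in>splits J. otens 0 0 g g K L M N * cop M N J))"


section \<open>Deformations\<close>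

definition linf_structure :: "'a::ring_1 salg \<Rightarrow> 'a opr \<Rightarrow> bool" where
  "linf_structure A d \<longleftrightarrow> coderivation A 1 d \<and> brk 1 1 d d = (\<lambda>K J. 0)"

definition deformation :: "'a::ring_1 salg \<Rightarrow> complex opr \<Rightarrow> 'a opr \<Rightarrow> bool" where
  "deformation A d d' \<longleftrightarrow> linf_structure A d' \<and> (\<forall>K J. aug A (d' K J) = d K J)"

definition equivalent :: "'a::ring_1 salg \<Rightarrow> 'a opr \<Rightarrow> 'a opr \<Rightarrow> bool" where
  "equivalent A d d' \<longleftrightarrow>
     (\<exists>g. coalgebra_automorphism A g \<and> (\<forall>K J. aug A (g K J) = oid K J) \<and> ocomp d g = ocomp g d')"

definition push :: "('a \<Rightarrow> 'b) \<Rightarrow> 'a opr \<Rightarrow> 'b opr" where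
  "push f T K J = f (T K J)"

text \<open>
  The bases \<open>B\<close> against which versality is tested live on the type given by the first argument.
\<close>

definition versal ::
  "'b::ring_1 itself \<Rightarrow> 'a::ring_1 salg \<Rightarrow> complex opr \<Rightarrow> 'a opr \<Rightarrow> bool" where
  "versal _ A d dinf \<longleftrightarrow> formal_base A \<and> deformation A d dinf \<and>
     (\<forall>(B :: 'b salg) d'. formal_base B \<and> deformation B d d' \<longrightarrow>
        (\<exists>f. base_hom A B f \<and> equivalent B (push f dinf) d'))"

definition miniversal ::
  "'b::ring_1 itself \<Rightarrow> 'a::ring_1 salg \<Rightarrow> complex opr \<Rightarrow> 'a opr \<Rightarrow> bool" where
  "miniversal T A d dinf \<longleftrightarrow> versal T A d dinf \<and>
     (\<forall>(B :: 'b salg) d'. formal_base B \<and> infinitesimal B \<and> deformation B d d' \<longrightarrow>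
        (\<exists>!f. base_hom A B f \<and> equivalent B (push f dinf) d'))"

text \<open>
  Elements of \<open>L = \<Prod>\<^sub>n Hom(S\<^sup>n(W), W)\<close>: \<open>x\<close> is the map \<open>w_I \<mapsto> \<Sum>\<^sub>j w_j (x I j)\<close>, \<open>j = 1, 2, 3\<close>.
  The coderivation \<open>coder x\<close> extending it is \<open>w_J \<mapsto> \<Sum> x(w_I) w_N\<close>, summed over the unshuffles of
  \<open>w_J\<close> into \<open>w_I\<close> and a possibly empty \<open>w_N\<close>.
\<close>

type_synonym cochain = "mi \<Rightarrow> nat \<Rightarrow> complex"

definition coder :: "cochain \<Rightarrow> complex opr" where
  "coder x K J = (if K \<in> MI \<and> J \<in> MI
     then \<Sum>(I, N, j) | I \<in> MI \<and> j \<in> {1, 2, 3} \<and> I + N = J \<and> N + evec j = K. of_nat (mbinom J I) * x I j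
     else 0)"

definition phi :: "mi \<Rightarrow> nat \<Rightarrow> cochain" where
  "phi I j = (\<lambda>J k. if J = I \<and> k = j then of_nat (mfact I) else 0)"

text \<open>
  \<open>x \<otimes> a\<close> for \<open>a\<close> of parity \<open>q\<close>, acting by \<open>(x \<otimes> a)(w_J) = (-1)^(|a||w_J|) x(w_J) a\<close>.
\<close>

definition ctens :: "'a::ring_1 salg \<Rightarrow> nat \<Rightarrow> cochain \<Rightarrow> 'a \<Rightarrow> 'a opr" where
  "ctens A q x a K J = scale A ((-1) ^ (q * par J) * coder x K J) a"

text \<open>
  The classes of the cocycles \<open>\<delta> i\<close>, of parity opposite to \<open>\<pi> i\<close>, form a basis of the cohomology of
  \<open>D = [\<cdot>, d]\<close>.  As \<open>L\<close> is a direct product, combinations \<open>\<Sum>\<^sub>i c\<^sub>i \<delta>\<^sub>i\<close> may be infinite; they are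
  locally finite.
\<close>

definition cohomology_basis :: "complex opr \<Rightarrow> ('i \<Rightarrow> nat) \<Rightarrow> ('i \<Rightarrow> cochain) \<Rightarrow> bool" where
  "cohomology_basis d \<pi> \<delta> \<longleftrightarrow>
     (\<forall>i. coderivation trivial_base (\<pi> i + 1) (coder (\<delta> i)) \<and>
          brk (\<pi> i + 1) 1 (coder (\<delta> i)) d = (\<lambda>K J. 0)) \<and>
     (\<forall>K J. finite {i. coder (\<delta> i) K J \<noteq> 0}) \<and>
     (\<forall>p T. coderivation trivial_base p T \<and> brk p 1 T d = (\<lambda>K J. 0) \<longrightarrow>
        (\<exists>!c. (\<forall>i. even (\<pi> i + p) \<longrightarrow> c i = 0) \<and>
           (\<exists>U. coderivation trivial_base (p + 1) U \<and>
              T = (\<lambda>K J. (\<Sum>i | coder (\<delta> i) K J \<noteq> 0. c i * coder (\<delta> i) K J) + brk (p + 1) 1 U d K J))))"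

text \<open>
  \<open>d' = d + \<Sum>\<^sub>i \<delta>\<^sub>i u\<^sup>i\<close>, with \<open>u\<^sup>i\<close> of parity \<open>\<pi> i\<close>.
\<close>

definition universal_infinitesimal ::
  "'a::ring_1 salg \<Rightarrow> complex opr \<Rightarrow> ('i \<Rightarrow> nat) \<Rightarrow> ('i \<Rightarrow> cochain) \<Rightarrow> ('i \<Rightarrow> 'a) \<Rightarrow> 'a opr \<Rightarrow> bool" where
  "universal_infinitesimal A d \<pi> \<delta> u d' \<longleftrightarrow>
     cohomology_basis d \<pi> \<delta> \<and> (\<forall>i. u i \<in> hpart A (\<pi> i)) \<and>
     d' = (\<lambda>K J. scale A (d K J) 1 + (\<Sum>i | coder (\<delta> i) K J \<noteq> 0. ctens A (\<pi> i) (\<delta> i) (u i) K J))"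


section \<open>The base of the deformation\<close>

text \<open>
  The parameters \<open>s\<close>, \<open>\<eta>\<close>, \<open>t\<^sup>k\<close>, \<open>\<theta>\<^sup>k\<close>, \<open>k \<ge> 1\<close>; \<open>PT m\<close> and \<open>PTheta m\<close> stand for
  \<open>t\<^sup>m\<^sup>+\<^sup>1\<close> and \<open>\<theta>\<^sup>m\<^sup>+\<^sup>1\<close>.
\<close>

datatype param = PS | PEta | PT nat | PTheta nat

primrec ppar :: "param \<Rightarrow> nat" where
  "ppar PS = 0"
| "ppar PEta = 1"
| "ppar (PT m) = 0"
| "ppar (PTheta m) = 1"

text \<open>
  The completed free associative algebra on the parameters: formal series in words, each homogeneous
  component being a finite sum.  The formal power series algebra \<open>\<complex>[[s, \<eta>, t\<^sup>k, \<theta>\<^sup>k]]\<close>, i.e. the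
  completion of the free graded commutative algebra, is its quotient by the closed ideal generated by
  the graded commutators of the parameters.
\<close>

typedef fser = "{f :: param list \<Rightarrow> complex. \<forall>n. finite {w. length w = n \<and> f w \<noteq> 0}}"
  morphisms fcoeff Fser
  by (rule exI[of _ "\<lambda>_. 0"]) simp

setup_lifting type_definition_fser

definition wsplits :: "'i list \<Rightarrow> ('i list \<times> 'i list) set" where
  "wsplits w = {(u, v). u @ v = w}"

lemma finite_wsplits [simp]: "finite (wsplits w)"
proof -
  have "wsplits w \<subseteq> (\<lambda>i. (take i w, drop i w)) ` {..length w}"
  proof
    fix x assume "x \<in> wsplits w"
    then have "x = (take (length (fst x)) w, drop (length (fst x)) w)" "length (fst x) \<le> length w"
      by (auto simp: wsplits_def)
    then show "x \<in> (\<lambda>i. (take i w, drop i w)) ` {..length w}" by blast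
  qed
  then show ?thesis by (rule finite_subset) simp
qed

lemma wsplits_Nil [simp]: "wsplits [] = {([], [])}"
  by (auto simp: wsplits_def)

instantiation fser :: ring_1
begin

lift_definition zero_fser :: fser is "\<lambda>_. 0" by simp

lift_definition one_fser :: fser is "\<lambda>w. if w = [] then 1 else 0"
  by (auto intro: finite_subset[of _ "{[]}"])

lift_definition plus_fser :: "fser \<Rightarrow> fser \<Rightarrow> fser" is "\<lambda>f g w. f w + g w"
proof -
  fix f g :: "param list \<Rightarrow> complex" and n
  assume "\<And>n. finite {w. length w = n \<and> f w \<noteq> 0}" "\<And>n. finite {w. length w = n \<and> g w \<noteq> 0}"
  then have "finite ({w. length w = n \<and> f w \<noteq> 0} \<union> {w. length w = n \<and> g w \<noteq> 0})" by blast
  then show "finite {w. length w = n \<and> f w + g w \<noteq> 0}" by (rule finite_subset[rotated]) auto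
qed

lift_definition uminus_fser :: "fser \<Rightarrow> fser" is "\<lambda>f w. - f w" by simp

lift_definition minus_fser :: "fser \<Rightarrow> fser \<Rightarrow> fser" is "\<lambda>f g w. f w - g w"
proof -
  fix f g :: "param list \<Rightarrow> complex" and n
  assume "\<And>n. finite {w. length w = n \<and> f w \<noteq> 0}" "\<And>n. finite {w. length w = n \<and> g w \<noteq> 0}"
  then have "finite ({w. length w = n \<and> f w \<noteq> 0} \<union> {w. length w = n \<and> g w \<noteq> 0})" by blast
  then show "finite {w. length w = n \<and> f w - g w \<noteq> 0}" by (rule finite_subset[rotated]) auto
qed

lift_definition times_fser :: "fser \<Rightarrow> fser \<Rightarrow> fser" is
  "\<lambda>f g w. \<Sum>(u, v)\<in>wsplits w. f u * g v"
proof -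
  fix f g :: "param list \<Rightarrow> complex" and n
  assume f: "\<And>n. finite {w. length w = n \<and> f w \<noteq> 0}" and g: "\<And>n. finite {w. length w = n \<and> g w \<noteq> 0}"
  let ?P = "\<Union>i\<le>n. (\<lambda>(u, v). u @ v) `
    ({w. length w = i \<and> f w \<noteq> 0} \<times> {w. length w = n - i \<and> g w \<noteq> 0})"
  have "finite ?P" using f g by blast
  moreover have "{w. length w = n \<and> (\<Sum>(u, v)\<in>wsplits w. f u * g v) \<noteq> 0} \<subseteq> ?P"
  proof
    fix w assume "w \<in> {w. length w = n \<and> (\<Sum>(u, v)\<in>wsplits w. f u * g v) \<noteq> 0}"
    then have n: "length w = n" and ne: "(\<Sum>x\<in>wsplits w. f (fst x) * g (snd x)) \<noteq> 0"
      by (simp_all add: split_def)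
    from ne obtain x where x: "x \<in> wsplits w" "f (fst x) * g (snd x) \<noteq> 0"
      by (rule sum.not_neutral_contains_not_neutral)
    obtain u v where uv: "x = (u, v)" by (cases x)
    have w: "w = u @ v" using x(1) uv by (simp add: wsplits_def)
    show "w \<in> ?P"
    proof (rule UN_I)
      show "length u \<in> {..n}" using n w by simp
      show "w \<in> (\<lambda>(u, v). u @ v) ` ({w. length w = length u \<and> f w \<noteq> 0} \<times>
          {w. length w = n - length u \<and> g w \<noteq> 0})"
        by (rule image_eqI[of _ _ "(u, v)"]) (use n w x(2) uv in simp_all)
    qed
  qed
  ultimately show "finite {w. length w = n \<and> (\<Sum>(u, v)\<in>wsplits w. f u * g v) \<noteq> 0}"
    by (rule finite_subset[rotated])
qed

instance
proof
  fix a b c :: fser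
  show "a + b + c = a + (b + c)" by transfer (simp add: add.assoc)
  show "a + b = b + a" by transfer (simp add: add.commute)
  show "0 + a = a" by transfer simp
  show "- a + a = 0" by transfer simp
  show "a - b = a + - b" by transfer simp
  show "(0::fser) \<noteq> 1" by transfer (metis zero_neq_one)
  show "(a + b) * c = a * c + b * c"
    by transfer (simp add: distrib_right split_def sum.distrib)
  show "a * (b + c) = a * b + a * c"
    by transfer (simp add: distrib_left split_def sum.distrib)
  show "1 * a = a"
  proof (transfer, rule ext)
    fix a :: "param list \<Rightarrow> complex" and w
    have "(\<Sum>(u, v)\<in>wsplits w. (if u = [] then 1 else 0) * a v) =
      (\<Sum>x\<in>{([] :: param list, w)}. (if fst x = [] then 1 else 0) * a (snd x))"
      by (rule sum.mono_neutral_cong_right)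
         (auto simp: wsplits_def finite_wsplits[unfolded wsplits_def] split: if_splits)
    then show "(\<Sum>(u, v)\<in>wsplits w. (if u = [] then 1 else 0) * a v) = a w" by simp
  qed
  show "a * 1 = a"
  proof (transfer, rule ext)
    fix a :: "param list \<Rightarrow> complex" and w
    have "(\<Sum>(u, v)\<in>wsplits w. a u * (if v = [] then 1 else 0)) =
      (\<Sum>x\<in>{(w, [] :: param list)}. a (fst x) * (if snd x = [] then 1 else 0))"
      by (rule sum.mono_neutral_cong_right)
         (auto simp: wsplits_def finite_wsplits[unfolded wsplits_def] split: if_splits)
    then show "(\<Sum>(u, v)\<in>wsplits w. a u * (if v = [] then 1 else 0)) = a w" by simp
  qed
  show "a * b * c = a * (b * c)"
  proof (transfer, rule ext)
    fix a b c :: "param list \<Rightarrow> complex" and w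
    have "(\<Sum>(u, v)\<in>wsplits w. (\<Sum>(x, y)\<in>wsplits u. a x * b y) * c v) =
      (\<Sum>p\<in>wsplits w. \<Sum>q\<in>wsplits (fst p). a (fst q) * b (snd q) * c (snd p))"
      by (simp add: split_def sum_distrib_right)
    also have "\<dots> = (\<Sum>(p, q)\<in>(SIGMA p:wsplits w. wsplits (fst p)). a (fst q) * b (snd q) * c (snd p))"
      by (rule sum.Sigma) auto
    also have "\<dots> = (\<Sum>(p, q)\<in>(SIGMA p:wsplits w. wsplits (snd p)). a (fst p) * b (fst q) * c (snd q))"
    proof (rule sum.reindex_bij_witness[where
            i = "\<lambda>(p, q). ((fst p @ fst q, snd q), (fst p, fst q))" and
            j = "\<lambda>(p, q). ((fst q, snd q @ snd p), (snd q, snd p))"], goal_cases)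
    qed (clarsimp simp: wsplits_def)+
    also have "\<dots> = (\<Sum>p\<in>wsplits w. \<Sum>q\<in>wsplits (snd p). a (fst p) * b (fst q) * c (snd q))"
      by (rule sum.Sigma[symmetric]) auto
    also have "\<dots> = (\<Sum>(u, v)\<in>wsplits w. a u * (\<Sum>(x, y)\<in>wsplits v. b x * c y))"
      by (simp add: split_def sum_distrib_left mult.assoc)
    finally show "(\<Sum>(u, v)\<in>wsplits w. (\<Sum>(x, y)\<in>wsplits u. a x * b y) * c v) =
      (\<Sum>(u, v)\<in>wsplits w. a u * (\<Sum>(x, y)\<in>wsplits v. b x * c y))" .
  qed
qed

end

lift_definition fscale :: "complex \<Rightarrow> fser \<Rightarrow> fser" is "\<lambda>c f w. c * f w"
  subgoal for c f n by (rule finite_subset[of _ "{w. length w = n \<and> f w \<noteq> 0}"]) auto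
  done

lift_definition fvar :: "param \<Rightarrow> fser" is "\<lambda>x w. if w = [x] then 1 else 0"
  subgoal for x n by (rule finite_subset[of _ "{[x]}"]) auto
  done

text \<open>Series of order at least \<open>n\<close>, and series in the words of parity \<open>p\<close>.\<close>

definition ford :: "nat \<Rightarrow> fser set" where
  "ford n = {f. \<forall>w. length w < n \<longrightarrow> fcoeff f w = 0}"

definition fhpart :: "nat \<Rightarrow> fser set" where
  "fhpart p = {f. \<forall>w. odd (sum_list (map ppar w) + p) \<longrightarrow> fcoeff f w = 0}"

inductive_set ideal_gen :: "'r::ring_1 set \<Rightarrow> 'r set" for R :: "'r set" where
  zero: "0 \<in> ideal_gen R"
| gen: "r \<in> R \<Longrightarrow> a * r * b \<in> ideal_gen R"
| add: "x \<in> ideal_gen R \<Longrightarrow> y \<in> ideal_gen R \<Longrightarrow> x + y \<in> ideal_gen R"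

definition closed_ideal_gen :: "fser set \<Rightarrow> fser set" where
  "closed_ideal_gen R = {f. \<forall>n. \<exists>g\<in>ideal_gen R. f - g \<in> ford n}"

definition ft :: "nat \<Rightarrow> fser" where "ft k = fvar (PT (k - 1))"
definition ftheta :: "nat \<Rightarrow> fser" where "ftheta k = fvar (PTheta (k - 1))"

definition graded_commutators :: "fser set" where
  "graded_commutators = {fvar x * fvar y - (-1) ^ (ppar x * ppar y) * (fvar y * fvar x) | x y. True}"

definition base_relations :: "fser set" where
  "base_relations =
     {fvar PS * fvar PEta} \<union>
     {\<Sum>k=1..n. let l = n + 1 - k in of_int (int k - int l - 1) * (ft k * ftheta l) | n. n \<ge> 1} \<union>
     {\<Sum>k=1..n. let l = n + 1 - k in of_int (int k - int l) * (ftheta k * ftheta l) | n. n \<ge> 1}"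

definition base_ideal :: "fser set" where
  "base_ideal = closed_ideal_gen (graded_commutators \<union> base_relations)"

lemma ideal_gen_mult_left: "x \<in> ideal_gen R \<Longrightarrow> c * x \<in> ideal_gen R"
  by (induction rule: ideal_gen.induct)
     (auto simp: distrib_left mult.assoc[symmetric] intro: ideal_gen.intros)

lemma ideal_gen_mult_right: "x \<in> ideal_gen R \<Longrightarrow> x * c \<in> ideal_gen R"
proof (induction rule: ideal_gen.induct)
  case (gen r a b)
  then show ?case using ideal_gen.gen[of r R a "b * c"] by (simp add: mult.assoc)
qed (auto simp: distrib_right intro: ideal_gen.intros)

lemma ford_add: "f \<in> ford n \<Longrightarrow> g \<in> ford n \<Longrightarrow> f + g \<in> ford n"
  by (auto simp: ford_def plus_fser.rep_eq)

lemma fcoeff_mult: "fcoeff (f * g) w = (\<Sum>(u, v)\<in>wsplits w. fcoeff f u * fcoeff g v)"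
  by (simp add: times_fser.rep_eq)

lemma ford_mult_left: "f \<in> ford n \<Longrightarrow> h * f \<in> ford n"
  by (auto simp: ford_def fcoeff_mult wsplits_def intro!: sum.neutral)

lemma ford_mult_right: "f \<in> ford n \<Longrightarrow> f * h \<in> ford n"
  by (auto simp: ford_def fcoeff_mult wsplits_def intro!: sum.neutral)

lemma closed_ideal_gen_zero: "0 \<in> closed_ideal_gen R"
  unfolding closed_ideal_gen_def ford_def
  by (auto intro!: bexI[of _ 0] ideal_gen.zero simp: zero_fser.rep_eq)

lemma closed_ideal_gen_add:
  assumes "f \<in> closed_ideal_gen R" "f' \<in> closed_ideal_gen R"
  shows "f + f' \<in> closed_ideal_gen R"
  unfolding closed_ideal_gen_def
proof (clarify)
  fix n
  from assms obtain g g' where g: "g \<in> ideal_gen R" "f - g \<in> ford n"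
      and g': "g' \<in> ideal_gen R" "f' - g' \<in> ford n"
    unfolding closed_ideal_gen_def by blast
  have "f + f' - (g + g') = (f - g) + (f' - g')" by (simp add: algebra_simps)
  then show "\<exists>h\<in>ideal_gen R. f + f' - h \<in> ford n"
    using ford_add[OF g(2) g'(2)] ideal_gen.add[OF g(1) g'(1)] by metis
qed

lemma closed_ideal_gen_mult_left:
  assumes "f \<in> closed_ideal_gen R" shows "h * f \<in> closed_ideal_gen R"
  unfolding closed_ideal_gen_def
proof (clarify)
  fix n
  from assms obtain g where g: "g \<in> ideal_gen R" "f - g \<in> ford n"
    unfolding closed_ideal_gen_def by blast
  have "h * f - h * g \<in> ford n" using ford_mult_left[OF g(2)] by (simp add: right_diff_distrib)
  then show "\<exists>k\<in>ideal_gen R. h * f - k \<in> ford n" using ideal_gen_mult_left[OF g(1)] by blast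
qed

lemma closed_ideal_gen_mult_right:
  assumes "f \<in> closed_ideal_gen R" shows "f * h \<in> closed_ideal_gen R"
  unfolding closed_ideal_gen_def
proof (clarify)
  fix n
  from assms obtain g where g: "g \<in> ideal_gen R" "f - g \<in> ford n"
    unfolding closed_ideal_gen_def by blast
  have "f * h - g * h \<in> ford n" using ford_mult_right[OF g(2)] by (simp add: left_diff_distrib)
  then show "\<exists>k\<in>ideal_gen R. f * h - k \<in> ford n" using ideal_gen_mult_right[OF g(1)] by blast
qed

lemma base_ideal_zero: "0 \<in> base_ideal"
  by (simp add: base_ideal_def closed_ideal_gen_zero)

lemma base_ideal_add: "f \<in> base_ideal \<Longrightarrow> g \<in> base_ideal \<Longrightarrow> f + g \<in> base_ideal"
  by (simp add: base_ideal_def closed_ideal_gen_add)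

lemma base_ideal_mult_left: "f \<in> base_ideal \<Longrightarrow> h * f \<in> base_ideal"
  by (simp add: base_ideal_def closed_ideal_gen_mult_left)

lemma base_ideal_mult_right: "f \<in> base_ideal \<Longrightarrow> f * h \<in> base_ideal"
  by (simp add: base_ideal_def closed_ideal_gen_mult_right)

lemma base_ideal_minus: "f \<in> base_ideal \<Longrightarrow> - f \<in> base_ideal"
  using base_ideal_mult_left[of f "-1"] by simp

lemma fcoeff_Nil_mult: "fcoeff (f * g) [] = fcoeff f [] * fcoeff g []"
  by (simp add: times_fser.rep_eq)

lemma fcoeff_Nil_sum: "fcoeff (sum f S) [] = (\<Sum>i\<in>S. fcoeff (f i) [])"
  by (induction S rule: infinite_finite_induct) (simp_all add: zero_fser.rep_eq plus_fser.rep_eq)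

lemma base_ideal_aug:
  assumes "f \<in> base_ideal" shows "fcoeff f [] = 0"
proof -
  have R: "fcoeff r [] = 0" if "r \<in> graded_commutators \<union> base_relations" for r
    using that
    by (auto simp: graded_commutators_def base_relations_def Let_def fcoeff_Nil_mult fcoeff_Nil_sum
        minus_fser.rep_eq fvar.rep_eq ft_def ftheta_def)
  have I: "fcoeff g [] = 0" if "g \<in> ideal_gen (graded_commutators \<union> base_relations)" for g
    using that by induction (auto simp: R fcoeff_Nil_mult plus_fser.rep_eq zero_fser.rep_eq)
  obtain g where "g \<in> ideal_gen (graded_commutators \<union> base_relations)" "f - g \<in> ford 1"
    using assms unfolding base_ideal_def closed_ideal_gen_def by blast
  then show ?thesis using I[of g] by (simp add: ford_def minus_fser.rep_eq)
qed

quotient_type base = fser / "\<lambda>f g. f - g \<in> base_ideal"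
proof (rule equivpI)
  show "reflp (\<lambda>f g. f - g \<in> base_ideal)" by (simp add: reflp_def base_ideal_zero)
  show "symp (\<lambda>f g. f - g \<in> base_ideal)"
    unfolding symp_def by (metis base_ideal_minus minus_diff_eq)
  show "transp (\<lambda>f g. f - g \<in> base_ideal)"
  proof (rule transpI)
    fix x y z assume "x - y \<in> base_ideal" "y - z \<in> base_ideal"
    then have "(x - y) + (y - z) \<in> base_ideal" by (rule base_ideal_add)
    then show "x - z \<in> base_ideal" by simp
  qed
qed

instantiation base :: ring_1
begin

lift_definition zero_base :: base is 0 .
lift_definition one_base :: base is 1 .

lift_definition plus_base :: "base \<Rightarrow> base \<Rightarrow> base" is "(+)"
  subgoal for a b c d using base_ideal_add[of "a - b" "c - d"] by (simp add: algebra_simps)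
  done

lift_definition uminus_base :: "base \<Rightarrow> base" is "uminus"
  subgoal for a b using base_ideal_minus[of "a - b"] by (simp add: algebra_simps)
  done

lift_definition minus_base :: "base \<Rightarrow> base \<Rightarrow> base" is "(-)"
  subgoal for a b c d
    using base_ideal_add[of "a - b" "- (c - d)"] base_ideal_minus[of "c - d"]
    by (simp add: algebra_simps)
  done

lift_definition times_base :: "base \<Rightarrow> base \<Rightarrow> base" is "(*)"
  subgoal for a b c d
    using base_ideal_add[of "(a - b) * c" "b * (c - d)"] base_ideal_mult_right[of "a - b" c]
      base_ideal_mult_left[of "c - d" b]
    by (simp add: algebra_simps)
  done

instance
proof
  fix a b c :: base
  show "a + b + c = a + (b + c)" by transfer (simp add: base_ideal_zero add.assoc)
  show "a + b = b + a" by transfer (simp add: base_ideal_zero)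
  show "0 + a = a" by transfer (simp add: base_ideal_zero)
  show "- a + a = 0" by transfer (simp add: base_ideal_zero)
  show "a - b = a + - b" by transfer (simp add: base_ideal_zero)
  show "(0::base) \<noteq> 1"
    using base_ideal_aug[of "0 - 1"]
    by transfer (auto simp: minus_fser.rep_eq zero_fser.rep_eq one_fser.rep_eq dest: base_ideal_aug)
  show "(a + b) * c = a * c + b * c" by transfer (simp add: base_ideal_zero distrib_right)
  show "a * (b + c) = a * b + a * c" by transfer (simp add: base_ideal_zero distrib_left)
  show "1 * a = a" by transfer (simp add: base_ideal_zero)
  show "a * 1 = a" by transfer (simp add: base_ideal_zero)
  show "a * b * c = a * (b * c)" by transfer (simp add: base_ideal_zero mult.assoc)
qed

end

lift_definition bscale :: "complex \<Rightarrow> base \<Rightarrow> base" is fscale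
proof -
  fix c f g assume "f - g \<in> base_ideal"
  moreover have "fscale c f - fscale c g = fscale c 1 * (f - g)"
  proof (transfer, rule ext)
    fix c :: complex and f g :: "param list \<Rightarrow> complex" and w
    have "(\<Sum>(u, v)\<in>wsplits w. c * (if u = [] then 1 else 0) * (f v - g v)) =
      (\<Sum>x\<in>{([] :: param list, w)}. c * (f (snd x) - g (snd x)))"
      by (rule sum.mono_neutral_cong_right)
         (auto simp: wsplits_def finite_wsplits[unfolded wsplits_def] split: if_splits)
    then show "c * f w - c * g w =
        (\<Sum>(u, v)\<in>wsplits w. c * (if u = [] then 1 else 0) * (f v - g v))"
      by (simp add: right_diff_distrib)
  qed
  ultimately show "fscale c f - fscale c g \<in> base_ideal" by (simp add: base_ideal_mult_left)
qed

lift_definition baug :: "base \<Rightarrow> complex" is "\<lambda>f. fcoeff f []"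
  subgoal for f g using base_ideal_aug[of "f - g"] by (simp add: minus_fser.rep_eq)
  done

definition versal_base :: "base salg" where
  "versal_base = \<lparr>scale = bscale, even_part = abs_base ` fhpart 0, odd_part = abs_base ` fhpart 1,
     aug = baug, filt = (\<lambda>n. abs_base ` ford n)\<rparr>"


section \<open>The codifferential and its deformation\<close>

definition d0 :: "complex opr" where "d0 = coder (phi (1, 1, 0) 2)"

definition xi :: cochain where "xi = phi (1, 0, 0) 2"
definition sigma :: cochain where "sigma = phi (0, 1, 0) 2"
definition psik :: "nat \<Rightarrow> cochain" where "psik k = phi (1, 0, k - 1) 3"
definition phik :: "nat \<Rightarrow> cochain" where "phik k = phi (0, 0, k) 3"

primrec delta :: "param \<Rightarrow> cochain" where
  "delta PS = xi"
| "delta PEta = sigma"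
| "delta (PT m) = psik (m + 1)"
| "delta (PTheta m) = phik (m + 1)"

definition bpar :: "param \<Rightarrow> base" where
  "bpar x = abs_base (fvar x)"

text \<open>
  On \<open>w_J\<close> only the terms with \<open>k \<le> |J|\<close> of the sum over \<open>k \<ge> 1\<close> act, since
  \<open>psik k\<close> and \<open>phik k\<close> lie in \<open>Hom(S\<^sup>k(W), W)\<close>.
\<close>

definition d1 :: "base opr" where
  "d1 K J = scale versal_base (d0 K J) 1
     + ctens versal_base 0 xi (bpar PS) K J
     + ctens versal_base 1 sigma (bpar PEta) K J
     + (\<Sum>k=1..deg J. ctens versal_base 0 (psik k) (bpar (PT (k - 1))) K J)
     + (\<Sum>k=1..deg J. ctens versal_base 1 (phik k) (bpar (PTheta (k - 1))) K J)"

end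

theory Submission
  imports Defs
begin

text \<open>
  Dually, a coderivation of \<open>S(W)\<close> is a vector field on the formal superspace with coordinates
  \<open>x\<^sub>1\<close> (odd), \<open>x\<^sub>2\<close>, \<open>x\<^sub>3\<close> (even), and \<open>d\<^sub>0\<close> is \<open>x\<^sub>1 x\<^sub>2 \<partial>\<^sub>2\<close>.  The operator \<open>[d\<^sub>0, \<cdot>]\<close> has an explicit
  contracting homotopy onto the span of the \<open>\<delta>\<^sub>i\<close>.  Given a deformation \<open>Q\<close> over a formal base, this homotopy
  corrects order by order a coalgebra morphism \<open>g\<close> and the parameters \<open>u\<close> of a normal form \<open>N\<close>, until
  \<open>N g = g Q\<close>; the obstruction \<open>N N\<close> causes no trouble because \<open>E = N g - g Q\<close> satisfies
  \<open>N E + E Q = N N g\<close> and \<open>N N\<close> involves only coefficients that coboundaries do not reach.  As \<open>g\<close> is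
  invertible, \<open>N N = 0\<close>, and this is exactly the list of relations of the base, so that \<open>u\<close> defines
  a homomorphism out of it.  Over an infinitesimal base the parameters are coefficients of \<open>Q\<close> which
  no automorphism changes.
\<close>

declare split_paired_All [simp del] split_paired_Ex [simp del]

lemma par_add [simp]: "par (M + N) = par M + par N"
  by (simp add: par_def)

lemma deg_add [simp]: "deg (M + N) = deg M + deg N"
  by (simp add: deg_def)

lemma sgn_cong: "even (m + n) \<Longrightarrow> (-1) ^ m = ((-1) ^ n :: 'b::ring_1)"
  by (auto simp: minus_one_power_iff)

lemma sgn_left_commute: "(-1) ^ m * ((-1) ^ n * x) = (-1) ^ n * ((-1) ^ m * (x :: 'b::ring_1))"
  by (simp add: minus_one_power_iff)

lemma sgn_mid_commute: "x * ((-1) ^ n * y) = (-1) ^ n * (x * (y :: 'b::ring_1))"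
  by (simp add: minus_one_power_iff)

lemma MI_par: "K \<in> MI \<Longrightarrow> par K \<le> 1"
  by (auto simp: MI_def par_def)

lemma MI_deg: "K \<in> MI \<Longrightarrow> deg K \<ge> 1"
  by (auto simp: MI_def deg_def)

lemma evec_MI [simp]: "j \<in> {1, 2, 3} \<Longrightarrow> evec j \<in> MI"
  by (auto simp: MI_def evec_def)

lemma mi_induct [consumes 1, case_names evec add]:
  assumes K: "K \<in> MI"
    and e: "\<And>j. j \<in> {1, 2, 3} \<Longrightarrow> P (evec j)"
    and a: "\<And>K L. K \<in> MI \<Longrightarrow> L \<in> MI \<Longrightarrow> K + L \<in> MI \<Longrightarrow> P K \<Longrightarrow> P L \<Longrightarrow> P (K + L)"
  shows "P K"
  using K
proof (induction "deg K" arbitrary: K rule: less_induct)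
  case less
  obtain x y z where K: "K = (x, y, z)" by (cases K)
  have e1: "P (1, 0, 0)" and e2: "P (0, 1, 0)" and e3: "P (0, 0, 1)"
    using e[of 1] e[of 2] e[of 3] by (auto simp: evec_def)
  consider "K = (1, 0, 0)" | "x = 1" "(y, z) \<noteq> (0, 0)" | "x = 0" "K = (0, 1, 0)"
    | "x = 0" "K = (0, 0, 1)" | y' where "x = 0" "y = Suc y'" "(y', z) \<noteq> (0, 0)"
    | z' where "x = 0" "y = 0" "z = Suc (Suc z')"
    using less.prems K
    by (cases y; cases z; cases "z - 1") (auto simp: MI_def le_Suc_eq)
  then show ?case
  proof cases
    case 2
    then have "P (0, y, z)" by (intro less.hyps) (auto simp: K deg_def MI_def)
    then show ?thesis using a[of "(1, 0, 0)" "(0, y, z)"] e1 2 by (auto simp: K MI_def)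
  next
    case 5
    then have "P (0, y', z)" by (intro less.hyps) (auto simp: K deg_def MI_def)
    then show ?thesis using a[of "(0, 1, 0)" "(0, y', z)"] e2 5 by (auto simp: K MI_def)
  next
    case 6
    then have "P (0, 0, Suc z')" by (intro less.hyps) (auto simp: K deg_def MI_def)
    then show ?thesis using a[of "(0, 0, 1)" "(0, 0, Suc z')"] e3 6 by (auto simp: K MI_def)
  qed (use e1 e2 e3 in auto)
qed

lemma sum_sum_mult:
  "(\<Sum>i\<in>S. \<Sum>j\<in>T. s * (t * f i * g j)) = s * (t * sum f S * sum g T :: 'b::ring_1)"
proof -
  have "(\<Sum>i\<in>S. \<Sum>j\<in>T. s * (t * f i * g j)) = (\<Sum>i\<in>S. \<Sum>j\<in>T. s * t * (f i * g j))"
    by (simp only: mult.assoc)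
  also have "\<dots> = s * t * (sum f S * sum g T)"
    unfolding sum_product by (simp only: sum_distrib_left)
  finally show ?thesis by (simp only: mult.assoc)
qed

definition msplits :: "mi \<Rightarrow> (mi \<times> mi) set" where
  "msplits J = {(M, N). M + N = J}"

lemma msplits_iff: "p \<in> msplits J \<longleftrightarrow> fst p + snd p = J"
  by (simp add: msplits_def split_def)

lemma finite_msplits [simp]: "finite (msplits J)"
proof -
  obtain x y z where J: "J = (x, y, z)" by (cases J)
  have "msplits J \<subseteq> ({..x} \<times> {..y} \<times> {..z}) \<times> ({..x} \<times> {..y} \<times> {..z})"
    by (auto simp: msplits_def J)
  then show ?thesis by (rule finite_subset) auto
qed

lemma splits_subset: "splits J \<subseteq> msplits J"
  by (auto simp: splits_def msplits_def)

lemma finite_splits [simp]: "finite (splits J)"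
  by (rule finite_subset[OF splits_subset]) simp

text \<open>
  Functions on multi-indices are power series in \<open>x\<^sub>1, x\<^sub>2, x\<^sub>3\<close> with their coefficients on the left.
  In the product of \<open>f\<close> and \<open>h\<close> the number \<open>s\<close> is the parity of \<open>h\<close>, so that the coefficient \<open>h N\<close>,
  which has to pass \<open>x\<^sup>M\<close>, has parity \<open>s + par N\<close>; here \<open>par M * par N\<close> can be dropped, since the
  product vanishes when it is odd.
\<close>

definition rprod :: "nat \<Rightarrow> (mi \<Rightarrow> 'b::ring_1) \<Rightarrow> (mi \<Rightarrow> 'b) \<Rightarrow> mi \<Rightarrow> 'b" where
  "rprod s f h J =
     (if fst J \<le> 1 then \<Sum>(M, N)\<in>msplits J. (-1) ^ (s * par M) * f M * h N else 0)"

lemma rprod_assoc: "rprod r (rprod q F G) H = rprod (q + r) F (rprod r G H)"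
proof
  fix J
  show "rprod r (rprod q F G) H J = rprod (q + r) F (rprod r G H) J"
  proof (cases "fst J \<le> 1")
    case True
    have le: "fst (fst p) \<le> 1" "fst (snd p) \<le> 1" if "p \<in> msplits J" for p
      using that True by (auto simp: msplits_def)
    have "rprod r (rprod q F G) H J = (\<Sum>p\<in>msplits J. \<Sum>t\<in>msplits (fst p).
        (-1) ^ (r * par (fst p)) * ((-1) ^ (q * par (fst t)) * F (fst t) * G (snd t)) * H (snd p))"
      using True le by (auto simp: rprod_def split_def sum_distrib_left sum_distrib_right intro!: sum.cong)
    also have "\<dots> = (\<Sum>(p, t)\<in>(SIGMA p:msplits J. msplits (fst p)).
        (-1) ^ (r * par (fst p)) * ((-1) ^ (q * par (fst t)) * F (fst t) * G (snd t)) * H (snd p))"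
      by (rule sum.Sigma) auto
    also have "\<dots> = (\<Sum>(p, t)\<in>(SIGMA p:msplits J. msplits (snd p)).
        (-1) ^ ((q + r) * par (fst p)) * F (fst p) * ((-1) ^ (r * par (fst t)) * G (fst t) * H (snd t)))"
    proof (rule sum.reindex_bij_witness[where
            i = "\<lambda>(p, t). ((fst p + fst t, snd t), (fst p, fst t))" and
            j = "\<lambda>(p, t). ((fst t, snd t + snd p), (snd t, snd p))"], goal_cases)
      case (5 w)
      obtain P N M M' where w: "w = ((P, N), (M, M'))" by (metis prod.exhaust)
      have P: "P = M + M'" using 5 by (auto simp: msplits_def w)
      have "(-1) ^ (r * par P) * ((-1) ^ (q * par M) * F M * G M') * H N =
        (-1) ^ (r * par P + q * par M) * (F M * (G M' * H N))"
        by (simp only: power_add mult.assoc)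
      also have "r * par P + q * par M = (q + r) * par M + r * par M'"
        by (simp add: P algebra_simps)
      also have "(-1) ^ \<dots> * (F M * (G M' * H N)) =
        (-1) ^ ((q + r) * par M) * F M * ((-1) ^ (r * par M') * G M' * H N)"
        by (simp only: power_add mult.assoc sgn_mid_commute[of "F M"])
      finally show ?case by (simp add: w)
    qed (clarsimp simp: msplits_def add.assoc)+
    also have "\<dots> = (\<Sum>p\<in>msplits J. \<Sum>t\<in>msplits (snd p).
        (-1) ^ ((q + r) * par (fst p)) * F (fst p) * ((-1) ^ (r * par (fst t)) * G (fst t) * H (snd t)))"
      by (rule sum.Sigma[symmetric]) auto
    also have "\<dots> = rprod (q + r) F (rprod r G H) J"
      using True le by (auto simp: rprod_def split_def sum_distrib_left intro!: sum.cong)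
    finally show ?thesis .
  qed (simp add: rprod_def)
qed

definition rind :: "mi \<Rightarrow> mi \<Rightarrow> 'b::ring_1" where
  "rind I J = (if J = I then 1 else 0)"

definition shift :: "mi \<Rightarrow> (mi \<Rightarrow> 'b::ring_1) \<Rightarrow> mi \<Rightarrow> 'b" where
  "shift L f J = (if \<exists>M. J = M + L then f (J - L) else 0)"

lemma shift_add [simp]: "shift L f (M + L) = f M"
  by (auto simp: shift_def)

lemma shift_eq_0: "(\<And>M. J \<noteq> M + L) \<Longrightarrow> shift L f J = 0"
  by (auto simp: shift_def)

lemma rprod_rind_right:
  assumes "fst J \<le> 1"
  shows "rprod s f (rind L) J = shift L (\<lambda>M. (-1) ^ (s * par M) * f M) J"
proof (cases "\<exists>M. J = M + L")
  case True
  then obtain M where M: "J = M + L" by blast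
  have "rprod s f (rind L) J = (\<Sum>p\<in>{(M, L)}. (-1) ^ (s * par (fst p)) * f (fst p) * rind L (snd p))"
    unfolding rprod_def if_P[OF assms] split_def
  proof (rule sum.mono_neutral_right)
    have "snd p \<noteq> L" if "p \<in> msplits J - {(M, L)}" for p
      using that by (auto simp: msplits_iff M prod_eq_iff)
    then show "\<forall>p\<in>msplits J - {(M, L)}. (-1) ^ (s * par (fst p)) * f (fst p) * rind L (snd p) = 0"
      by (simp add: rind_def)
  qed (simp_all add: msplits_iff M)
  then show ?thesis by (simp add: M rind_def)
next
  case False
  then have "\<forall>p\<in>msplits J. snd p \<noteq> L" by (metis msplits_iff)
  then have "rprod s f (rind L) J = 0"
    by (simp add: rprod_def rind_def split_def)
  with False show ?thesis by (simp add: shift_def)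
qed

lemma rprod_rind_left:
  assumes "fst J \<le> 1"
  shows "rprod s (rind L) f J = (-1) ^ (s * par L) * shift L f J"
proof (cases "\<exists>M. J = M + L")
  case True
  then obtain M where M: "J = M + L" by blast
  have "rprod s (rind L) f J = (\<Sum>p\<in>{(L, M)}. (-1) ^ (s * par (fst p)) * rind L (fst p) * f (snd p))"
    unfolding rprod_def if_P[OF assms] split_def
  proof (rule sum.mono_neutral_right)
    have "fst p \<noteq> L" if "p \<in> msplits J - {(L, M)}" for p
      using that by (auto simp: msplits_iff M add.commute[of M] prod_eq_iff)
    then show "\<forall>p\<in>msplits J - {(L, M)}. (-1) ^ (s * par (fst p)) * rind L (fst p) * f (snd p) = 0"
      by (simp add: rind_def)
  qed (simp_all add: msplits_iff M add.commute)
  then show ?thesis by (simp add: M rind_def)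
next
  case False
  then have "\<forall>p\<in>msplits J. fst p \<noteq> L" by (metis msplits_iff add.commute)
  then have "rprod s (rind L) f J = 0"
    by (simp add: rprod_def rind_def split_def)
  with False show ?thesis by (simp add: shift_def)
qed

lemma rprod_add_left: "rprod s (\<lambda>J. f J + f' J) h J = rprod s f h J + rprod s f' h J"
  by (auto simp: rprod_def split_def sum.distrib algebra_simps)

lemma rprod_add_right: "rprod s f (\<lambda>J. h J + h' J) J = rprod s f h J + rprod s f h' J"
  by (auto simp: rprod_def split_def sum.distrib algebra_simps)

lemma rprod_diff_left: "rprod s (\<lambda>J. f J - f' J) h J = rprod s f h J - rprod s f' h J"
  by (auto simp: rprod_def split_def sum_subtractf algebra_simps)

lemma rprod_diff_right: "rprod s f (\<lambda>J. h J - h' J) J = rprod s f h J - rprod s f h' J"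
  by (auto simp: rprod_def split_def sum_subtractf algebra_simps)

lemma rprod_sgn_left: "rprod s (\<lambda>J. (-1) ^ n * f J) h J = (-1) ^ n * rprod s f h J"
  by (auto simp: rprod_def split_def sum_negf minus_one_power_iff)

lemma rprod_sgn_right: "rprod s f (\<lambda>J. (-1) ^ n * h J) J = (-1) ^ n * rprod s f h J"
  by (auto simp: rprod_def split_def sum_negf minus_one_power_iff)

lemma rprod_parity_cong: "even (s + s') \<Longrightarrow> rprod s f h = rprod s' f h"
proof
  fix J assume "even (s + s')"
  then have "(-1) ^ (s * n) = ((-1) ^ (s' * n) :: 'a)" for n
    by (intro sgn_cong) auto
  then show "rprod s f h J = rprod s' f h J" by (simp add: rprod_def)
qed

section \<open>Matrices that do not raise the degree\<close>

definition below :: "mi \<Rightarrow> mi set" where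
  "below J = {M \<in> MI. deg M \<le> deg J}"

lemma below_iff: "M \<in> below J \<longleftrightarrow> M \<in> MI \<and> deg M \<le> deg J"
  by (simp add: below_def)

lemma finite_below [simp]: "finite (below J)"
proof -
  have "below J \<subseteq> {..deg J} \<times> {..deg J} \<times> {..deg J}"
    by (auto simp: below_def deg_def)
  then show ?thesis by (rule finite_subset) auto
qed

definition lower :: "'b::ring_1 opr \<Rightarrow> bool" where
  "lower T \<longleftrightarrow> (\<forall>K J. T K J \<noteq> 0 \<longrightarrow> K \<in> MI \<and> J \<in> MI \<and> deg K \<le> deg J)"

lemma lowerD: "lower T \<Longrightarrow> T K J \<noteq> 0 \<Longrightarrow> K \<in> MI \<and> J \<in> MI \<and> deg K \<le> deg J"
  unfolding lower_def by blast

lemma lower_outside: "lower T \<Longrightarrow> K \<notin> MI \<or> J \<notin> MI \<Longrightarrow> T K J = 0"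
  by (meson lowerD)

lemma lower_below: "lower T \<Longrightarrow> K \<notin> below J \<Longrightarrow> T K J = 0"
  by (auto simp: below_iff dest: lowerD)

lemma lower_oid: "lower oid"
  by (auto simp: lower_def oid_def)

definition act :: "(mi \<Rightarrow> 'b::ring_1) \<Rightarrow> 'b opr \<Rightarrow> mi \<Rightarrow> 'b" where
  "act f T J = (\<Sum>M\<in>below J. f M * T M J)"

lemma act_superset:
  assumes "lower T" "finite S" "below J \<subseteq> S"
  shows "act f T J = (\<Sum>M\<in>S. f M * T M J)"
  unfolding act_def
  by (rule sum.mono_neutral_left) (use assms in \<open>simp_all add: lower_below\<close>)

lemma ocomp_act: "lower U \<Longrightarrow> ocomp T U K J = act (T K) U J"
  unfolding ocomp_def act_def
  by (rule sum.mono_neutral_left) (auto simp: below_iff dest: lowerD)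

lemma lower_ocomp: "lower T \<Longrightarrow> lower U \<Longrightarrow> lower (ocomp T U)"
  unfolding lower_def
proof (intro allI impI)
  fix K J assume T: "\<forall>K J. T K J \<noteq> 0 \<longrightarrow> K \<in> MI \<and> J \<in> MI \<and> deg K \<le> deg J"
    and U: "\<forall>K J. U K J \<noteq> 0 \<longrightarrow> K \<in> MI \<and> J \<in> MI \<and> deg K \<le> deg J"
    and "ocomp T U K J \<noteq> 0"
  then obtain M where "U M J \<noteq> 0" "T K M * U M J \<noteq> 0"
    unfolding ocomp_def by (auto elim: sum.not_neutral_contains_not_neutral)
  then have "T K M \<noteq> 0" "U M J \<noteq> 0" by auto
  with T U show "K \<in> MI \<and> J \<in> MI \<and> deg K \<le> deg J" by (meson le_trans)
qed

lemma act_act: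
  assumes "lower T" "lower U"
  shows "act (act f T) U J = act f (ocomp T U) J"
proof -
  have "act (act f T) U J = (\<Sum>N\<in>below J. \<Sum>M\<in>below J. f M * T M N * U N J)"
  proof -
    have "act f T N = (\<Sum>M\<in>below J. f M * T M N)" if "N \<in> below J" for N
      using that by (intro act_superset[OF assms(1)]) (auto simp: below_iff)
    then show ?thesis by (simp add: act_def[of "act f T"] sum_distrib_right)
  qed
  also have "\<dots> = (\<Sum>M\<in>below J. \<Sum>N\<in>below J. f M * T M N * U N J)"
    by (rule sum.swap)
  also have "\<dots> = act f (ocomp T U) J"
    by (simp add: act_def ocomp_act[OF assms(2)] sum_distrib_left mult.assoc)
  finally show ?thesis .
qed

lemma ocomp_assoc:
  assumes "lower U" "lower V"
  shows "ocomp (ocomp T U) V = ocomp T (ocomp U V)"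
proof (intro ext)
  fix K J
  have "ocomp (ocomp T U) V K J = act (act (T K) U) V J"
    by (simp add: ocomp_act assms ext[OF ocomp_act[OF assms(1)]])
  then show "ocomp (ocomp T U) V K J = ocomp T (ocomp U V) K J"
    using assms by (simp add: act_act ocomp_act lower_ocomp)
qed

lemma act_oid: "J \<in> MI \<Longrightarrow> act f oid J = f J"
proof -
  assume J: "J \<in> MI"
  then have "act f oid J = (\<Sum>M\<in>{J}. f M * oid M J)"
    unfolding act_def by (intro sum.mono_neutral_right) (auto simp: below_iff oid_def)
  then show ?thesis using J by (simp add: oid_def)
qed

lemma act_rind: "act (rind I) T J = T I J" if "lower T"
proof -
  have "act (rind I) T J = (\<Sum>M\<in>insert I (below J). rind I M * T M J)"
    by (rule act_superset) (use that in auto)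
  also have "\<dots> = (\<Sum>M\<in>{I}. rind I M * T M J)"
    by (rule sum.mono_neutral_right) (auto simp: rind_def)
  finally show ?thesis by (simp add: rind_def)
qed

lemma ocomp_oid_right: "lower T \<Longrightarrow> ocomp T oid = T"
proof (intro ext)
  fix K J assume T: "lower T"
  show "ocomp T oid K J = T K J"
    by (cases "J \<in> MI")
       (simp_all add: ocomp_act lower_oid act_oid lower_outside[OF T] ocomp_def oid_def)
qed

lemma ocomp_oid_left: "lower T \<Longrightarrow> ocomp oid T = T"
proof (intro ext)
  fix K J assume T: "lower T"
  have "(oid K :: mi \<Rightarrow> 'a) = (if K \<in> MI then rind K else (\<lambda>_. 0))"
    by (auto simp: oid_def rind_def)
  then have "act (oid K) T J = (if K \<in> MI then T K J else 0)"
    by (simp add: act_rind[OF T]) (simp add: act_def)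
  then show "ocomp oid T K J = T K J"
    by (simp add: ocomp_act[OF T] lower_outside[OF T])
qed

lemma act_add_left: "act (\<lambda>M. f M + h M) T J = act f T J + act h T J"
  by (simp add: act_def sum.distrib algebra_simps)

lemma act_diff_left: "act (\<lambda>M. f M - h M) T J = act f T J - act h T J"
  by (simp add: act_def sum_subtractf algebra_simps)

lemma act_add_right: "act f (\<lambda>K J. T K J + U K J) J = act f T J + act f U J"
  by (simp add: act_def sum.distrib algebra_simps)

lemma act_diff_right: "act f (\<lambda>K J. T K J - U K J) J = act f T J - act f U J"
  by (simp add: act_def sum_subtractf algebra_simps)

lemma act_sgn_left: "act (\<lambda>M. (-1) ^ n * f M) T J = (-1) ^ n * act f T J"
  by (simp add: act_def sum_distrib_left mult.assoc)

definition product_row :: "'b::ring_1 opr \<Rightarrow> mi \<Rightarrow> mi \<Rightarrow> mi \<Rightarrow> 'b" where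
  "product_row T K L J = (if K + L \<in> MI then T (K + L) J else 0)"

lemma act_rprod:
  assumes Y: "lower Y" and f: "\<forall>M. M \<notin> MI \<longrightarrow> f M = 0" and h: "\<forall>M. M \<notin> MI \<longrightarrow> h M = 0"
  shows "act (rprod q f h) Y J =
    (\<Sum>M\<in>below J. \<Sum>N\<in>below J. (-1) ^ (q * par M) * f M * h N * product_row Y M N J)"
proof -
  have "act (rprod q f h) Y J = (\<Sum>P\<in>below J. \<Sum>p\<in>msplits P.
      (-1) ^ (q * par (fst p)) * f (fst p) * h (snd p) * Y (fst p + snd p) J)"
  proof (unfold act_def, rule sum.cong[OF refl])
    fix P assume P: "P \<in> below J"
    then have "fst P \<le> 1" by (auto simp: below_iff MI_def)
    then show "rprod q f h P * Y P J = (\<Sum>p\<in>msplits P.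
        (-1) ^ (q * par (fst p)) * f (fst p) * h (snd p) * Y (fst p + snd p) J)"
      by (auto simp: rprod_def split_def sum_distrib_right msplits_def intro!: sum.cong)
  qed
  also have "\<dots> = (\<Sum>(P, p)\<in>(SIGMA P:below J. msplits P).
      (-1) ^ (q * par (fst p)) * f (fst p) * h (snd p) * Y (fst p + snd p) J)"
    by (rule sum.Sigma) auto
  also have "\<dots> = (\<Sum>p\<in>snd ` (SIGMA P:below J. msplits P).
      (-1) ^ (q * par (fst p)) * f (fst p) * h (snd p) * Y (fst p + snd p) J)"
    by (subst sum.reindex) (auto simp: inj_on_def msplits_def split_def)
  also have "\<dots> = (\<Sum>p\<in>snd ` (SIGMA P:below J. msplits P).
      (-1) ^ (q * par (fst p)) * f (fst p) * h (snd p) * product_row Y (fst p) (snd p) J)"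
    by (rule sum.cong) (auto simp: product_row_def msplits_iff below_iff)
  also have "\<dots> = (\<Sum>p\<in>below J \<times> below J.
      (-1) ^ (q * par (fst p)) * f (fst p) * h (snd p) * product_row Y (fst p) (snd p) J)"
  proof (rule sum.mono_neutral_cong)
    show "finite (snd ` (SIGMA P:below J. msplits P))" by auto
    fix p assume p: "p \<in> snd ` (SIGMA P:below J. msplits P) - below J \<times> below J"
    have le: "deg (fst p) \<le> deg (fst p + snd p)" "deg (snd p) \<le> deg (fst p + snd p)"
      by (simp_all del: fst_add snd_add)
    from p obtain P where "P \<in> below J" "fst p + snd p = P" by (auto simp: msplits_iff)
    moreover have "fst p \<notin> below J \<or> snd p \<notin> below J" using p by (simp add: mem_Times_iff)
    ultimately have "fst p \<notin> MI \<or> snd p \<notin> MI"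
      using le unfolding below_iff by (metis le_trans)
    then show "(-1) ^ (q * par (fst p)) * f (fst p) * h (snd p) * product_row Y (fst p) (snd p) J = 0"
      using f h by (elim disjE) simp_all
  next
    fix p assume p: "p \<in> below J \<times> below J - snd ` (SIGMA P:below J. msplits P)"
    have "fst p + snd p \<notin> below J"
    proof
      assume "fst p + snd p \<in> below J"
      then have "(fst p + snd p, p) \<in> (SIGMA P:below J. msplits P)"
        by (auto simp: msplits_def split_def)
      then have "p \<in> snd ` (SIGMA P:below J. msplits P)" by force
      with p show False by blast
    qed
    then have "product_row Y (fst p) (snd p) J = 0" by (simp add: product_row_def lower_below[OF Y])
    then show "(-1) ^ (q * par (fst p)) * f (fst p) * h (snd p) * product_row Y (fst p) (snd p) J = 0" by simp
  qed auto
  also have "\<dots> = (\<Sum>M\<in>below J. \<Sum>N\<in>below J. (-1) ^ (q * par M) * f M * h N * product_row Y M N J)"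
    by (simp add: sum.cartesian_product split_def)
  finally show ?thesis .
qed

lemma hpart_cong: "even (p + q) \<Longrightarrow> hpart A p = hpart A q"
  by (auto simp: hpart_def)

context local_superalgebra
begin

lemma sgn_scale: "(-1) ^ n * x = scale A ((-1) ^ n) x"
  by (simp add: minus_one_power_iff)

lemma hpart_zero [simp]: "0 \<in> hpart A p"
  using subspace_hpart subspace_0 by blast

lemma hpart_add: "x \<in> hpart A p \<Longrightarrow> y \<in> hpart A p \<Longrightarrow> x + y \<in> hpart A p"
  using subspace_hpart subspace_add by blast

lemma hpart_diff: "x \<in> hpart A p \<Longrightarrow> y \<in> hpart A p \<Longrightarrow> x - y \<in> hpart A p"
  using subspace_hpart subspace_diff by blast

lemma hpart_minus: "x \<in> hpart A p \<Longrightarrow> - x \<in> hpart A p"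
  using subspace_hpart subspace_neg by blast

lemma hpart_scale: "x \<in> hpart A p \<Longrightarrow> scale A c x \<in> hpart A p"
  using subspace_hpart subspace_scale by blast

lemma hpart_sgn: "x \<in> hpart A p \<Longrightarrow> (-1) ^ n * x \<in> hpart A p"
  by (simp add: sgn_scale hpart_scale)

lemma hpart_sum: "(\<And>i. i \<in> S \<Longrightarrow> f i \<in> hpart A p) \<Longrightarrow> sum f S \<in> hpart A p"
  using subspace_hpart subspace_sum by blast

lemma hpart_mult': "x \<in> hpart A p \<Longrightarrow> y \<in> hpart A q \<Longrightarrow> even (p + q + r) \<Longrightarrow> x * y \<in> hpart A r"
  using hpart_mult[of x p y q] hpart_cong[of "p + q" r A] by simp

lemma of_nat_scale: "of_nat n * x = scale A (of_nat n) x"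
  by (induction n) (simp_all add: scale_left_distrib distrib_right)

lemma hpart_of_nat: "x \<in> hpart A p \<Longrightarrow> of_nat n * x \<in> hpart A p"
  by (simp add: of_nat_scale hpart_scale)

lemma hpart_disjoint: "x \<in> hpart A p \<Longrightarrow> x \<in> hpart A q \<Longrightarrow> odd (p + q) \<Longrightarrow> x = 0"
  using parts_disjoint by (auto simp: hpart_def split: if_splits)

lemma one_even: "1 \<in> hpart A 0"
proof -
  obtain a b where a: "a \<in> even_part A" and b: "b \<in> odd_part A" and ab: "1 = a + b"
    using parts_span by blast
  have a': "a \<in> hpart A 0" and b': "b \<in> hpart A 1" using a b by (auto simp: hpart_def)
  have z: "x * b = 0" if x: "x \<in> hpart A p" for x p
  proof -
    have 1: "x = x * a + x * b" using ab by (metis distrib_left mult.right_neutral)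
    have 2: "x * b = x - x * a" using 1 by (metis add_diff_cancel_left')
    have "x * a \<in> hpart A p" using hpart_mult[OF x a'] by simp
    then have "x * b \<in> hpart A p" using 2 hpart_diff[OF x] by simp
    moreover have "x * b \<in> hpart A (p + 1)" using hpart_mult[OF x b'] .
    ultimately show ?thesis using hpart_disjoint by fastforce
  qed
  have "b = a * b + b * b" using ab by (metis distrib_right mult.left_neutral)
  then have "b = 0" using z[OF a'] z[OF b'] by simp
  then show ?thesis using ab a' by simp
qed

lemma oid_hpart: "oid K J \<in> hpart A (par K + par J)"
proof (cases "K = J")
  case True
  then show ?thesis using one_even hpart_cong[of 0 "par J + par J" A] by (auto simp: oid_def)
qed (simp add: oid_def)

lemma rprod_super:
  assumes f: "\<And>M. f M \<in> hpart A (q + par M)" and h: "\<And>M. h M \<in> hpart A (r + par M)"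
  shows "rprod r f h J = (-1) ^ (q * r) * rprod q h f J"
proof (cases "fst J \<le> 1")
  case True
  have "(\<Sum>p\<in>msplits J. (-1) ^ (r * par (fst p)) * f (fst p) * h (snd p)) =
     (\<Sum>p\<in>msplits J. (-1) ^ (q * r) * ((-1) ^ (q * par (fst p)) * h (fst p) * f (snd p)))"
  proof (rule sum.reindex_bij_witness[where i = "prod.swap" and j = prod.swap], goal_cases)
    case (5 p)
    obtain M N where p: "p = (M, N)" by (cases p)
    have "par M + par N \<le> 1" using 5 True p by (auto simp: msplits_def par_def)
    then have MN: "par M = 0 \<or> par N = 0" by linarith
    have *: "f M * h N = (-1) ^ ((q + par M) * (r + par N)) * (h N * f M)"
      using supercommute[OF f h] .
    have "(-1) ^ (r * par M) * f M * h N =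
        (-1) ^ (r * par M) * ((-1) ^ ((q + par M) * (r + par N)) * (h N * f M))"
      by (metis * mult.assoc)
    also have "\<dots> = (-1) ^ (r * par M + (q + par M) * (r + par N)) * (h N * f M)"
      by (simp add: power_add mult.assoc)
    also have "(-1) ^ (r * par M + (q + par M) * (r + par N)) = ((-1) ^ (q * r + q * par N) :: 'a)"
      by (rule sgn_cong) (use MN in auto)
    finally show ?case
      by (simp add: p power_add mult.assoc)
  qed (auto simp: msplits_def add.commute)
  then show ?thesis using True by (simp add: rprod_def split_def sum_distrib_left)
qed (simp add: rprod_def)

lemma rprod_hpart:
  assumes f: "\<And>M. f M \<in> hpart A (q + par M)" and h: "\<And>M. h M \<in> hpart A (r + par M)"
    and "even (q + r + par J + p)"
  shows "rprod s f h J \<in> hpart A p"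
proof -
  have "(-1) ^ (s * par M) * f M * h N \<in> hpart A p" if "M + N = J" for M N
  proof -
    have "f M * h N \<in> hpart A p"
      using f h by (rule hpart_mult') (use that assms(3) in auto)
    then show ?thesis by (simp add: mult.assoc hpart_sgn)
  qed
  then show ?thesis by (auto simp: rprod_def msplits_def intro!: hpart_sum)
qed

lemma rprod_act_act:
  assumes C: "lower C" "\<And>M J. C M J \<in> hpart A (r + par M + par J)" and D: "lower D"
    and h: "\<And>N. h N \<in> hpart A (q + par N)" and J: "J \<in> MI"
  shows "(\<Sum>M\<in>below J. \<Sum>N\<in>below J. (-1) ^ (q * par M) * f M * h N *
      ((-1) ^ ((r + par M) * par N) * rprod (s + par N) (C M) (D N) J)) =
    (-1) ^ (q * r) * rprod (q + s) (act f C) (act h D) J"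
    (is "?lhs = _")
proof -
  have J1: "fst J \<le> 1" using J by (auto simp: MI_def)
  have "?lhs = (\<Sum>M\<in>below J. \<Sum>N\<in>below J. \<Sum>p\<in>msplits J.
      (-1) ^ (q * r) * ((-1) ^ ((q + s) * par (fst p)) * (f M * C M (fst p)) * (h N * D N (snd p))))"
  proof (intro sum.cong refl)
    fix M N
    have "(-1) ^ (q * par M) * f M * h N * ((-1) ^ ((r + par M) * par N) *
          ((-1) ^ ((s + par N) * par P) * C M P * D N Q)) =
       (-1) ^ (q * r) * ((-1) ^ ((q + s) * par P) * (f M * C M P) * (h N * D N Q))"
      for P Q
    proof -
      have *: "h N * C M P = (-1) ^ ((q + par N) * (r + par M + par P)) * (C M P * h N)"
        using supercommute[OF h C(2)] .
      have "(-1) ^ (q * par M) * f M * h N * ((-1) ^ ((r + par M) * par N) *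
          ((-1) ^ ((s + par N) * par P) * C M P * D N Q)) =
        (-1) ^ (q * par M + (r + par M) * par N + (s + par N) * par P) *
          (f M * (h N * C M P) * D N Q)"
        by (simp only: power_add mult.assoc sgn_mid_commute[of "f M"] sgn_mid_commute[of "h N"])
      also have "\<dots> = (-1) ^ (q * par M + (r + par M) * par N + (s + par N) * par P +
          (q + par N) * (r + par M + par P)) * (f M * (C M P * h N) * D N Q)"
        unfolding * by (simp only: power_add mult.assoc sgn_mid_commute[of "f M"])
      also have "(-1) ^ (q * par M + (r + par M) * par N + (s + par N) * par P +
          (q + par N) * (r + par M + par P)) = ((-1) ^ (q * r + (q + s) * par P) :: 'a)"
        by (rule sgn_cong) (simp, blast)
      finally show ?thesis by (simp add: power_add mult.assoc)
    qed
    then show "(-1) ^ (q * par M) * f M * h N *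
      ((-1) ^ ((r + par M) * par N) * rprod (s + par N) (C M) (D N) J) = (\<Sum>p\<in>msplits J.
      (-1) ^ (q * r) * ((-1) ^ ((q + s) * par (fst p)) * (f M * C M (fst p)) * (h N * D N (snd p))))"
      using J1 by (simp add: rprod_def split_def sum_distrib_left)
  qed
  also have "\<dots> = (\<Sum>p\<in>msplits J. \<Sum>M\<in>below J. \<Sum>N\<in>below J.
      (-1) ^ (q * r) * ((-1) ^ ((q + s) * par (fst p)) * (f M * C M (fst p)) * (h N * D N (snd p))))"
    by (simp only: sum.swap[of _ "msplits J" "below J"])
  also have "\<dots> = (\<Sum>p\<in>msplits J.
      (-1) ^ (q * r) * ((-1) ^ ((q + s) * par (fst p)) * act f C (fst p) * act h D (snd p)))"
  proof (rule sum.cong[OF refl])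
    fix p assume "p \<in> msplits J"
    then have "below (fst p) \<subseteq> below J" "below (snd p) \<subseteq> below J"
      by (auto simp: msplits_iff below_iff)
    then have "act f C (fst p) = (\<Sum>M\<in>below J. f M * C M (fst p))"
      "act h D (snd p) = (\<Sum>M\<in>below J. h M * D M (snd p))"
      by (simp_all add: act_superset[OF C(1)] act_superset[OF D])
    then show "(\<Sum>M\<in>below J. \<Sum>N\<in>below J.
      (-1) ^ (q * r) * ((-1) ^ ((q + s) * par (fst p)) * (f M * C M (fst p)) * (h N * D N (snd p)))) =
      (-1) ^ (q * r) * ((-1) ^ ((q + s) * par (fst p)) * act f C (fst p) * act h D (snd p))"
      by (simp only: sum_sum_mult)
  qed
  also have "\<dots> = (-1) ^ (q * r) * rprod (q + s) (act f C) (act h D) J"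
    using J1 by (simp add: rprod_def split_def sum_distrib_left)
  finally show ?thesis .
qed

end

lemma act_cong: "(\<And>M. M \<in> MI \<Longrightarrow> f M = h M) \<Longrightarrow> act f T J = act h T J"
  by (auto simp: act_def below_def intro!: sum.cong)

lemma rprod_nonzero:
  assumes "rprod s f h J \<noteq> 0"
  obtains M N where "M + N = J" "f M \<noteq> 0" "h N \<noteq> 0"
proof -
  have "(\<Sum>p\<in>msplits J. (-1) ^ (s * par (fst p)) * f (fst p) * h (snd p)) \<noteq> 0"
    using assms by (simp add: rprod_def split_def split: if_splits)
  then obtain p where "p \<in> msplits J" "(-1) ^ (s * par (fst p)) * f (fst p) * h (snd p) \<noteq> 0"
    by (rule sum.not_neutral_contains_not_neutral)
  then have "fst p + snd p = J" "f (fst p) \<noteq> 0" "h (snd p) \<noteq> 0" by (auto simp: msplits_iff)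
  then show ?thesis by (rule that)
qed

section \<open>Coderivations and coalgebra morphisms in the normalized basis\<close>

text \<open>
  In the basis \<open>w_J / J!\<close> of \<open>S(W)\<close> the comultiplication has no binomial coefficients, and the
  \<open>K\<close>-th row of the matrix of a coderivation (coalgebra morphism) becomes the image of \<open>x^K\<close> under
  the dual derivation (homomorphism) of the algebra of power series in \<open>x\<^sub>1\<close> (odd), \<open>x\<^sub>2\<close>, \<open>x\<^sub>3\<close>.
\<close>

definition normalized :: "'b::ring_1 salg \<Rightarrow> 'b opr \<Rightarrow> 'b opr" where
  "normalized A T K J = scale A (of_nat (mfact K) / of_nat (mfact J)) (T K J)"

definition denormalized :: "'b::ring_1 salg \<Rightarrow> 'b opr \<Rightarrow> 'b opr" where
  "denormalized A T K J = scale A (of_nat (mfact J) / of_nat (mfact K)) (T K J)"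

definition derivation :: "nat \<Rightarrow> 'b::ring_1 opr \<Rightarrow> bool" where
  "derivation p T \<longleftrightarrow> (\<forall>K\<in>MI. \<forall>L\<in>MI. \<forall>J\<in>MI. product_row T K L J =
     (-1) ^ ((p + par K) * par L) * rprod (par L) (T K) (oid L) J +
     (-1) ^ (par K * par L) * rprod (p + par L) (oid K) (T L) J)"

definition multiplicative :: "'b::ring_1 opr \<Rightarrow> bool" where
  "multiplicative g \<longleftrightarrow> (\<forall>K\<in>MI. \<forall>L\<in>MI. \<forall>J\<in>MI.
     product_row g K L J = (-1) ^ (par K * par L) * rprod (par L) (g K) (g L) J)"

definition MIsupported :: "'b::ring_1 opr \<Rightarrow> bool" where
  "MIsupported T \<longleftrightarrow> (\<forall>K J. K \<notin> MI \<or> J \<notin> MI \<longrightarrow> T K J = 0)"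

lemma mivanD: "MIsupported T \<Longrightarrow> K \<notin> MI \<or> J \<notin> MI \<Longrightarrow> T K J = 0"
  by (simp add: MIsupported_def)

lemma lower_MIsupported: "lower T \<Longrightarrow> MIsupported T"
  by (simp add: MIsupported_def lower_outside)

lemma mfact_nz [simp]: "mfact K \<noteq> 0" "0 < mfact K"
  by (simp_all add: mfact_def)

lemma mbinom_mfact:
  "(of_nat (mbinom (M + N) M) :: complex) = of_nat (mfact (M + N)) / (of_nat (mfact M) * of_nat (mfact N))"
  by (simp add: mbinom_def mfact_def binomial_fact)

lemma derivation_lower:
  assumes "MIsupported T" "derivation p T"
  shows "lower T"
proof -
  have "\<forall>J. T K J \<noteq> 0 \<longrightarrow> deg K \<le> deg J" if "K \<in> MI" for K
    using that
  proof (induction rule: mi_induct)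
    case (evec j)
    have "deg (evec j) = 1" using evec by (auto simp: deg_def evec_def)
    then show ?case using MI_deg mivanD[OF assms(1)] by metis
  next
    case (add K L)
    show ?case
    proof (intro allI impI)
      fix J assume nz: "T (K + L) J \<noteq> 0"
      then have J: "J \<in> MI" using mivanD[OF assms(1)] by blast
      have "T (K + L) J = (-1) ^ ((p + par K) * par L) * rprod (par L) (T K) (oid L) J +
          (-1) ^ (par K * par L) * rprod (p + par L) (oid K) (T L) J"
        using assms(2) add J unfolding derivation_def product_row_def by (metis (no_types, lifting))
      then consider "rprod (par L) (T K) (oid L) J \<noteq> 0" | "rprod (p + par L) (oid K) (T L) J \<noteq> 0"
        using nz by fastforce
      then show "deg (K + L) \<le> deg J"
      proof cases
        case 1
        then obtain M N where *: "M + N = J" "T K M \<noteq> 0" "oid L N \<noteq> (0 :: 'a)" by (rule rprod_nonzero)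
        then have "deg K \<le> deg M" "N = L" using add.IH by (auto simp: oid_def split: if_splits)
        then show ?thesis using *(1) by auto
      next
        case 2
        then obtain M N where *: "M + N = J" "oid K M \<noteq> (0 :: 'a)" "T L N \<noteq> 0" by (rule rprod_nonzero)
        then have "deg L \<le> deg N" "M = K" using add.IH by (auto simp: oid_def split: if_splits)
        then show ?thesis using *(1) by auto
      qed
    qed
  qed
  then show ?thesis using mivanD[OF assms(1)] unfolding lower_def by blast
qed

lemma multiplicative_lower:
  assumes "MIsupported g" "multiplicative g"
  shows "lower g"
proof -
  have "\<forall>J. g K J \<noteq> 0 \<longrightarrow> deg K \<le> deg J" if "K \<in> MI" for K
    using that
  proof (induction rule: mi_induct)
    case (evec j)
    have "deg (evec j) = 1" using evec by (auto simp: deg_def evec_def)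
    then show ?case using MI_deg mivanD[OF assms(1)] by metis
  next
    case (add K L)
    show ?case
    proof (intro allI impI)
      fix J assume nz: "g (K + L) J \<noteq> 0"
      then have J: "J \<in> MI" using mivanD[OF assms(1)] by blast
      have "g (K + L) J = (-1) ^ (par K * par L) * rprod (par L) (g K) (g L) J"
        using assms(2) add J unfolding multiplicative_def product_row_def by (metis (no_types, lifting))
      then have "rprod (par L) (g K) (g L) J \<noteq> 0" using nz by fastforce
      then obtain M N where *: "M + N = J" "g K M \<noteq> 0" "g L N \<noteq> 0" by (rule rprod_nonzero)
      then have "deg K \<le> deg M" "deg L \<le> deg N" using add.IH by blast+
      then show "deg (K + L) \<le> deg J" using *(1) by auto
    qed
  qed
  then show ?thesis using mivanD[OF assms(1)] unfolding lower_def by blast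
qed

lemma derivation_eqI:
  assumes "MIsupported T" "MIsupported U" "derivation p T" "derivation p U"
    and e: "\<And>j J. j \<in> {1, 2, 3} \<Longrightarrow> J \<in> MI \<Longrightarrow> T (evec j) J = U (evec j) J"
  shows "T = U"
proof -
  have "T K = U K" if "K \<in> MI" for K
    using that
  proof (induction rule: mi_induct)
    case (evec j)
    show ?case
    proof
      fix J show "T (evec j) J = U (evec j) J"
        using e[OF evec] mivanD[OF assms(1)] mivanD[OF assms(2)] by (cases "J \<in> MI") auto
    qed
  next
    case (add K L)
    show ?case
    proof
      fix J show "T (K + L) J = U (K + L) J"
      proof (cases "J \<in> MI")
        case True
        have "product_row T K L J = product_row U K L J"
          using assms(3,4) add True unfolding derivation_def by (metis (no_types, lifting))
        then show ?thesis using add by (simp add: product_row_def)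
      qed (use mivanD[OF assms(1)] mivanD[OF assms(2)] in simp)
    qed
  qed
  then show ?thesis
    using mivanD[OF assms(1)] mivanD[OF assms(2)] by (intro ext) metis
qed

context local_superalgebra
begin

definition homogeneous :: "nat \<Rightarrow> 'a opr \<Rightarrow> bool" where
  "homogeneous p T \<longleftrightarrow> (\<forall>K J. T K J \<in> hpart A (p + par K + par J))"

lemma hopD: "homogeneous p T \<Longrightarrow> T K J \<in> hpart A (p + par K + par J)"
  by (simp add: homogeneous_def)

lemma homogeneous_oid: "homogeneous 0 oid"
  using oid_hpart by (simp add: homogeneous_def)

lemma normalized_denormalized [simp]: "normalized A (denormalized A T) = T"
  by (intro ext) (simp add: normalized_def denormalized_def)

lemma denormalized_normalized [simp]: "denormalized A (normalized A T) = T"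
  by (intro ext) (simp add: normalized_def denormalized_def)

lemma normalized_eq_0 [simp]: "normalized A T K J = 0 \<longleftrightarrow> T K J = 0"
  by (simp add: normalized_def scale_eq_0_iff)

lemma denormalized_eq_0 [simp]: "denormalized A T K J = 0 \<longleftrightarrow> T K J = 0"
  by (simp add: denormalized_def scale_eq_0_iff)

lemma normalized_oid [simp]: "normalized A oid = oid"
  by (intro ext) (auto simp: normalized_def oid_def)

lemma normalized_inject: "normalized A T = normalized A U \<longleftrightarrow> T = U"
  by (metis denormalized_normalized)

lemma normalized_ocomp: "normalized A (ocomp T U) = ocomp (normalized A T) (normalized A U)"
proof (intro ext)
  fix K J
  have "scale A (of_nat (mfact K) / of_nat (mfact J)) (T K M * U M J) = normalized A T K M * normalized A U M J" for M
    by (simp add: normalized_def flip: scale_mult_left scale_mult_right)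
  then show "normalized A (ocomp T U) K J = ocomp (normalized A T) (normalized A U) K J"
    by (simp add: normalized_def[of A "ocomp T U"] ocomp_def scale_sum_right)
qed

lemma normalized_hpart: "normalized A T K J \<in> hpart A p \<longleftrightarrow> T K J \<in> hpart A p"
  by (metis hpart_scale normalized_def denormalized_def denormalized_normalized)

lemma normalized_oprs: "normalized A T \<in> oprs A p \<longleftrightarrow> T \<in> oprs A p"
  by (simp add: oprs_def normalized_hpart)

lemma oprs_lower: "T \<in> oprs A p \<longleftrightarrow> homogeneous p T \<and> MIsupported T" if "lower T"
proof -
  have "finite {K. T K J \<noteq> 0}" for J
    by (rule finite_subset[of _ "below J"]) (use lower_below[OF that] finite_below in blast)+
  then show ?thesis by (auto simp: oprs_def homogeneous_def MIsupported_def)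
qed

lemma oprs_homogeneous: "T \<in> oprs A p \<Longrightarrow> homogeneous p T \<and> MIsupported T"
  by (auto simp: oprs_def homogeneous_def MIsupported_def)

lemma otens_sum:
  assumes T: "MIsupported T" and U: "MIsupported U" and J: "J \<in> MI"
  shows "(\<Sum>(M, N)\<in>splits J. otens p q T U K L M N * cop M N J) =
    scale A (of_nat (mfact J) / (of_nat (mfact K) * of_nat (mfact L)))
      ((-1) ^ ((p + par K) * par L) * rprod (q + par L) (normalized A T K) (normalized A U L) J)"
proof -
  let ?c = "of_nat (mfact J) / (of_nat (mfact K) * of_nat (mfact L)) :: complex"
  have J1: "fst J \<le> 1" using J by (auto simp: MI_def)
  have "(\<Sum>(M, N)\<in>splits J. otens p q T U K L M N * cop M N J) =
    (\<Sum>p'\<in>splits J. scale A ?c ((-1) ^ ((p + par K) * par L) *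
      ((-1) ^ ((q + par L) * par (fst p')) * normalized A T K (fst p') * normalized A U L (snd p'))))"
  proof (rule sum.cong[OF refl])
    fix p' assume "p' \<in> splits J"
    then obtain M N where p': "p' = (M, N)" and "(M, N) \<in> splits J" by (cases p') blast
    then have M: "M \<in> MI" "N \<in> MI" "M + N = J" by (auto simp: splits_def)
    have "cop M N J = (of_nat (mbinom J M) :: 'a)" using M J by (simp add: cop_def)
    then have "otens p q T U K L M N * cop M N J =
        (-1) ^ (q * par M + (p + par K + par M) * par L) * (of_nat (mbinom J M) * (T K M * U L N))"
      by (metis (no_types, lifting) otens_def mult.assoc mult_of_nat_commute)
    also have "of_nat (mbinom J M) * (T K M * U L N) =
        scale A (of_nat (mfact J) / (of_nat (mfact M) * of_nat (mfact N))) (T K M * U L N)"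
      by (simp add: of_nat_scale mbinom_mfact flip: M(3))
    also have "\<dots> = scale A ?c (normalized A T K M * normalized A U L N)"
      by (simp add: normalized_def flip: scale_mult_left scale_mult_right)
    also have "q * par M + (p + par K + par M) * par L = (p + par K) * par L + (q + par L) * par M"
      by (simp add: algebra_simps)
    finally show "(case p' of (M, N) \<Rightarrow> otens p q T U K L M N * cop M N J) =
        scale A ?c ((-1) ^ ((p + par K) * par L) *
          ((-1) ^ ((q + par L) * par (fst p')) * normalized A T K (fst p') * normalized A U L (snd p')))"
      unfolding p' prod.case
      by (simp only: fst_conv snd_conv power_add mult.assoc scale_mult_right)
  qed
  also have "\<dots> = (\<Sum>p'\<in>msplits J. scale A ?c ((-1) ^ ((p + par K) * par L) *
      ((-1) ^ ((q + par L) * par (fst p')) * normalized A T K (fst p') * normalized A U L (snd p'))))"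
  proof (rule sum.mono_neutral_left[OF _ splits_subset])
    show "\<forall>i\<in>msplits J - splits J. scale A ?c ((-1) ^ ((p + par K) * par L) *
        ((-1) ^ ((q + par L) * par (fst i)) * normalized A T K (fst i) * normalized A U L (snd i))) = 0"
    proof
      fix i assume "i \<in> msplits J - splits J"
      then have "fst i \<notin> MI \<or> snd i \<notin> MI" by (auto simp: msplits_def splits_def)
      then have "normalized A T K (fst i) = 0 \<or> normalized A U L (snd i) = 0"
        using mivanD[OF T] mivanD[OF U] by (metis normalized_eq_0)
      then show "scale A ?c ((-1) ^ ((p + par K) * par L) *
        ((-1) ^ ((q + par L) * par (fst i)) * normalized A T K (fst i) * normalized A U L (snd i))) = 0"
        by (elim disjE) (simp_all del: normalized_eq_0)
    qed
  qed simp
  also have "\<dots> = scale A ?c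
      ((-1) ^ ((p + par K) * par L) * rprod (q + par L) (normalized A T K) (normalized A U L) J)"
    using J1 by (simp add: rprod_def split_def sum_distrib_left scale_sum_right)
  finally show ?thesis .
qed

lemma cop_sum:
  assumes T: "MIsupported T" "finite {M. T M J \<noteq> 0}" and "K \<in> MI" "L \<in> MI"
  shows "(\<Sum>M | T M J \<noteq> 0. cop K L M * T M J) =
    scale A (of_nat (mfact J) / (of_nat (mfact K) * of_nat (mfact L))) (product_row (normalized A T) K L J)"
proof -
  have "(\<Sum>M | T M J \<noteq> 0. cop K L M * T M J) = (\<Sum>M\<in>insert (K + L) {M. T M J \<noteq> 0}. cop K L M * T M J)"
    by (rule sum.mono_neutral_left) (use T in auto)
  also have "\<dots> = (\<Sum>M\<in>{K + L}. cop K L M * T M J)"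
    by (rule sum.mono_neutral_right) (use T in \<open>auto simp: cop_def\<close>)
  also have "\<dots> = (if K + L \<in> MI then of_nat (mbinom (K + L) K) * T (K + L) J else 0)"
    using assms by (simp add: cop_def)
  also have "\<dots> = scale A (of_nat (mfact J) / (of_nat (mfact K) * of_nat (mfact L))) (product_row (normalized A T) K L J)"
    by (simp add: product_row_def of_nat_scale normalized_def mbinom_mfact)
  finally show ?thesis .
qed

lemma coderivation_iff: "coderivation A p T \<longleftrightarrow> T \<in> oprs A p \<and> derivation p (normalized A T)"
proof (cases "T \<in> oprs A p")
  case True
  then have T: "MIsupported T" "\<And>J. finite {M. T M J \<noteq> 0}" by (auto simp: oprs_def MIsupported_def)
  have o: "MIsupported oid" by (auto simp: MIsupported_def oid_def)
  show ?thesis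
    unfolding coderivation_def derivation_def
    by (simp add: True cop_sum[OF T] distrib_right split_def sum.distrib
        otens_sum[OF T(1) o, unfolded split_def] otens_sum[OF o T(1), unfolded split_def]
        flip: scale_right_distrib cong: ball_cong) blast
qed (simp add: coderivation_def)

lemma coalgebra_automorphism_iff:
  "coalgebra_automorphism A g \<longleftrightarrow> g \<in> oprs A 0 \<and>
     (\<exists>h\<in>oprs A 0. ocomp g h = oid \<and> ocomp h g = oid) \<and> multiplicative (normalized A g)"
proof (cases "g \<in> oprs A 0")
  case True
  then have g: "MIsupported g" "\<And>J. finite {M. g M J \<noteq> 0}" by (auto simp: oprs_def MIsupported_def)
  show ?thesis
    unfolding coalgebra_automorphism_def multiplicative_def
    by (simp add: True cop_sum[OF g] otens_sum[OF g(1) g(1)] cong: ball_cong) blast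
qed (simp add: coalgebra_automorphism_def)

lemma act_oid_fun: "\<forall>M. M \<notin> MI \<longrightarrow> f M = 0 \<Longrightarrow> act f oid = f"
proof
  fix J assume f: "\<forall>M. M \<notin> MI \<longrightarrow> f M = 0"
  show "act f oid J = f J"
  proof (cases "J \<in> MI")
    case False
    then show ?thesis using f by (simp add: act_def oid_def)
  qed (simp add: act_oid)
qed

lemma oid_rind: "K \<in> MI \<Longrightarrow> oid K = rind K"
  by (auto simp: oid_def rind_def)

lemma act_oid_left: "lower T \<Longrightarrow> K \<in> MI \<Longrightarrow> act (oid K) T = T K"
  by (intro ext) (simp add: oid_rind act_rind)

lemma act_derivation:
  assumes U: "lower U" "derivation q U" "homogeneous q U"
    and f: "\<forall>M. M \<notin> MI \<longrightarrow> f M = 0" and h: "\<forall>M. M \<notin> MI \<longrightarrow> h M = 0"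
    and hp: "\<And>N. h N \<in> hpart A (r + par N)" and J: "J \<in> MI"
  shows "act (rprod r f h) U J =
    (-1) ^ (r * q) * rprod r (act f U) h J + rprod (r + q) f (act h U) J"
proof -
  have "act (rprod r f h) U J = (\<Sum>M\<in>below J. \<Sum>N\<in>below J. (-1) ^ (r * par M) * f M * h N *
      ((-1) ^ ((q + par M) * par N) * rprod (0 + par N) (U M) (oid N) J +
       (-1) ^ ((0 + par M) * par N) * rprod (q + par N) (oid M) (U N) J))"
  proof (subst act_rprod[OF U(1) f h], intro sum.cong refl, goal_cases)
    case (1 M N)
    then have "M \<in> MI" "N \<in> MI" by (auto simp: below_iff)
    then show ?case using U(2) J unfolding derivation_def by simp
  qed
  also have "\<dots> = (-1) ^ (r * q) * rprod (r + 0) (act f U) (act h oid) J +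
      (-1) ^ (r * 0) * rprod (r + q) (act f oid) (act h U) J"
    unfolding distrib_left sum.distrib
    by (subst rprod_act_act[OF U(1) hopD[OF U(3)] lower_oid hp J],
        subst rprod_act_act[OF lower_oid hopD[OF homogeneous_oid] U(1) hp J]) (rule refl)
  finally show ?thesis by (simp add: act_oid_fun f h)
qed

lemma act_multiplicative:
  assumes g: "lower g" "multiplicative g" "homogeneous 0 g"
    and f: "\<forall>M. M \<notin> MI \<longrightarrow> f M = 0" and h: "\<forall>M. M \<notin> MI \<longrightarrow> h M = 0"
    and hp: "\<And>N. h N \<in> hpart A (r + par N)" and J: "J \<in> MI"
  shows "act (rprod r f h) g J = rprod r (act f g) (act h g) J"
proof -
  have "act (rprod r f h) g J = (\<Sum>M\<in>below J. \<Sum>N\<in>below J. (-1) ^ (r * par M) * f M * h N *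
      ((-1) ^ ((0 + par M) * par N) * rprod (0 + par N) (g M) (g N) J))"
  proof (subst act_rprod[OF g(1) f h], intro sum.cong refl, goal_cases)
    case (1 M N)
    then have "M \<in> MI" "N \<in> MI" by (auto simp: below_iff)
    then show ?case using g(2) J unfolding multiplicative_def by simp
  qed
  also have "\<dots> = (-1) ^ (r * 0) * rprod (r + 0) (act f g) (act h g) J"
    by (subst rprod_act_act[OF g(1) hopD[OF g(3)] g(1) hp J]) (rule refl)
  finally show ?thesis by simp
qed

lemma product_row_ocomp: "lower U \<Longrightarrow> product_row (ocomp T U) K L J = act (product_row T K L) U J"
  by (cases "K + L \<in> MI") (simp_all add: product_row_def ocomp_act act_def)

lemma product_row_ocomp_derivation_derivation:
  assumes T: "MIsupported T" "derivation p T" "homogeneous p T" and U: "MIsupported U" "derivation q U" "homogeneous q U"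
    and KLJ: "K \<in> MI" "L \<in> MI" "J \<in> MI"
  shows "product_row (ocomp T U) K L J =
    (-1) ^ ((p + q + par K) * par L) * rprod (par L) (ocomp T U K) (oid L) J +
    (-1) ^ ((p + par K) * par L) * rprod (par L + q) (T K) (U L) J +
    (-1) ^ (par K * par L + (p + par L) * q) * rprod (p + par L) (U K) (T L) J +
    (-1) ^ (par K * par L) * rprod (p + q + par L) (oid K) (ocomp T U L) J"
proof -
  have lT: "lower T" and lU: "lower U" using derivation_lower T U by blast+
  have v: "\<forall>N. N \<notin> MI \<longrightarrow> T M N = 0" for M using mivanD[OF T(1)] by blast
  have vo: "\<forall>N. N \<notin> MI \<longrightarrow> oid M N = (0 :: 'a)" for M by (simp add: oid_def)
  have o: "oid L N \<in> hpart A (par L + par N)" for N by (rule oid_hpart)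
  have t: "T L N \<in> hpart A (p + par L + par N)" for N using hopD[OF T(3)] .
  have "product_row (ocomp T U) K L J = act (product_row T K L) U J" by (rule product_row_ocomp[OF lU])
  also have "\<dots> = act (\<lambda>J. (-1) ^ ((p + par K) * par L) * rprod (par L) (T K) (oid L) J +
     (-1) ^ (par K * par L) * rprod (p + par L) (oid K) (T L) J) U J"
    by (rule act_cong) (use T(2) KLJ in \<open>simp add: derivation_def\<close>)
  also have "\<dots> = (-1) ^ ((p + par K) * par L) * ((-1) ^ (par L * q) *
        rprod (par L) (ocomp T U K) (oid L) J + rprod (par L + q) (T K) (U L) J) +
      (-1) ^ (par K * par L) * ((-1) ^ ((p + par L) * q) *
        rprod (p + par L) (U K) (T L) J + rprod (p + par L + q) (oid K) (ocomp T U L) J)"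
    by (simp add: act_add_left act_sgn_left act_derivation[OF lU U(2,3) v vo o KLJ(3)]
       act_derivation[OF lU U(2,3) vo v t KLJ(3)] act_oid_left[OF lU] KLJ ext[OF ocomp_act[OF lU]])
  finally have *: "product_row (ocomp T U) K L J = \<dots>" .
  have e: "(p + q + par K) * par L = (p + par K) * par L + par L * q" "p + q + par L = p + par L + q"
    by (simp_all add: algebra_simps)
  show ?thesis
    unfolding * e
    by (simp only: distrib_left mult.assoc[symmetric] power_add[symmetric] add.assoc)
qed

lemma derivation_brk:
  assumes T: "MIsupported T" "derivation p T" "homogeneous p T" and U: "MIsupported U" "derivation q U" "homogeneous q U"
  shows "derivation (p + q) (brk p q T U)"
  unfolding derivation_def
proof (intro ballI)
  fix K L J assume KLJ: "K \<in> MI" "L \<in> MI" "J \<in> MI"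
  let ?k = "par K" and ?l = "par L"
  have b: "brk p q T U K = (\<lambda>J. ocomp T U K J - (-1) ^ (p * q) * ocomp U T K J)" for K
    by (rule ext) (simp add: brk_def)
  have "product_row (brk p q T U) K L J = product_row (ocomp T U) K L J - (-1) ^ (p * q) * product_row (ocomp U T) K L J"
    by (simp add: product_row_def brk_def)
  also have "\<dots> =
     (-1) ^ ((p + q + ?k) * ?l) * rprod ?l (brk p q T U K) (oid L) J +
     ((-1) ^ ((p + ?k) * ?l) - (-1) ^ (p * q + (?k * ?l + (q + ?l) * p))) * rprod (?l + q) (T K) (U L) J +
     ((-1) ^ (?k * ?l + (p + ?l) * q) - (-1) ^ (p * q + (q + ?k) * ?l)) * rprod (p + ?l) (U K) (T L) J +
     (-1) ^ (?k * ?l) * rprod (p + q + ?l) (oid K) (brk p q T U L) J"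
    unfolding product_row_ocomp_derivation_derivation[OF T U KLJ] product_row_ocomp_derivation_derivation[OF U T KLJ] b
      rprod_diff_left rprod_diff_right rprod_sgn_left rprod_sgn_right power_add[of _ "p * q"]
    by (simp add: right_diff_distrib left_diff_distrib distrib_left mult.assoc sgn_left_commute
        add.commute[of q p] add.commute[of q ?l] add.commute[of ?l p])
  also have "(-1) ^ (p * q + (?k * ?l + (q + ?l) * p)) = ((-1) ^ ((p + ?k) * ?l) :: 'a)"
    by (rule sgn_cong) auto
  also have "(-1) ^ (p * q + (q + ?k) * ?l) = ((-1) ^ (?k * ?l + (p + ?l) * q) :: 'a)"
    by (rule sgn_cong) auto
  finally show "product_row (brk p q T U) K L J =
     (-1) ^ ((p + q + ?k) * ?l) * rprod ?l (brk p q T U K) (oid L) J +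
     (-1) ^ (?k * ?l) * rprod (p + q + ?l) (oid K) (brk p q T U L) J"
    by simp
qed

lemma product_row_intertwine:
  assumes T: "MIsupported T" "derivation p T" "homogeneous p T" and U: "MIsupported U" "derivation p U" "homogeneous p U"
    and g: "MIsupported g" "multiplicative g" "homogeneous 0 g"
    and E: "E = (\<lambda>K J. ocomp T g K J - ocomp g U K J)"
    and KLJ: "K \<in> MI" "L \<in> MI" "J \<in> MI"
  shows "product_row E K L J = (-1) ^ ((p + par K) * par L) * rprod (par L) (E K) (g L) J +
    (-1) ^ (par K * par L) * rprod (p + par L) (g K) (E L) J"
proof -
  have lT: "lower T" and lU: "lower U" and lg: "lower g"
    using derivation_lower multiplicative_lower T U g by blast+
  have v: "\<forall>N. N \<notin> MI \<longrightarrow> T M N = 0" for M using mivanD[OF T(1)] by blast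
  have vg: "\<forall>N. N \<notin> MI \<longrightarrow> g M N = 0" for M using mivanD[OF g(1)] by blast
  have vo: "\<forall>N. N \<notin> MI \<longrightarrow> oid M N = (0 :: 'a)" for M by (simp add: oid_def)
  have o: "oid L N \<in> hpart A (par L + par N)" for N by (rule oid_hpart)
  have t: "T L N \<in> hpart A (p + par L + par N)" for N using hopD[OF T(3)] .
  have gl: "g L N \<in> hpart A (par L + par N)" for N using hopD[OF g(3), of L N] by simp
  have 1: "product_row (ocomp T g) K L J =
     (-1) ^ ((p + par K) * par L) * rprod (par L) (ocomp T g K) (g L) J +
     (-1) ^ (par K * par L) * rprod (p + par L) (g K) (ocomp T g L) J"
  proof -
    have "product_row (ocomp T g) K L J = act (product_row T K L) g J" by (rule product_row_ocomp[OF lg])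
    also have "\<dots> = act (\<lambda>J. (-1) ^ ((p + par K) * par L) * rprod (par L) (T K) (oid L) J +
       (-1) ^ (par K * par L) * rprod (p + par L) (oid K) (T L) J) g J"
      by (rule act_cong) (use T(2) KLJ in \<open>simp add: derivation_def\<close>)
    finally show ?thesis
      by (simp add: act_add_left act_sgn_left act_multiplicative[OF lg g(2,3) v vo o KLJ(3)]
       act_multiplicative[OF lg g(2,3) vo v t KLJ(3)] act_oid_left[OF lg] KLJ ext[OF ocomp_act[OF lg]])
  qed
  have 2: "product_row (ocomp g U) K L J =
     (-1) ^ ((p + par K) * par L) * rprod (par L) (ocomp g U K) (g L) J +
     (-1) ^ (par K * par L) * rprod (p + par L) (g K) (ocomp g U L) J"
  proof -
    have "product_row (ocomp g U) K L J = act (product_row g K L) U J" by (rule product_row_ocomp[OF lU])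
    also have "\<dots> = act (\<lambda>J. (-1) ^ (par K * par L) * rprod (par L) (g K) (g L) J) U J"
      by (rule act_cong) (use g(2) KLJ in \<open>simp add: multiplicative_def\<close>)
    also have "\<dots> = (-1) ^ (par K * par L) * ((-1) ^ (par L * p) *
        rprod (par L) (ocomp g U K) (g L) J + rprod (par L + p) (g K) (ocomp g U L) J)"
      by (simp add: act_sgn_left act_derivation[OF lU U(2,3) vg vg gl KLJ(3)] ext[OF ocomp_act[OF lU]])
    finally have *: "product_row (ocomp g U) K L J = \<dots>" .
    have e: "(p + par K) * par L = par K * par L + par L * p" "p + par L = par L + p"
      by (simp_all add: algebra_simps)
    show ?thesis
      unfolding * e
      by (simp only: distrib_left mult.assoc[symmetric] power_add[symmetric])
  qed
  have "product_row E K L J = product_row (ocomp T g) K L J - product_row (ocomp g U) K L J"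
    by (simp add: product_row_def E)
  then show ?thesis
    unfolding 1 2 E rprod_diff_left rprod_diff_right by (simp add: algebra_simps)
qed

end

section \<open>The coderivation of a vector field\<close>

lemma shift_0 [simp]: "shift 0 f = f" "shift (0, 0, 0) f = f"
proof -
  show "shift 0 f = f" by (rule ext) (metis add.right_neutral shift_add)
  then show "shift (0, 0, 0) f = f" by (simp add: zero_prod_def)
qed

lemma shift_plus: "shift L (\<lambda>M. f M + g M) J = shift L f J + shift L g J"
  by (simp add: shift_def)

lemma shift_mult: "shift L (\<lambda>M. c * f M) J = c * shift L f J"
  by (simp add: shift_def)

lemma shift_zero_fun: "shift L (\<lambda>M. 0) J = 0"
  by (simp add: shift_def)

lemma shift_shift: "shift L (shift M f) J = shift (M + L) f J"
proof (cases "\<exists>N. J = N + (M + L)")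
  case True
  then obtain N where N: "J = N + (M + L)" by blast
  then have "shift (M + L) f J = f N" by (metis shift_add)
  moreover have "shift L (shift M f) J = f N" unfolding N add.assoc[symmetric] by (simp only: shift_add)
  ultimately show ?thesis by simp
next
  case False
  show ?thesis
  proof (cases "\<exists>P. J = P + L")
    case True
    then obtain P where P: "J = P + L" by blast
    have "shift L (shift M f) J = shift M f P" unfolding P by (rule shift_add)
    also have "\<dots> = 0" using False P by (intro shift_eq_0) (auto simp: add.assoc)
    finally show ?thesis using False by (simp add: shift_def)
  qed (use False in \<open>simp add: shift_def\<close>)
qed

lemma shift_eq: "shift (a, b, c) f (a', b', c') =
  (if a \<le> a' \<and> b \<le> b' \<and> c \<le> c' then f (a' - a, b' - b, c' - c) else 0)"
proof (cases "a \<le> a' \<and> b \<le> b' \<and> c \<le> c'")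
  case True
  then have e: "(a', b', c') = (a' - a, b' - b, c' - c) + (a, b, c)" by simp
  show ?thesis using True by (subst e, subst shift_add) simp
next
  case False
  then show ?thesis by (auto intro!: shift_eq_0)
qed

lemma shift_cong: "(\<And>M. J = M + L \<Longrightarrow> f M = g M) \<Longrightarrow> shift L f J = shift L g J"
  by (auto simp: shift_def)

text \<open>The image of \<open>x\<^sup>K\<close> under the right derivation of parity \<open>p\<close> with \<open>x\<^sub>j \<mapsto> X j\<close>.\<close>

definition field_row :: "nat \<Rightarrow> (nat \<Rightarrow> mi \<Rightarrow> 'b::ring_1) \<Rightarrow> mi \<Rightarrow> mi \<Rightarrow> 'b" where
  "field_row p X = (\<lambda>(a, b, c) J. (if a = 1 then shift (0, b, c) (X 1) J else 0) +
     (-1) ^ (p * a) * (of_nat b * shift (a, b - 1, c) (X 2) J + of_nat c * shift (a, b, c - 1) (X 3) J))"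

definition field_matrix :: "nat \<Rightarrow> (nat \<Rightarrow> mi \<Rightarrow> 'b::ring_1) \<Rightarrow> 'b opr" where
  "field_matrix p X K J = (if K \<in> MI \<and> J \<in> MI then field_row p X K J else 0)"

definition MIfield :: "(nat \<Rightarrow> mi \<Rightarrow> 'b::ring_1) \<Rightarrow> bool" where
  "MIfield X \<longleftrightarrow> (\<forall>j J. J \<notin> MI \<longrightarrow> X j J = 0)"

lemma moffD: "MIfield X \<Longrightarrow> J \<notin> MI \<Longrightarrow> X j J = 0"
  by (simp add: MIfield_def)

lemma MI_cases: "K \<in> MI \<Longrightarrow> (\<And>b c. K = (0, b, c) \<Longrightarrow> (b, c) \<noteq> (0, 0) \<Longrightarrow> P) \<Longrightarrow> (\<And>b c. K = (1, b, c) \<Longrightarrow> P) \<Longrightarrow> P"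
  by (cases K) (auto simp: MI_def le_Suc_eq)

lemma MI_iff: "(a, b, c) \<in> MI \<longleftrightarrow> a = 0 \<and> (b \<noteq> 0 \<or> c \<noteq> 0) \<or> a = 1"
  by (auto simp: MI_def)

lemma MIsupported_field_matrix: "MIsupported (field_matrix p X)"
  by (simp add: MIsupported_def field_matrix_def)

lemma field_matrix_evec: "MIfield X \<Longrightarrow> j \<in> {1, 2, 3} \<Longrightarrow> field_matrix p X (evec j) J = X j J"
  by (auto simp: field_matrix_def field_row_def evec_def MI_iff moffD)

lemma shift_sgn:
  assumes "fst J \<le> 1" "par L = 1"
  shows "shift L (\<lambda>M. (-1) ^ (n * par M) * f M) J = shift L f J"
  by (rule shift_cong) (use assms in \<open>auto simp: par_def\<close>)

lemma field_row_0:
  assumes "MIfield X" shows "field_row p X K (0, 0, 0) = 0"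
proof -
  have [simp]: "X j (0, 0, 0) = 0" for j using assms by (simp add: moffD MI_iff)
  show ?thesis by (cases K) (auto simp: field_row_def shift_eq)
qed

lemma derivation_field_matrix:
  assumes X: "MIfield X"
  shows "derivation p (field_matrix p X)"
  unfolding derivation_def
proof (intro ballI)
  fix K L J assume K: "K \<in> MI" and L: "L \<in> MI" and J: "J \<in> MI"
  let ?T = "field_matrix p X"
  have J1: "fst J \<le> 1" using J by (auto simp: MI_def)
  have row: "shift N (?T M) J = shift N (field_row p X M) J" if "M \<in> MI" for M N
  proof (rule shift_cong)
    fix P assume "J = P + N"
    then have "fst P \<le> 1" using J1 by auto
    then have "P \<in> MI \<or> P = (0, 0, 0)" by (cases P) (auto simp: MI_def)
    then show "?T M P = field_row p X M P"
      using that by (auto simp: field_matrix_def MI_iff field_row_0[OF X])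
  qed
  have 1: "rprod (par L) (?T K) (oid L) J = shift L (field_row p X K) J"
  proof -
    have "rprod (par L) (?T K) (oid L) J = shift L (\<lambda>M. (-1) ^ (par L * par M) * ?T K M) J"
    proof -
      have "(oid L :: mi \<Rightarrow> 'a) = rind L" using L by (auto simp: oid_def rind_def)
      then show ?thesis using rprod_rind_right[OF J1] by simp
    qed
    also have "\<dots> = shift L (?T K) J"
    proof (cases "par L = 0")
      case False
      then have "par L = 1" using MI_par[OF L] by linarith
      then show ?thesis using shift_sgn[OF J1, of L 1 "?T K"] by simp
    qed simp
    finally show ?thesis by (simp add: row[OF K])
  qed
  have 2: "rprod (p + par L) (oid K) (?T L) J = (-1) ^ ((p + par L) * par K) * shift K (field_row p X L) J"
  proof -
    have "(oid K :: mi \<Rightarrow> 'a) = rind K" using K by (auto simp: oid_def rind_def)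
    then show ?thesis by (simp add: rprod_rind_left[OF J1] row[OF L])
  qed
  have 3: "product_row ?T K L J = (if K + L \<in> MI then field_row p X (K + L) J else 0)"
    using J by (simp add: product_row_def field_matrix_def)
  obtain b c b' c' a' ja jb jc where J': "J = (ja, jb, jc)" by (cases J)
  obtain a b c where K': "K = (a, b, c)" by (cases K)
  obtain a' b' c' where L': "L = (a', b', c')" by (cases L)
  have sgn2: "(-1) ^ (par K * par L) * ((-1) ^ ((p + par L) * par K) * x) = (-1) ^ (p * par K) * x"
    for x :: 'a
  proof -
    have "(-1) ^ (par K * par L) * ((-1) ^ ((p + par L) * par K) * x) =
      (-1) ^ (par K * par L + (p + par L) * par K) * x"
      by (simp only: power_add mult.assoc)
    also have "(-1) ^ (par K * par L + (p + par L) * par K) = ((-1) ^ (p * par K) :: 'a)"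
      by (rule sgn_cong) auto
    finally show ?thesis .
  qed
  have sub: "of_nat b * shift (i, j + (b - Suc 0), k) f J = of_nat b * shift (i, j + b - Suc 0, k) f J"
    "of_nat b * shift (i, (b - Suc 0) + j, k) f J = of_nat b * shift (i, b + j - Suc 0, k) f J"
    "of_nat b * shift (i, k, j + (b - Suc 0)) f J = of_nat b * shift (i, k, j + b - Suc 0) f J"
    "of_nat b * shift (i, k, (b - Suc 0) + j) f J = of_nat b * shift (i, k, b + j - Suc 0) f J"
    for b i j k and f :: "mi \<Rightarrow> 'a"
    by (cases b; simp)+
  have sh2: "shift (Suc (Suc n), j, k) f J = 0" for n j k and f :: "mi \<Rightarrow> 'a"
    using J1 by (auto simp: J' shift_eq)
  have [simp]: "ja \<le> Suc 0" using J1 J' by simp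
  have sgn3: "(-1) ^ ((p + par K) * par L) * x =
      (if par L = 0 then x else if par K = 0 then (-1) ^ p * x else - ((-1) ^ p * x))" for x :: 'a
    using MI_par[OF K] MI_par[OF L] by (auto simp: le_Suc_eq)
  show "product_row ?T K L J = (-1) ^ ((p + par K) * par L) * rprod (par L) (?T K) (oid L) J +
     (-1) ^ (par K * par L) * rprod (p + par L) (oid K) (?T L) J"
    unfolding 1 2 3 sgn2 sgn3
    using MI_par[OF K] MI_par[OF L]
    by (auto simp: K' L' par_def le_Suc_eq MI_iff field_row_def shift_plus shift_mult shift_shift shift_zero_fun sub sh2
        algebra_simps K[unfolded K', unfolded MI_iff] L[unfolded L', unfolded MI_iff])
qed

lemma derivation_unique:
  assumes "MIsupported T" "derivation p T"
  shows "T = field_matrix p (\<lambda>j. T (evec j))"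
proof (rule derivation_eqI[OF assms(1) MIsupported_field_matrix assms(2)])
  have m: "MIfield (\<lambda>j. T (evec j))" using assms(1) by (simp add: MIfield_def MIsupported_def)
  show "derivation p (field_matrix p (\<lambda>j. T (evec j)))" by (rule derivation_field_matrix[OF m])
  show "T (evec j) J = field_matrix p (\<lambda>j. T (evec j)) (evec j) J" if "j \<in> {1, 2, 3}" for j J
    using field_matrix_evec[OF m that] by simp
qed

context local_superalgebra
begin

definition vector_field :: "nat \<Rightarrow> (nat \<Rightarrow> mi \<Rightarrow> 'a) \<Rightarrow> bool" where
  "vector_field p X \<longleftrightarrow> MIfield X \<and> (\<forall>j J. X j J \<in> hpart A (p + par (evec j) + par J))"

lemma vector_field_MIfield: "vector_field p X \<Longrightarrow> MIfield X"
  by (simp add: vector_field_def)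

lemma vector_field_hpart: "vector_field p X \<Longrightarrow> X j J \<in> hpart A (p + par (evec j) + par J)"
  by (simp add: vector_field_def)

lemma shift_hpart:
  assumes "\<And>M. M + L = J \<Longrightarrow> f M \<in> hpart A p" shows "shift L f J \<in> hpart A p"
  using assms by (auto simp: shift_def)

lemma par_evec: "par (evec 1) = 1" "par (evec (Suc 0)) = 1" "par (evec 2) = 0" "par (evec 3) = 0"
  by (simp_all add: par_def evec_def)

lemma homogeneous_field_matrix:
  assumes "vector_field p X" shows "homogeneous p (field_matrix p X)"
  unfolding homogeneous_def
proof (intro allI)
  fix K J :: mi
  obtain a b c where K: "K = (a, b, c)" by (cases K)
  have x: "X j M \<in> hpart A q" if "even (q + p + par (evec j) + par M)" for j M q
    using vector_field_hpart[OF assms, of j M] hpart_cong[of q "p + par (evec j) + par M" A] that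
    by (simp add: add.assoc)
  show "field_matrix p X K J \<in> hpart A (p + par K + par J)"
  proof (cases "K \<in> MI \<and> J \<in> MI")
    case True
    then have a: "a = 0 \<or> a = 1" by (auto simp: K MI_iff)
    have 1: "(if a = 1 then shift (0, b, c) (X 1) J else 0) \<in> hpart A (p + par K + par J)"
      by (auto intro!: shift_hpart x simp: K par_def evec_def)
    have 2: "shift (a, i, j) (X k) J \<in> hpart A (p + par K + par J)" if "par (evec k) = 0" for i j k
      by (rule shift_hpart, rule x) (use a that in \<open>auto simp: K par_def\<close>)
    show ?thesis
      using True 1 2 by (auto simp: field_matrix_def field_row_def K par_evec intro!: hpart_add hpart_sgn hpart_of_nat)
  qed (auto simp: field_matrix_def)
qed

lemma field_matrix_oprs: "vector_field p X \<Longrightarrow> field_matrix p X \<in> oprs A p"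
  using derivation_lower[OF MIsupported_field_matrix derivation_field_matrix[OF vector_field_MIfield]] homogeneous_field_matrix MIsupported_field_matrix oprs_lower by blast

end

section \<open>Coalgebra morphisms\<close>

definition monomial_image :: "(nat \<Rightarrow> mi \<Rightarrow> 'b::ring_1) \<Rightarrow> mi \<Rightarrow> mi \<Rightarrow> 'b" where
  "monomial_image \<gamma> = (\<lambda>(a, b, c). (if a = 1 then rprod 0 (\<gamma> 1) else id)
     ((rprod 0 (\<gamma> 2) ^^ b) ((rprod 0 (\<gamma> 3) ^^ c) (rind 0))))"

definition morphism :: "(nat \<Rightarrow> mi \<Rightarrow> 'b::ring_1) \<Rightarrow> 'b opr" where
  "morphism \<gamma> K J = (if K \<in> MI \<and> J \<in> MI then monomial_image \<gamma> K J else 0)"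

definition odd_degree_le_1 :: "(mi \<Rightarrow> 'b::ring_1) \<Rightarrow> bool" where
  "odd_degree_le_1 f \<longleftrightarrow> (\<forall>J. fst J > 1 \<longrightarrow> f J = 0)"

lemma odd_degree_le_1_rprod: "odd_degree_le_1 (rprod s f h)"
  by (simp add: odd_degree_le_1_def rprod_def)

lemma odd_degree_le_1_rind: "odd_degree_le_1 (rind 0)"
  by (simp add: odd_degree_le_1_def rind_def zero_prod_def)

lemma rprod_one_left: "odd_degree_le_1 f \<Longrightarrow> rprod s (rind 0) f = f"
proof
  fix J assume "odd_degree_le_1 f"
  then show "rprod s (rind 0) f J = f J"
    by (cases "fst J \<le> 1") (simp_all add: rprod_rind_left odd_degree_le_1_def, simp_all add: rprod_def par_def)
qed

lemma rprod_one_right: "odd_degree_le_1 f \<Longrightarrow> rprod 0 f (rind 0) = f"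
proof
  fix J assume "odd_degree_le_1 f"
  then show "rprod 0 f (rind 0) J = f J"
    by (cases "fst J \<le> 1") (simp_all add: rprod_rind_right odd_degree_le_1_def, simp_all add: rprod_def)
qed

lemma odd_degree_le_1_funpow: "odd_degree_le_1 h \<Longrightarrow> odd_degree_le_1 ((rprod 0 f ^^ n) h)"
  by (induction n) (auto simp: odd_degree_le_1_rprod)

lemma rprod_0_0_assoc: "rprod r (rprod 0 F G) H = rprod r F (rprod r G H)"
  by (simp add: rprod_assoc)

lemma funpow_rprod:
  "odd_degree_le_1 k \<Longrightarrow> odd_degree_le_1 h \<Longrightarrow> rprod r ((rprod 0 f ^^ n) h) k = (rprod r f ^^ n) (rprod r h k)"
  by (induction n) (simp_all add: rprod_0_0_assoc)

lemma MI_deg_pos: "K \<in> MI \<longleftrightarrow> fst K \<le> 1 \<and> deg K > 0"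
  by (cases K) (auto simp: MI_def deg_def)

lemma monomial_image_deg:
  assumes "MIfield \<gamma>" "monomial_image \<gamma> K J \<noteq> 0" "fst K \<le> 1"
  shows "deg K \<le> deg J"
proof -
  have m: "n + i \<le> deg J" if "\<And>J. h J \<noteq> 0 \<Longrightarrow> i \<le> deg J" "(rprod 0 (\<gamma> j) ^^ n) h J \<noteq> 0" for n i j h J
    using that(2)
  proof (induction n arbitrary: J)
    case 0 then show ?case using that(1) by simp
  next
    case (Suc n)
    then have "rprod 0 (\<gamma> j) ((rprod 0 (\<gamma> j) ^^ n) h) J \<noteq> 0" by simp
    then obtain M N where *: "M + N = J" "\<gamma> j M \<noteq> 0" "(rprod 0 (\<gamma> j) ^^ n) h N \<noteq> 0"
      by (rule rprod_nonzero)
    then have "n + i \<le> deg N" using Suc.IH by blast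
    moreover have "1 \<le> deg M" using * moffD[OF assms(1)] MI_deg by blast
    ultimately show ?case using *(1) by auto
  qed
  obtain a b c where K: "K = (a, b, c)" by (cases K)
  define h where "h = (rprod 0 (\<gamma> 2) ^^ b) ((rprod 0 (\<gamma> 3) ^^ c) (rind 0))"
  have h: "b + (c + 0) \<le> deg J" if "h J \<noteq> 0" for J
    using that unfolding h_def by (intro m) auto
  have "a + (b + c) \<le> deg J"
  proof (cases "a = 1")
    case True
    then have "(rprod 0 (\<gamma> 1) ^^ a) h J \<noteq> 0" using assms(2) by (simp add: monomial_image_def K h_def)
    show ?thesis
    proof (rule m)
      show "b + c \<le> deg J" if "h J \<noteq> 0" for J using h[OF that] by simp
    qed fact
  next
    case False
    then show ?thesis using h[of J] assms(2,3) by (simp add: monomial_image_def K h_def)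
  qed
  then show ?thesis by (simp add: K deg_def)
qed

lemma odd_degree_le_1_monomial_image: "odd_degree_le_1 (monomial_image \<gamma> K)"
  by (cases K) (auto simp: monomial_image_def odd_degree_le_1_rprod intro!: odd_degree_le_1_funpow odd_degree_le_1_rind)

lemma morphism_row: "MIfield \<gamma> \<Longrightarrow> K \<in> MI \<Longrightarrow> morphism \<gamma> K = monomial_image \<gamma> K"
proof
  fix J assume g: "MIfield \<gamma>" and K: "K \<in> MI"
  show "morphism \<gamma> K J = monomial_image \<gamma> K J"
  proof (cases "J \<in> MI")
    case False
    have "monomial_image \<gamma> K J = 0"
    proof (rule ccontr)
      assume nz: "monomial_image \<gamma> K J \<noteq> 0"
      then have "deg K \<le> deg J" using monomial_image_deg[OF g nz] K by (simp add: MI_deg_pos)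
      moreover have "fst J \<le> 1" using nz odd_degree_le_1_monomial_image unfolding odd_degree_le_1_def by (metis not_le)
      ultimately show False using False K by (simp add: MI_deg_pos)
    qed
    then show ?thesis using False by (simp add: morphism_def)
  qed (simp add: morphism_def K)
qed

lemma morphism_evec:
  assumes "MIfield \<gamma>" "j \<in> {1, 2, 3}"
  shows "morphism \<gamma> (evec j) = \<gamma> j"
proof -
  have "odd_degree_le_1 (\<gamma> j)" using moffD[OF assms(1)] by (auto simp: odd_degree_le_1_def MI_def)
  then show ?thesis
    using assms by (auto simp: morphism_row) (auto simp: monomial_image_def evec_def rprod_one_right)
qed

lemma MIsupported_morphism: "MIsupported (morphism \<gamma>)"
  by (simp add: MIsupported_def morphism_def)

context local_superalgebra
begin

lemma rprod_hpart0:
  assumes "\<And>M. f M \<in> hpart A (q + par M)" "\<And>M. h M \<in> hpart A (r + par M)"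
  shows "rprod s f h J \<in> hpart A ((q + r) + par J)"
  by (rule rprod_hpart[OF assms]) simp

lemma funpow_hpart:
  assumes "\<And>M. f M \<in> hpart A (0 + par M)" "\<And>M. h M \<in> hpart A (r + par M)"
  shows "(rprod s f ^^ n) h J \<in> hpart A (r + par J)"
proof (induction n arbitrary: J)
  case (Suc n)
  then show ?case using rprod_hpart0[OF assms(1), of "(rprod s f ^^ n) h" r s J] by simp
qed (use assms in simp)

lemma vector_field_row: "vector_field 0 \<gamma> \<Longrightarrow> \<gamma> j J \<in> hpart A (par (evec j) + par J)"
  using vector_field_hpart[of 0 \<gamma> j J] by simp

lemma monomial_image_hpart:
  assumes "vector_field 0 \<gamma>" "fst K \<le> 1"
  shows "monomial_image \<gamma> K J \<in> hpart A (par K + par J)"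
proof -
  obtain a b c where K: "K = (a, b, c)" by (cases K)
  have g: "\<gamma> 2 J \<in> hpart A (0 + par J)" "\<gamma> 3 J \<in> hpart A (0 + par J)" "\<gamma> 1 J \<in> hpart A (1 + par J)" for J
    using vector_field_row[OF assms(1), of 1] vector_field_row[OF assms(1), of 2] vector_field_row[OF assms(1), of 3]
    by (simp_all add: par_evec)
  have o: "(rind 0 :: mi \<Rightarrow> 'a) J \<in> hpart A (0 + par J)" for J
    using one_even by (auto simp: rind_def par_def)
  have h: "(rprod 0 (\<gamma> 2) ^^ b) ((rprod 0 (\<gamma> 3) ^^ c) (rind 0)) J \<in> hpart A (0 + par J)" for J
    by (intro funpow_hpart g o)
  show ?thesis
  proof (cases "a = 1")
    case True
    then show ?thesis using rprod_hpart0[OF g(3) h, of 0 J] by (simp add: monomial_image_def K par_def)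
  next
    case False
    then have "a = 0" using assms(2) by (simp add: K)
    then show ?thesis using h[of J] by (simp add: monomial_image_def K par_def)
  qed
qed

lemma rprod_commute_even:
  assumes "\<And>M. f M \<in> hpart A (0 + par M)" "\<And>M. h M \<in> hpart A (0 + par M)"
  shows "rprod 0 f h = rprod 0 h f"
  by (rule ext) (simp add: rprod_super[OF assms])

lemma funpow_commute:
  assumes "\<And>M. f M \<in> hpart A (0 + par M)" "\<And>M. h M \<in> hpart A (0 + par M)"
  shows "(rprod 0 f ^^ m) ((rprod 0 h ^^ n) k) = (rprod 0 h ^^ n) ((rprod 0 f ^^ m) k)"
proof -
  have c: "rprod 0 f (rprod 0 h k) = rprod 0 h (rprod 0 f k)" for k
    using rprod_commute_even[OF assms] rprod_0_0_assoc[of 0 f h k] rprod_0_0_assoc[of 0 h f k] by simp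
  have d: "rprod 0 f ((rprod 0 h ^^ n) k) = (rprod 0 h ^^ n) (rprod 0 f k)" for k
    by (induction n) (simp_all add: c)
  show ?thesis by (induction m) (simp_all add: d)
qed

lemma monomial_image_mult:
  assumes \<gamma>: "vector_field 0 \<gamma>" and K: "fst K \<le> 1" and L: "fst L \<le> 1"
  shows "rprod (par L) (monomial_image \<gamma> K) (monomial_image \<gamma> L) = (if fst (K + L) \<le> 1 then monomial_image \<gamma> (K + L) else (\<lambda>_. 0))"
proof -
  obtain a b c where K': "K = (a, b, c)" by (cases K)
  obtain a' b' c' where L': "L = (a', b', c')" by (cases L)
  define e where "e b c = (rprod 0 (\<gamma> 2) ^^ b) ((rprod 0 (\<gamma> 3) ^^ c) (rind 0))" for b c
  have g: "\<gamma> 2 J \<in> hpart A (0 + par J)" "\<gamma> 3 J \<in> hpart A (0 + par J)" "\<gamma> 1 J \<in> hpart A (1 + par J)" for J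
    using vector_field_row[OF \<gamma>, of 1] vector_field_row[OF \<gamma>, of 2] vector_field_row[OF \<gamma>, of 3] by (simp_all add: par_evec)
  have we: "odd_degree_le_1 (e b c)" for b c unfolding e_def by (intro odd_degree_le_1_funpow odd_degree_le_1_rind)
  have he: "e b c J \<in> hpart A (0 + par J)" for b c J
    using monomial_image_hpart[OF \<gamma>, of "(0, b, c)" J] by (simp add: monomial_image_def e_def par_def)
  have ee: "rprod 0 (e b c) (e b' c') = e (b + b') (c + c')" for b c b' c'
  proof -
    have "rprod 0 (e b c) (e b' c') = (rprod 0 (\<gamma> 2) ^^ b) ((rprod 0 (\<gamma> 3) ^^ c) (e b' c'))"
      by (simp add: e_def funpow_rprod odd_degree_le_1_funpow odd_degree_le_1_rind rprod_one_left)
    also have "\<dots> = e (b + b') (c + c')"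
      by (simp add: e_def funpow_commute[OF g(2) g(1)] funpow_add)
    finally show ?thesis .
  qed
  have G0: "monomial_image \<gamma> (0, b, c) = e b c" and G1: "monomial_image \<gamma> (Suc 0, b, c) = rprod 0 (\<gamma> 1) (e b c)" for b c
    by (simp_all add: monomial_image_def e_def)
  have c1: "rprod 1 (e b c) (\<gamma> 1) = rprod 0 (\<gamma> 1) (e b c)" for b c
    using rprod_super[OF he[of b c] g(3)] by (intro ext) simp
  have e1: "rprod (Suc 0) (e b c) (rprod 0 (\<gamma> 1) k) = rprod 0 (\<gamma> 1) (rprod 0 (e b c) k)" for b c k
  proof -
    have "rprod 1 (e b c) (rprod 0 (\<gamma> 1) k) = rprod 0 (rprod 1 (e b c) (\<gamma> 1)) k"
      by (simp add: rprod_assoc)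
    also have "\<dots> = rprod 0 (rprod 0 (\<gamma> 1) (e b c)) k" by (simp only: c1)
    finally show ?thesis by (simp add: rprod_assoc)
  qed
  have sq: "rprod 1 (\<gamma> 1) (\<gamma> 1) = (\<lambda>_. 0)"
  proof
    fix J
    let ?x = "rprod 1 (\<gamma> 1) (\<gamma> 1) J"
    have "?x = (-1) ^ (1 * 1) * ?x" by (rule rprod_super[OF g(3) g(3)])
    also have "\<dots> = - ?x" by simp
    finally have "?x + ?x = - ?x + ?x" by (rule arg_cong)
    then have "scale A 2 ?x = 0"
      using scale_left_distrib[of 1 1 ?x] by simp
    then show "?x = 0" by simp
  qed
  have z: "rprod 0 (\<lambda>_. 0) k = (\<lambda>_. 0)" for k :: "mi \<Rightarrow> 'a"
    by (rule ext) (simp add: rprod_def split_def)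
  have oo: "rprod (Suc 0) (rprod 0 (\<gamma> 1) (e b c)) (rprod 0 (\<gamma> 1) (e b' c')) = (\<lambda>_. 0)"
  proof -
    have "rprod 1 (rprod 0 (\<gamma> 1) (e b c)) (rprod 0 (\<gamma> 1) (e b' c')) =
        rprod (0 + 1) (\<gamma> 1) (rprod 1 (e b c) (rprod 0 (\<gamma> 1) (e b' c')))"
      by (rule rprod_assoc)
    also have "\<dots> = rprod (1 + 0) (\<gamma> 1) (rprod 0 (\<gamma> 1) (rprod 0 (e b c) (e b' c')))"
      using e1[of b c "e b' c'"] by simp
    also have "\<dots> = rprod 0 (rprod 1 (\<gamma> 1) (\<gamma> 1)) (rprod 0 (e b c) (e b' c'))"
      by (rule rprod_assoc[symmetric])
    also have "\<dots> = (\<lambda>_. 0)" unfolding sq z ..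
    finally show ?thesis by simp
  qed
  have eo: "rprod 0 (rprod 0 (\<gamma> 1) (e b c)) (e b' c') = rprod 0 (\<gamma> 1) (e (b + b') (c + c'))"
    unfolding rprod_0_0_assoc ee ..
  have oe: "rprod (Suc 0) (e b c) (rprod 0 (\<gamma> 1) (e b' c')) = rprod 0 (\<gamma> 1) (e (b + b') (c + c'))"
    unfolding e1 ee ..
  consider "a = 0" "a' = 0" | "a = 0" "a' = 1" | "a = 1" "a' = 0" | "a = 1" "a' = 1"
    using K L by (auto simp: K' L' le_Suc_eq)
  then show ?thesis
  proof cases
    case 1 then show ?thesis by (simp add: K' L' par_def G0 ee)
  next
    case 2 then show ?thesis using oe by (simp add: K' L' par_def G0 G1)
  next
    case 3 then show ?thesis using eo by (simp add: K' L' par_def G0 G1)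
  next
    case 4 then show ?thesis using oo by (simp add: K' L' par_def G1)
  qed
qed

lemma multiplicative_morphism:
  assumes "vector_field 0 \<gamma>"
  shows "multiplicative (morphism \<gamma>)"
  unfolding multiplicative_def
proof (intro ballI)
  fix K L J assume KLJ: "K \<in> MI" "L \<in> MI" "J \<in> MI"
  have 1: "fst K \<le> 1" "fst L \<le> 1" using KLJ by (auto simp: MI_def)
  have 2: "K + L \<in> MI \<longleftrightarrow> fst (K + L) \<le> 1" using KLJ by (simp add: MI_deg_pos)
  have r: "morphism \<gamma> K = monomial_image \<gamma> K" "morphism \<gamma> L = monomial_image \<gamma> L" "K + L \<in> MI \<Longrightarrow> morphism \<gamma> (K + L) = monomial_image \<gamma> (K + L)"
    using KLJ morphism_row[OF vector_field_MIfield[OF assms]] by blast+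
  have "par K * par L = 0" if "fst (K + L) \<le> 1" using that by (auto simp: par_def)
  then show "product_row (morphism \<gamma>) K L J = (-1) ^ (par K * par L) * rprod (par L) (morphism \<gamma> K) (morphism \<gamma> L) J"
    unfolding r(1,2) monomial_image_mult[OF assms 1] using 2 r(3) by (auto simp: product_row_def)
qed

lemma homogeneous_morphism: "vector_field 0 \<gamma> \<Longrightarrow> homogeneous 0 (morphism \<gamma>)"
  using monomial_image_hpart by (auto simp: homogeneous_def morphism_def MI_deg_pos)

end

section \<open>Formal bases\<close>

lemma (in local_superalgebra) aug_simps [simp]:
  "aug A 0 = 0" "aug A (x + y) = aug A x + aug A y" "aug A (x - y) = aug A x - aug A y"
  "aug A (- x) = - aug A x" "aug A (scale A c x) = c * aug A x"
proof -
  interpret a: Vector_Spaces.linear "scale A" "(*)" "aug A" by (rule aug_linear)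
  show "aug A 0 = 0" "aug A (x + y) = aug A x + aug A y" "aug A (x - y) = aug A x - aug A y"
    "aug A (- x) = - aug A x" "aug A (scale A c x) = c * aug A x"
    by (simp_all add: a.zero a.add a.diff a.neg a.scale)
qed

context formal_base
begin

lemma filt_zero [simp]: "0 \<in> filt A n"
  using filt_subspace subspace_0 by blast

lemma filt_add: "x \<in> filt A n \<Longrightarrow> y \<in> filt A n \<Longrightarrow> x + y \<in> filt A n"
  using filt_subspace subspace_add by blast

lemma filt_diff: "x \<in> filt A n \<Longrightarrow> y \<in> filt A n \<Longrightarrow> x - y \<in> filt A n"
  using filt_subspace subspace_diff by blast

lemma filt_minus: "x \<in> filt A n \<Longrightarrow> - x \<in> filt A n"
  using filt_subspace subspace_neg by blast

lemma filt_scale: "x \<in> filt A n \<Longrightarrow> scale A c x \<in> filt A n"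
  using filt_subspace subspace_scale by blast

lemma filt_sum: "(\<And>i. i \<in> S \<Longrightarrow> f i \<in> filt A n) \<Longrightarrow> sum f S \<in> filt A n"
  using filt_subspace subspace_sum by blast

lemma filt_mult_left: "x \<in> filt A n \<Longrightarrow> y * x \<in> filt A n"
  using filt_ideal by blast

lemma filt_mult_right: "x \<in> filt A n \<Longrightarrow> x * y \<in> filt A n"
  using filt_ideal by blast

lemma filt_of_nat_cancel:
  assumes "n > 0" "of_nat n * x \<in> filt A k" shows "x \<in> filt A k"
  using filt_scale[OF assms(2), of "1 / of_nat n"] assms(1) by (simp add: of_nat_scale)

lemma filt_mono: "m \<le> n \<Longrightarrow> filt A n \<subseteq> filt A m"
  using filt_antimono by (rule lift_Suc_antimono_le)

lemma mpow_filt: "mpow A n \<subseteq> filt A n"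
proof
  fix x assume "x \<in> mpow A n"
  then have "x \<in> {x + y |x y. x \<in> mpow A n \<and> y \<in> filt A k}" for k
    using filt_zero[of k] by force
  then show "x \<in> filt A n" by (subst filt_closure) blast
qed

lemma filt_0 [simp]: "filt A 0 = UNIV"
  using mpow_filt[of 0] by auto

lemma filt_Inter: "(\<And>n. x \<in> filt A n) \<Longrightarrow> x = 0"
  using complete[of "\<lambda>_. 0"] by (metis diff_zero filt_zero diff_self)

lemma mideal_ideal: "a \<in> mideal A \<Longrightarrow> a * b \<in> mideal A" "b \<in> mideal A \<Longrightarrow> a * b \<in> mideal A"
  by (simp_all add: mideal_def aug_mult)

lemma subspace_mideal: "subspace (mideal A)"
  by (rule subspaceI) (simp_all add: mideal_def)

lemma mpow_1: "mpow A 1 \<subseteq> mideal A"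
proof -
  have "span {a * b | a b. a \<in> mideal A \<and> b \<in> (UNIV :: 'a set)} \<subseteq> mideal A"
    by (rule span_minimal) (auto intro: mideal_ideal subspace_mideal)
  then show ?thesis by simp
qed

lemma filt_1: "filt A 1 = mideal A"
proof
  show "mideal A \<subseteq> filt A 1"
  proof
    fix a assume "a \<in> mideal A"
    then have "a * 1 \<in> mpow A 1" by (simp, intro span_base) (metis (mono_tags) mem_Collect_eq mult.right_neutral UNIV_I)
    then show "a \<in> filt A 1" using mpow_filt[of 1] by auto
  qed
  show "filt A 1 \<subseteq> mideal A"
  proof
    fix x assume x: "x \<in> filt A 1"
    have unit: "1 \<in> filt A k" if "y \<in> filt A k" "y \<notin> mideal A" for y k
      using local_ring[OF that(2)] filt_mult_right[OF that(1)] by metis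
    show "x \<in> mideal A"
    proof (rule ccontr)
      assume "x \<notin> mideal A"
      then have 1: "1 \<in> filt A 1" using unit[OF x] by blast
      have "1 \<in> filt A k" for k
      proof -
        have "1 \<in> {x + y |x y. x \<in> mpow A 1 \<and> y \<in> filt A k}"
          using 1 by (subst (asm) filt_closure) blast
        then obtain z y where zy: "1 = z + y" "z \<in> mpow A 1" "y \<in> filt A k" by blast
        then have "z \<in> mideal A" using mpow_1 by blast
        then have "aug A y = 1"
          using arg_cong[OF zy(1), of "aug A"] by (simp add: mideal_def aug_one)
        then show ?thesis using unit[OF zy(3)] by (simp add: mideal_def)
      qed
      then show False using filt_Inter[of 1] by simp
    qed
  qed
qed

lemma filt_Suc_mult_left:
  assumes a: "a \<in> filt A 1" and x: "x \<in> filt A n"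
  shows "a * x \<in> filt A (Suc n)"
proof -
  have "a * x \<in> {x + y |x y. x \<in> mpow A (Suc n) \<and> y \<in> filt A k}" for k
  proof -
    have "x \<in> {x + y |x y. x \<in> mpow A n \<and> y \<in> filt A k}"
      using x by (subst (asm) filt_closure) blast
    then obtain z y where zy: "x = z + y" "z \<in> mpow A n" "y \<in> filt A k" by blast
    have "a * z \<in> mpow A (Suc n)"
      using a zy(2) unfolding filt_1 mpow.simps by (intro span_base) blast
    moreover have "a * y \<in> filt A k" using zy(3) by (rule filt_mult_left)
    ultimately show ?thesis using zy(1) by (auto simp: distrib_left)
  qed
  then show ?thesis by (subst filt_closure) blast
qed

lemma filt_hpart_split:
  assumes "x \<in> filt A n"
  obtains a b where "x = a + b" "a \<in> hpart A 0" "b \<in> hpart A 1" "a \<in> filt A n" "b \<in> filt A n"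
proof -
  obtain a b where ab: "x = a + b" "a \<in> even_part A" "b \<in> odd_part A"
    using parts_span by blast
  then have "a \<in> filt A n" using filt_graded assms by blast
  moreover from this have "b \<in> filt A n" using filt_diff[OF assms] ab(1) by fastforce
  ultimately show ?thesis using ab that by (auto simp: hpart_def)
qed

lemma filt_Suc_mult_right:
  assumes a: "a \<in> filt A 1" and x: "x \<in> filt A n"
  shows "x * a \<in> filt A (Suc n)"
proof -
  obtain a0 a1 where A: "a = a0 + a1" "a0 \<in> hpart A 0" "a1 \<in> hpart A 1" "a0 \<in> filt A 1" "a1 \<in> filt A 1"
    using filt_hpart_split[OF a] .
  obtain x0 x1 where X: "x = x0 + x1" "x0 \<in> hpart A 0" "x1 \<in> hpart A 1" "x0 \<in> filt A n" "x1 \<in> filt A n"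
    using filt_hpart_split[OF x] .
  have c: "y * b \<in> filt A (Suc n)" if "y \<in> hpart A p" "b \<in> hpart A q" "y \<in> filt A n" "b \<in> filt A 1" for y b p q
    unfolding supercommute[OF that(1,2)]
    using filt_mult_left[OF filt_Suc_mult_left[OF that(4,3)]] .
  show ?thesis
    unfolding A(1) X(1) distrib_left distrib_right
    by (intro filt_add c[OF X(2) A(2)] c[OF X(3) A(2)] c[OF X(2) A(3)] c[OF X(3) A(3)] X A)
qed

lemma hpart_closed:
  assumes "\<And>n. l - s n \<in> filt A n" "\<And>n. s n \<in> hpart A p"
  shows "l \<in> hpart A p"
proof -
  obtain a b where ab: "l = a + b" "a \<in> hpart A 0" "b \<in> hpart A 1"
    using parts_span[of l] by (auto simp: hpart_def)
  show ?thesis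
  proof (cases "even p")
    case True
    have "b \<in> filt A n" for n
    proof -
      have s: "s n \<in> hpart A 0" using assms(2) hpart_cong[of p 0 A] True by simp
      have "(a - s n) + b \<in> filt A n" using assms(1)[of n] ab(1) by (simp add: algebra_simps)
      then have "a - s n \<in> filt A n"
        using filt_graded[of "a - s n" b n] hpart_diff[OF ab(2) s] ab(3) by (simp add: hpart_def)
      then have "((a - s n) + b) - (a - s n) \<in> filt A n" using \<open>(a - s n) + b \<in> filt A n\<close> filt_diff by blast
      then show ?thesis by simp
    qed
    then have "b = 0" by (rule filt_Inter)
    then show ?thesis using ab hpart_cong[of p 0 A] True by simp
  next
    case False
    have "a \<in> filt A n" for n
    proof -
      have s: "s n \<in> hpart A 1" using assms(2) hpart_cong[of p 1 A] False by simp
      have "a + (b - s n) \<in> filt A n" using assms(1)[of n] ab(1) by (simp add: algebra_simps)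
      then show ?thesis
        using filt_graded[of a "b - s n" n] hpart_diff[OF ab(3) s] ab(2) by (simp add: hpart_def)
    qed
    then have "a = 0" by (rule filt_Inter)
    then show ?thesis using ab hpart_cong[of p 1 A] False by simp
  qed
qed

definition fcong :: "nat \<Rightarrow> 'a \<Rightarrow> 'a \<Rightarrow> bool" where
  "fcong n x y \<longleftrightarrow> x - y \<in> filt A n"

lemma fcong_refl [simp]: "fcong n x x"
  by (simp add: fcong_def)

lemma fcong_sym: "fcong n x y \<Longrightarrow> fcong n y x"
  using filt_minus[of "x - y" n] by (simp add: fcong_def)

lemma fcong_trans [trans]: "fcong n x y \<Longrightarrow> fcong n y z \<Longrightarrow> fcong n x z"
  using filt_add[of "x - y" n "y - z"] by (simp add: fcong_def)

lemma fcong_mono: "fcong n x y \<Longrightarrow> m \<le> n \<Longrightarrow> fcong m x y"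
  using filt_mono by (auto simp: fcong_def)

lemma fcong_zero: "fcong n x 0 \<longleftrightarrow> x \<in> filt A n"
  by (simp add: fcong_def)

lemma fcong_add: "fcong n x y \<Longrightarrow> fcong n x' y' \<Longrightarrow> fcong n (x + x') (y + y')"
  using filt_add[of "x - y" n "x' - y'"] by (simp add: fcong_def algebra_simps)

lemma fcong_diff: "fcong n x y \<Longrightarrow> fcong n x' y' \<Longrightarrow> fcong n (x - x') (y - y')"
  using filt_diff[of "x - y" n "x' - y'"] by (simp add: fcong_def algebra_simps)

lemma fcong_mult: "fcong n x y \<Longrightarrow> fcong n x' y' \<Longrightarrow> fcong n (x * x') (y * y')"
  using filt_add[OF filt_mult_right[of "x - y" n x'] filt_mult_left[of "x' - y'" n y]]
  by (simp add: fcong_def algebra_simps)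

lemma fcong_sum: "(\<And>i. i \<in> S \<Longrightarrow> fcong n (f i) (g i)) \<Longrightarrow> fcong n (sum f S) (sum g S)"
  unfolding fcong_def sum_subtractf[symmetric] by (rule filt_sum)

lemma fcong_filt: "fcong n x y \<Longrightarrow> y \<in> filt A n \<Longrightarrow> x \<in> filt A n"
  by (metis fcong_trans fcong_zero)

lemma fcong_all: "(\<And>n. fcong n x y) \<Longrightarrow> x = y"
  using filt_Inter[of "x - y"] by (simp add: fcong_def)

lemma limit_exists:
  assumes "\<And>n. fcong n (s (Suc n)) (s n)"
  obtains l where "\<And>n. fcong n l (s n)"
  using complete[of s] assms unfolding fcong_def by blast

lemma fcong_rprod:
  "(\<And>M. fcong n (f M) (f' M)) \<Longrightarrow> (\<And>M. fcong n (h M) (h' M)) \<Longrightarrow> fcong n (rprod s f h J) (rprod s f' h' J)"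
  by (auto simp: rprod_def split_def intro!: fcong_sum fcong_mult)

lemma rprod_small_left:
  assumes "\<And>M. f M \<in> filt A n" "\<And>M. fcong 1 (h M) (h' M)"
  shows "fcong (Suc n) (rprod s f h J) (rprod s f h' J)"
proof -
  have "fcong (Suc n) (r * f M * h N) (r * f M * h' N)" for r M N
    using filt_mult_left[OF filt_Suc_mult_right[OF assms(2)[unfolded fcong_def, of N] assms(1)[of M]], of r]
    by (simp add: fcong_def algebra_simps)
  then show ?thesis by (auto simp: rprod_def split_def intro!: fcong_sum)
qed

lemma rprod_small_right:
  assumes "\<And>M. h M \<in> filt A n" "\<And>M. fcong 1 (f M) (f' M)"
  shows "fcong (Suc n) (rprod s f h J) (rprod s f' h J)"
proof -
  have "fcong (Suc n) (r * f M * h N) (r * f' M * h N)" for r M N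
    using filt_mult_left[OF filt_Suc_mult_left[OF assms(2)[unfolded fcong_def, of M] assms(1)[of N]], of r]
    by (simp add: fcong_def algebra_simps)
  then show ?thesis by (auto simp: rprod_def split_def intro!: fcong_sum)
qed

lemma rprod_filt_left: "(\<And>M. f M \<in> filt A n) \<Longrightarrow> rprod s f h J \<in> filt A n"
  using filt_mult_right[OF filt_mult_left] by (auto simp: rprod_def split_def intro!: filt_sum)

lemma rprod_filt_right: "(\<And>M. h M \<in> filt A n) \<Longrightarrow> rprod s f h J \<in> filt A n"
  by (auto simp: rprod_def split_def intro!: filt_sum filt_mult_left)

lemma fcong_act:
  "(\<And>M. fcong n (f M) (f' M)) \<Longrightarrow> (\<And>M. fcong n (T M J) (T' M J)) \<Longrightarrow> fcong n (act f T J) (act f' T' J)"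
  by (auto simp: act_def intro!: fcong_sum fcong_mult)

lemma act_filt_left: "(\<And>M. f M \<in> filt A n) \<Longrightarrow> act f T J \<in> filt A n"
  by (auto simp: act_def intro!: filt_sum filt_mult_right)

lemma act_filt_right: "(\<And>M. T M J \<in> filt A n) \<Longrightarrow> act f T J \<in> filt A n"
  by (auto simp: act_def intro!: filt_sum filt_mult_left)

lemma act_small_left:
  assumes "\<And>M. f M \<in> filt A n" "\<And>M. fcong 1 (T M J) (T' M J)"
  shows "fcong (Suc n) (act f T J) (act f T' J)"
proof -
  have "fcong (Suc n) (f M * T M J) (f M * T' M J)" for M
    using filt_Suc_mult_right[OF assms(2)[unfolded fcong_def, of M] assms(1)[of M]]
    by (simp add: fcong_def algebra_simps)
  then show ?thesis by (auto simp: act_def intro!: fcong_sum)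
qed

lemma act_small_right:
  assumes "\<And>M. T M J \<in> filt A n" "\<And>M. fcong 1 (f M) (f' M)"
  shows "fcong (Suc n) (act f T J) (act f' T J)"
proof -
  have "fcong (Suc n) (f M * T M J) (f' M * T M J)" for M
    using filt_Suc_mult_left[OF assms(2)[unfolded fcong_def, of M] assms(1)[of M]]
    by (simp add: fcong_def algebra_simps)
  then show ?thesis by (auto simp: act_def intro!: fcong_sum)
qed

lemma fcong_shift: "(\<And>M. fcong n (f M) (f' M)) \<Longrightarrow> fcong n (shift L f J) (shift L f' J)"
  by (simp add: shift_def)

lemma fcong_field_matrix:
  assumes "\<And>j J. fcong n (X j J) (X' j J)"
  shows "fcong n (field_matrix p X K J) (field_matrix p X' K J)"
proof -
  obtain a b c where K: "K = (a, b, c)" by (cases K)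
  have "fcong n (if a = 1 then shift (0, b, c) (X 1) J else 0) (if a = 1 then shift (0, b, c) (X' 1) J else 0)"
    using fcong_shift[OF assms] by simp
  moreover have "fcong n (y * (z * shift L (X 2) J + z' * shift L' (X 3) J))
      (y * (z * shift L (X' 2) J + z' * shift L' (X' 3) J))" for y z z' L L'
    by (intro fcong_mult fcong_add fcong_shift assms fcong_refl)
  ultimately have "fcong n (field_row p X K J) (field_row p X' K J)"
    unfolding field_row_def K prod.case by (rule fcong_add)
  then show ?thesis by (simp add: field_matrix_def)
qed

lemma fcong_multiplicative:
  assumes "MIsupported g" "multiplicative g" "MIsupported h" "multiplicative h"
    and "\<And>j J. j \<in> {1, 2, 3} \<Longrightarrow> fcong n (g (evec j) J) (h (evec j) J)"
  shows "fcong n (g K J) (h K J)"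
proof (cases "K \<in> MI")
  case True
  then have "\<forall>J. fcong n (g K J) (h K J)"
  proof (induction rule: mi_induct)
    case (add K L)
    show ?case
    proof
      fix J show "fcong n (g (K + L) J) (h (K + L) J)"
      proof (cases "J \<in> MI")
        case True
        have "g (K + L) J = product_row g K L J" "h (K + L) J = product_row h K L J"
          using add by (simp_all add: product_row_def)
        moreover have "fcong n (product_row g K L J) (product_row h K L J)"
        proof -
          have "product_row g K L J = (-1) ^ (par K * par L) * rprod (par L) (g K) (g L) J"
            "product_row h K L J = (-1) ^ (par K * par L) * rprod (par L) (h K) (h L) J"
            using assms(2,4) add True by (simp_all add: multiplicative_def)
          then show ?thesis using add.IH by (simp add: fcong_mult fcong_rprod)
        qed
        ultimately show ?thesis by simp
      qed (simp add: mivanD[OF assms(1)] mivanD[OF assms(3)])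
    qed
  qed (use assms(5) in blast)
  then show ?thesis by blast
qed (simp add: mivanD[OF assms(1)] mivanD[OF assms(3)])

lemma fcong_morphism:
  assumes "vector_field 0 \<gamma>" "vector_field 0 \<gamma>'" "\<And>j J. j \<in> {1, 2, 3} \<Longrightarrow> fcong n (\<gamma> j J) (\<gamma>' j J)"
  shows "fcong n (morphism \<gamma> K J) (morphism \<gamma>' K J)"
proof (rule fcong_multiplicative[OF MIsupported_morphism multiplicative_morphism[OF assms(1)] MIsupported_morphism multiplicative_morphism[OF assms(2)]])
  fix j :: nat and J assume "j \<in> {1, 2, 3}"
  then show "fcong n (morphism \<gamma> (evec j) J) (morphism \<gamma>' (evec j) J)"
    using assms morphism_evec[OF vector_field_MIfield] by simp
qed

end

lemma multiplicative_oid: "multiplicative (oid :: 'b::ring_1 opr)"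
  unfolding multiplicative_def
proof (intro ballI)
  fix K L J assume K: "K \<in> MI" and L: "L \<in> MI" and J: "J \<in> MI"
  have o: "(oid K :: mi \<Rightarrow> 'b) = rind K" "(oid L :: mi \<Rightarrow> 'b) = rind L"
    using K L by (auto simp: oid_def rind_def)
  have J1: "fst J \<le> 1" using J by (auto simp: MI_def)
  have "(-1) ^ (par K * par L) * rprod (par L) (oid K) (oid L) J =
      (-1) ^ (par K * par L) * ((-1) ^ (par L * par K) * shift K (rind L) J :: 'b)"
    by (simp add: o rprod_rind_left[OF J1])
  also have "\<dots> = (-1) ^ (par K * par L + par L * par K) * shift K (rind L) J"
    by (simp only: power_add mult.assoc)
  also have "(-1) ^ (par K * par L + par L * par K) = ((-1) ^ 0 :: 'b)"
    by (rule sgn_cong) auto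
  also have "(-1) ^ 0 * shift K (rind L) J = (product_row oid K L J :: 'b)"
  proof (cases "\<exists>M. J = M + K")
    case True
    then obtain M where M: "J = M + K" by blast
    have "product_row oid K L J = (if L = M then 1 else (0 :: 'b))"
      using J by (auto simp: product_row_def oid_def M add.commute[of K])
    then show ?thesis by (simp add: M rind_def)
  next
    case False
    then have "product_row oid K L J = (0 :: 'b)" using J by (auto simp: product_row_def oid_def add.commute[of K])
    with False show ?thesis by (simp add: shift_def)
  qed
  finally show "product_row (oid :: 'b opr) K L J = (-1) ^ (par K * par L) * rprod (par L) (oid K) (oid L) J"
    by (rule sym)
qed

context formal_base
begin

lemma neumann_inverse:
  assumes g: "lower g" "homogeneous 0 g" and g1: "\<And>K J. fcong 1 (g K J) (oid K J)"
  obtains h where "lower h" "homogeneous 0 h" "ocomp g h = oid" "ocomp h g = oid"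
proof -
  define x where "x K J = oid K J - g K J" for K J
  have lx: "lower x" using g(1) lower_oid unfolding lower_def x_def by (metis diff_zero diff_self)
  have hx: "homogeneous 0 x" using g(2) homogeneous_oid by (simp add: homogeneous_def x_def hpart_diff)
  define xp where "xp n = ((\<lambda>T. ocomp x T) ^^ n) oid" for n
  have xp0: "xp 0 = oid" and xpS: "xp (Suc n) = ocomp x (xp n)" for n
    by (simp_all add: xp_def)
  have lxp: "lower (xp n)" for n
    by (induction n) (simp_all add: xp0 xpS lower_oid lower_ocomp lx)
  have xpS': "xp (Suc n) = ocomp (xp n) x" for n
  proof (induction n)
    case 0 show ?case by (simp add: xpS xp0 ocomp_oid_left ocomp_oid_right lx)
  next
    case (Suc n)
    show ?case
      by (subst xpS, subst Suc, subst ocomp_assoc[symmetric]) (simp_all add: lxp lx xpS)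
  qed
  have hxp: "homogeneous 0 (xp n)" for n
  proof (induction n)
    case (Suc n)
    show ?case unfolding homogeneous_def
    proof (intro allI)
      fix K J
      have "x K M * xp n M J \<in> hpart A (0 + par K + par J)" for M
        by (rule hpart_mult'[OF hopD[OF hx] hopD[OF Suc]]) (simp, blast)
      then show "xp (Suc n) K J \<in> hpart A (0 + par K + par J)"
        by (simp add: xpS ocomp_def hpart_sum)
    qed
  qed (simp add: xp0 homogeneous_oid)
  have x1: "x K J \<in> filt A 1" for K J
    using fcong_sym[OF g1] by (simp add: x_def fcong_def)
  have fxp: "xp n K J \<in> filt A n" for n K J
  proof (induction n arbitrary: K J)
    case (Suc n)
    show ?case unfolding xpS ocomp_def
      by (intro filt_sum filt_Suc_mult_left x1 Suc)
  qed simp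
  define s where "s n K J = (\<Sum>i<n. xp i K J)" for n K J
  have "\<exists>l. \<forall>n. fcong n l (s n K J)" for K J
    by (rule limit_exists[of "\<lambda>n. s n K J"]) (use fxp in \<open>auto simp: s_def fcong_def\<close>)
  then obtain h where h: "\<And>n K J. fcong n (h K J) (s n K J)" by metis
  have lh: "lower h"
    unfolding lower_def
  proof (intro allI impI)
    fix K J assume nz: "h K J \<noteq> 0"
    show "K \<in> MI \<and> J \<in> MI \<and> deg K \<le> deg J"
    proof (rule ccontr)
      assume "\<not> ?thesis"
      then have "xp i K J = 0" for i using lowerD[OF lxp] by blast
      then have "fcong n (h K J) 0" for n using h[of n K J] by (simp add: s_def)
      then show False using fcong_all nz by blast
    qed
  qed
  have hh: "homogeneous 0 h"
    unfolding homogeneous_def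
  proof (intro allI)
    fix K J
    show "h K J \<in> hpart A (0 + par K + par J)"
      by (rule hpart_closed[of _ "\<lambda>n. s n K J"])
        (use h hxp in \<open>auto simp: fcong_def s_def homogeneous_def intro!: hpart_sum\<close>)
  qed
  have gx: "g = (\<lambda>K J. oid K J - x K J)" by (intro ext) (simp add: x_def)
  have ls: "lower (s n)" for n
    unfolding lower_def s_def
  proof (intro allI impI)
    fix K J assume "(\<Sum>i<n. xp i K J) \<noteq> 0"
    then obtain i where "xp i K J \<noteq> 0" by (auto elim: sum.not_neutral_contains_not_neutral)
    then show "K \<in> MI \<and> J \<in> MI \<and> deg K \<le> deg J" using lowerD[OF lxp] by blast
  qed
  have gs: "act (g K) (s n) J = oid K J - xp n K J" for n K J
  proof (induction n)
    case 0 then show ?case by (simp add: s_def act_def xp0)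
  next
    case (Suc n)
    have "act (g K) (s (Suc n)) J = act (g K) (s n) J + act (g K) (xp n) J"
      unfolding s_def by (simp add: act_add_right[symmetric])
    also have "act (g K) (xp n) J = xp n K J - xp (Suc n) K J"
      using fun_cong[OF fun_cong[OF ocomp_oid_left[OF lxp]], of n K J]
      by (simp add: gx act_diff_left xpS ocomp_act[OF lxp])
    finally show ?case using Suc by simp
  qed
  have sg: "act (s n K) g J = oid K J - xp n K J" for n K J
  proof (induction n)
    case 0 then show ?case by (simp add: s_def act_def xp0)
  next
    case (Suc n)
    have "act (s (Suc n) K) g J = act (s n K) g J + act (xp n K) g J"
      unfolding s_def by (simp add: act_add_left[symmetric])
    also have "act (xp n K) g J = xp n K J - xp (Suc n) K J"
      using fun_cong[OF fun_cong[OF ocomp_oid_right[OF lxp]], of n K J]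
      by (simp add: gx act_diff_right xpS' ocomp_act[OF lower_oid] ocomp_act[OF lx])
    finally show ?case using Suc by simp
  qed
  have "ocomp g h = oid"
  proof (intro ext fcong_all)
    fix K J n
    have "fcong n (ocomp g h K J) (act (g K) (s n) J)"
      unfolding ocomp_act[OF lh] by (intro fcong_act h fcong_refl)
    also have "fcong n \<dots> (oid K J)"
      unfolding gs using filt_minus[OF fxp[of n K J]] by (simp add: fcong_def)
    finally show "fcong n (ocomp g h K J) (oid K J)" .
  qed
  moreover have "ocomp h g = oid"
  proof (intro ext fcong_all)
    fix K J n
    have "fcong n (ocomp h g K J) (act (s n K) g J)"
      unfolding ocomp_act[OF g(1)] by (intro fcong_act h fcong_refl)
    also have "fcong n \<dots> (oid K J)"
      unfolding sg using filt_minus[OF fxp[of n K J]] by (simp add: fcong_def)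
    finally show "fcong n (ocomp h g K J) (oid K J)" .
  qed
  ultimately show ?thesis using that lh hh by blast
qed

end

text \<open>Keeps multi-indices such as \<open>(1, 0, c)\<close> in the form in which they are written.\<close>

declare One_nat_def [simp del]

section \<open>The normal form\<close>

definition nf :: "(param \<Rightarrow> 'b::ring_1) \<Rightarrow> nat \<Rightarrow> mi \<Rightarrow> 'b" where
  "nf u j = (\<lambda>(a, b, c).
     if j = 2 then
       if (a, b, c) = (1, 1, 0) then 1 else if (a, b, c) = (1, 0, 0) then u PS
       else if (a, b, c) = (0, 1, 0) then u PEta else 0
     else if j = 3 \<and> b = 0 then
       if a = 1 then u (PT c) else if a = 0 \<and> c > 0 then u (PTheta (c - 1)) else 0
     else 0)"

definition NF :: "(param \<Rightarrow> 'b::ring_1) \<Rightarrow> 'b opr" where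
  "NF u = field_matrix 1 (nf u)"

lemma nf_simps [simp]:
  "nf u 2 (0, b, c) = (if b = 1 \<and> c = 0 then u PEta else 0)"
  "nf u 2 (1, b, c) = (if b = 1 \<and> c = 0 then 1 else if b = 0 \<and> c = 0 then u PS else 0)"
  "nf u 2 (Suc 0, b, c) = (if b = 1 \<and> c = 0 then 1 else if b = 0 \<and> c = 0 then u PS else 0)"
  "nf u 3 (1, b, c) = (if b = 0 then u (PT c) else 0)"
  "nf u 3 (Suc 0, b, c) = (if b = 0 then u (PT c) else 0)"
  "nf u 3 (0, b, c) = (if b = 0 \<and> c > 0 then u (PTheta (c - 1)) else 0)"
  "nf u 1 J = 0" "nf u (Suc 0) J = 0"
  by (cases J, simp add: nf_def)+

lemma MIfield_nf: "MIfield (nf u)"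
  by (auto simp: MIfield_def nf_def MI_iff)

lemma NF_zero_eq: "NF (\<lambda>_. 0) K J = (case K of (a, b, c) \<Rightarrow> if a = 0 \<and> J = (1, b, c) then of_nat b else 0)"
proof -
  obtain a b c where K: "K = (a, b, c)" by (cases K)
  obtain a' b' c' where J: "J = (a', b', c')" by (cases J)
  have 2: "nf (\<lambda>_. 0 :: 'a) 2 M = (if M = (1, 1, 0) then 1 else 0)" for M
    by (cases M) (simp add: nf_def)
  have 3: "nf (\<lambda>_. 0 :: 'a) 3 M = 0" for M
    by (cases M) (simp add: nf_def)
  show ?thesis
    by (cases b) (auto simp: NF_def K J field_matrix_def field_row_def MI_iff shift_eq 2 3)
qed

lemma MIsupported_NF: "MIsupported (NF u)"
  by (simp add: NF_def MIsupported_field_matrix)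

lemma derivation_NF: "derivation 1 (NF u)"
  by (simp add: NF_def derivation_field_matrix MIfield_nf)

lemma lower_NF: "lower (NF u)"
  by (rule derivation_lower[OF MIsupported_NF derivation_NF])

lemma NF_evec: "j \<in> {1, 2, 3} \<Longrightarrow> NF u (evec j) = nf u j"
  by (intro ext) (simp add: NF_def field_matrix_evec[OF MIfield_nf])

lemma act_NF_zero:
  assumes "f (0, 0, 0) = 0" "J \<in> MI"
  shows "act f (NF (\<lambda>_. 0)) J = (case J of (a, b, c) \<Rightarrow> if a = 1 then f (0, b, c) * of_nat b else 0)"
proof -
  obtain a b c where J: "J = (a, b, c)" by (cases J)
  have "act f (NF (\<lambda>_. 0)) J = (\<Sum>M\<in>insert (0, b, c) (below J). f M * NF (\<lambda>_. 0) M J)"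
    by (rule act_superset[OF lower_NF]) auto
  also have "\<dots> = (\<Sum>M\<in>{(0, b, c)}. f M * NF (\<lambda>_. 0) M J)"
    by (rule sum.mono_neutral_right) (auto simp: NF_zero_eq J split: if_splits)
  finally show ?thesis by (auto simp: NF_zero_eq J)
qed

lemma nf_zero_2: "nf (\<lambda>_. 0) 2 = rind (1, 1, 0)"
  by (rule ext) (auto simp: nf_def rind_def split: if_splits)

lemma nf_zero_13: "j \<in> {1, 3} \<Longrightarrow> nf (\<lambda>_. 0) j = (\<lambda>_. 0)"
  by (rule ext) (auto simp: nf_def)

lemma NF_100: "NF u (1, 0, 0) J = 0"
  using NF_evec[of 1 u] by (simp add: evec_def)

lemma NF_010: "NF u (0, 1, 0) J = nf u 2 J"
  using NF_evec[of 2 u] by (simp add: evec_def)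

lemma NF_110: "J \<in> MI \<Longrightarrow> NF u (1, 1, 0) J = - shift (1, 0, 0) (nf u 2) J"
  by (simp add: NF_def field_matrix_def field_row_def MI_iff shift_def)

lemma NF_10c: "J \<in> MI \<Longrightarrow> NF u (1, 0, c) J = - (of_nat c * shift (1, 0, c - 1) (nf u 3) J)"
  by (simp add: NF_def field_matrix_def field_row_def MI_iff shift_def)

lemma NF_00c: "J \<in> MI \<Longrightarrow> NF u (0, 0, Suc c) J = of_nat (Suc c) * shift (0, 0, c) (nf u 3) J"
  by (simp add: NF_def field_matrix_def field_row_def MI_iff shift_def)

lemma act_nf_1: "act (nf u 1) T J = 0"
  by (simp add: act_def)

lemma act_nf_2:
  assumes "lower T"
  shows "act (nf u 2) T J = T (1, 1, 0) J + u PS * T (1, 0, 0) J + u PEta * T (0, 1, 0) J"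
proof -
  have "act (nf u 2) T J = (\<Sum>M\<in>below J \<union> {(1, 1, 0), (1, 0, 0), (0, 1, 0)}. nf u 2 M * T M J)"
    by (rule act_superset[OF assms]) auto
  also have "\<dots> = (\<Sum>M\<in>{(1, 1, 0), (1, 0, 0), (0, 1, 0)}. nf u 2 M * T M J)"
    by (rule sum.mono_neutral_right) (auto simp: nf_def split: if_splits)
  finally show ?thesis by simp
qed

lemma act_nf_3:
  assumes "lower T" "deg J \<le> n"
  shows "act (nf u 3) T J =
    (\<Sum>c<n. u (PT c) * T (1, 0, c) J) + (\<Sum>c<n. u (PTheta c) * T (0, 0, Suc c) J)"
proof -
  let ?f = "\<lambda>c. (1, 0, c) :: mi" and ?g = "\<lambda>c. (0, 0, Suc c) :: mi"
  let ?S = "?f ` {..<n} \<union> ?g ` {..<n}"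
  have "act (nf u 3) T J = (\<Sum>M\<in>below J \<union> ?S. nf u 3 M * T M J)"
    by (rule act_superset[OF assms(1)]) auto
  also have "\<dots> = (\<Sum>M\<in>?S. nf u 3 M * T M J)"
  proof (rule sum.mono_neutral_right)
    show "\<forall>M\<in>below J \<union> ?S - ?S. nf u 3 M * T M J = 0"
    proof
      fix M assume M: "M \<in> below J \<union> ?S - ?S"
      obtain a b c where M': "M = (a, b, c)" by (cases M)
      have "a + b + c \<le> n" using M assms(2) by (auto simp: M' below_iff deg_def)
      moreover have "\<not> (b = 0 \<and> a = 1 \<and> c < n)" using M by (auto simp: M')
      moreover have "\<not> (b = 0 \<and> a = 0 \<and> 0 < c \<and> c \<le> n)"
      proof
        assume h: "b = 0 \<and> a = 0 \<and> 0 < c \<and> c \<le> n"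
        then have "M = ?g (c - 1)" "c - 1 \<in> {..<n}" by (auto simp: M')
        then have "M \<in> ?S" by blast
        with M show False by blast
      qed
      ultimately have "nf u 3 M = 0" by (auto simp: nf_def M')
      then show "nf u 3 M * T M J = 0" by simp
    qed
  qed auto
  also have "\<dots> = (\<Sum>M\<in>?f ` {..<n}. nf u 3 M * T M J) + (\<Sum>M\<in>?g ` {..<n}. nf u 3 M * T M J)"
    by (rule sum.union_disjoint) auto
  also have "\<dots> = (\<Sum>c<n. u (PT c) * T (1, 0, c) J) + (\<Sum>c<n. u (PTheta c) * T (0, 0, Suc c) J)"
    by (simp add: sum.reindex inj_on_def)
  finally show ?thesis .
qed

definition t_theta_relation :: "(param \<Rightarrow> 'b::ring_1) \<Rightarrow> nat \<Rightarrow> 'b" where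
  "t_theta_relation u n = (\<Sum>k=1..n. let l = n + 1 - k in
     of_int (int k - int l - 1) * (u (PT (k - 1)) * u (PTheta (l - 1))))"

definition theta_theta_relation :: "(param \<Rightarrow> 'b::ring_1) \<Rightarrow> nat \<Rightarrow> 'b" where
  "theta_theta_relation u n = (\<Sum>k=1..n. let l = n + 1 - k in
     of_int (int k - int l) * (u (PTheta (k - 1)) * u (PTheta (l - 1))))"

context local_superalgebra
begin

definition params :: "(param \<Rightarrow> 'a) \<Rightarrow> bool" where
  "params u \<longleftrightarrow> (\<forall>x. u x \<in> hpart A (ppar x))"

lemma params_zero: "params (\<lambda>_. 0)"
  by (simp add: params_def)

lemma vector_field_nf:
  assumes "params u" shows "vector_field 1 (nf u)"
  unfolding vector_field_def
proof (intro conjI allI)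
  fix j and J :: mi
  obtain a b c where J: "J = (a, b, c)" by (cases J)
  have p: "u x \<in> hpart A q" if "even (q + ppar x)" for x q
    using assms hpart_cong[of q "ppar x" A] that by (auto simp: params_def)
  have one: "1 \<in> hpart A 2" using one_even hpart_cong[of 0 2 A] by simp
  show "nf u j J \<in> hpart A (1 + par (evec j) + par J)"
    using one by (auto simp: nf_def J par_def evec_def numeral_2_eq_2 intro!: p)
qed (rule MIfield_nf)

lemma params_hpart: "params u \<Longrightarrow> ppar x = p \<Longrightarrow> u x \<in> hpart A p"
  by (auto simp: params_def)

lemma homogeneous_NF: "params u \<Longrightarrow> homogeneous 1 (NF u)"
  by (simp add: NF_def homogeneous_field_matrix vector_field_nf)

lemma params_anticommute: "params u \<Longrightarrow> u (PTheta i) * u (PTheta j) = - (u (PTheta j) * u (PTheta i))"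
  using supercommute[OF params_hpart[of u "PTheta i" 1] params_hpart[of u "PTheta j" 1]] by simp

lemma params_commute: "params u \<Longrightarrow> u (PT i) * u (PTheta j) = u (PTheta j) * u (PT i)"
  using supercommute[OF params_hpart[of u "PT i" 0] params_hpart[of u "PTheta j" 1]] by simp

lemma params_commute_PS: "params u \<Longrightarrow> u PS * u PEta = u PEta * u PS"
  using supercommute[OF params_hpart[of u PS 0] params_hpart[of u PEta 1]] by simp

lemma params_square: "params u \<Longrightarrow> u PEta * u PEta = 0"
proof -
  assume "params u"
  then have "u PEta \<in> hpart A 1" by (metis params_def ppar.simps(2))
  then have "u PEta * u PEta = - (u PEta * u PEta)"
    using supercommute[of "u PEta" 1 "u PEta" 1] by simp
  then have "u PEta * u PEta + u PEta * u PEta = - (u PEta * u PEta) + u PEta * u PEta"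
    by (rule arg_cong)
  then have "scale A 2 (u PEta * u PEta) = 0"
    using scale_left_distrib[of 1 1 "u PEta * u PEta"] by simp
  then show ?thesis by simp
qed

lemma NFNF_2:
  assumes u: "params u" and J: "J \<in> MI"
  shows "act (nf u 2) (NF u) J = (if J = (1, 0, 0) then u PEta * u PS else 0)"
proof -
  consider b c where "J = (0, b, c)" "(b, c) \<noteq> (0, 0)" | b c where "J = (1, b, c)"
    using J MI_cases by blast
  then show ?thesis
  proof cases
    case (1 b c)
    then show ?thesis
      unfolding act_nf_2[OF lower_NF] NF_110[OF J] NF_100 NF_010
      by (simp add: shift_eq params_square[OF u])
  next
    case (2 b c)
    then show ?thesis
      unfolding act_nf_2[OF lower_NF] NF_110[OF J] NF_100 NF_010
      by (auto simp: shift_eq)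
  qed
qed

lemma NFNF_3:
  assumes J: "J \<in> MI" and n: "deg J \<le> n"
  shows "act (nf u 3) (NF u) J = (\<Sum>c<n. u (PTheta c) * (of_nat (Suc c) * shift (0, 0, c) (nf u 3) J)) -
    (\<Sum>c<n. u (PT c) * (of_nat c * shift (1, 0, c - 1) (nf u 3) J))"
  by (simp only: act_nf_3[OF lower_NF n] NF_10c[OF J] NF_00c[OF J])
     (simp add: sum_negf)

lemma NFNF_3_b: "(a, Suc b, c) \<in> MI \<Longrightarrow> act (nf u 3) (NF u) (a, Suc b, c) = 0"
proof -
  assume J: "(a, Suc b, c) \<in> MI"
  have "shift (0, 0, k) (nf u 3) (a, Suc b, c) = 0" "shift (1, 0, k) (nf u 3) (a, Suc b, c) = 0" for k
    by (auto simp: shift_eq nf_def)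
  then show ?thesis unfolding NFNF_3[OF J order_refl] by simp
qed

lemma of_nat_mid: "x * (of_nat k * y) = of_nat k * (x * (y :: 'b::ring_1))"
  by (metis mult.assoc mult_of_nat_commute)

lemma NFNF_3_t:
  assumes u: "params u"
  shows "act (nf u 3) (NF u) (1, 0, n) = - t_theta_relation u (Suc n)"
proof -
  have n: "deg (1, 0, n) \<le> Suc n" and MI: "(1, 0, n) \<in> MI" by (simp_all add: deg_def MI_iff)
  have "act (nf u 3) (NF u) (1, 0, n) =
     (\<Sum>c<Suc n. u (PTheta c) * (of_nat (Suc c) * u (PT (n - c)))) -
     (\<Sum>c<Suc n. u (PT c) * (of_nat c * u (PTheta (n - c))))"
    unfolding NFNF_3[OF MI n]
  proof (intro arg_cong2[of _ _ _ _ "(-)"] sum.cong refl)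
    fix c assume "c \<in> {..<Suc n}"
    then show "u (PTheta c) * (of_nat (Suc c) * shift (0, 0, c) (nf u 3) (1, 0, n)) =
        u (PTheta c) * (of_nat (Suc c) * u (PT (n - c)))"
      by (simp add: shift_eq)
  next
    fix c assume "c \<in> {..<Suc n}"
    then show "u (PT c) * (of_nat c * shift (1, 0, c - 1) (nf u 3) (1, 0, n)) =
        u (PT c) * (of_nat c * u (PTheta (n - c)))"
      by (cases c) (auto simp: shift_eq Suc_diff_Suc One_nat_def)
  qed
  also have "(\<Sum>c<Suc n. u (PTheta c) * (of_nat (Suc c) * u (PT (n - c)))) =
      (\<Sum>c<Suc n. of_nat (Suc n - c) * (u (PT c) * u (PTheta (n - c))))"
    by (rule sum.reindex_bij_witness[of _ "\<lambda>c. n - c" "\<lambda>c. n - c"])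
       (auto simp: params_commute[OF u] of_nat_mid Suc_diff_le simp del: of_nat_Suc)
  also have "(\<Sum>c<Suc n. u (PT c) * (of_nat c * u (PTheta (n - c)))) =
      (\<Sum>c<Suc n. of_nat c * (u (PT c) * u (PTheta (n - c))))"
    by (rule sum.cong) (auto simp: mult_of_nat_commute mult.assoc)
  also have "(\<Sum>c<Suc n. of_nat (Suc n - c) * (u (PT c) * u (PTheta (n - c)))) -
      (\<Sum>c<Suc n. of_nat c * (u (PT c) * u (PTheta (n - c)))) =
      (\<Sum>c<Suc n. - (of_int (int (Suc c) - int (Suc (n - c)) - 1) * (u (PT c) * u (PTheta (n - c)))))"
    unfolding sum_subtractf[symmetric] left_diff_distrib[symmetric] minus_mult_left
    by (rule sum.cong) (auto simp: of_nat_diff Suc_diff_le algebra_simps mult_2)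
  also have "\<dots> = - t_theta_relation u (Suc n)"
    unfolding t_theta_relation_def Let_def sum_negf
    by (rule arg_cong[of _ _ uminus], rule sum.reindex_bij_witness[of _ "\<lambda>k. k - 1" Suc])
       (auto simp: Suc_diff_le)
  finally show ?thesis .
qed

lemma NFNF_3_theta:
  assumes u: "params u"
  shows "act (nf u 3) (NF u) (0, 0, Suc n) + act (nf u 3) (NF u) (0, 0, Suc n) = theta_theta_relation u (Suc n)"
proof -
  have n: "deg (0, 0, Suc n) \<le> Suc n" and MI: "(0, 0, Suc n) \<in> MI" by (simp_all add: deg_def MI_iff)
  let ?t = "\<lambda>c. u (PTheta c) * u (PTheta (n - c))"
  have 1: "act (nf u 3) (NF u) (0, 0, Suc n) = (\<Sum>c<Suc n. of_nat (Suc c) * ?t c)"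
  proof -
    have "shift (1, 0, k) (nf u 3) (0, 0, Suc n) = 0" for k by (simp add: shift_eq)
    moreover have "u (PTheta c) * (of_nat (Suc c) * shift (0, 0, c) (nf u 3) (0, 0, Suc n)) =
        of_nat (Suc c) * ?t c" if "c < Suc n" for c
    proof -
      have "shift (0, 0, c) (nf u 3) (0, 0, Suc n) = u (PTheta (n - c))"
        using that by (simp add: shift_eq)
      then show ?thesis by (metis mult.assoc mult_of_nat_commute)
    qed
    ultimately show ?thesis unfolding NFNF_3[OF MI n] by simp
  qed
  have 2: "(\<Sum>c<Suc n. of_nat (Suc c) * ?t c) = - (\<Sum>c<Suc n. of_nat (Suc (n - c)) * ?t c)"
    unfolding sum_negf[symmetric]
    by (rule sum.reindex_bij_witness[of _ "\<lambda>c. n - c" "\<lambda>c. n - c"])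
       (auto simp: params_anticommute[OF u, of "_ - _"])
  have "act (nf u 3) (NF u) (0, 0, Suc n) + act (nf u 3) (NF u) (0, 0, Suc n) =
      (\<Sum>c<Suc n. of_int (int (Suc c) - int (Suc (n - c))) * ?t c)"
    by (subst (2) 1, subst 1, subst (2) 2)
       (simp only: sum_negf[symmetric] sum.distrib[symmetric], rule sum.cong, simp_all add: algebra_simps mult_2)
  also have "\<dots> = theta_theta_relation u (Suc n)"
    unfolding theta_theta_relation_def Let_def
    by (rule sum.reindex_bij_witness[of _ "\<lambda>k. k - 1" Suc]) (auto simp: Suc_diff_le)
  finally show ?thesis .
qed

lemma half_zero: "x + x = 0 \<Longrightarrow> x = (0 :: 'a)"
  using scale_left_distrib[of 1 1 x] by (simp add: scale_eq_0_iff)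

lemma ocomp_NF_NF: "j \<in> {1, 2, 3} \<Longrightarrow> ocomp (NF u) (NF u) (evec j) J = act (nf u j) (NF u) J"
  using NF_evec[of j u] by (simp add: ocomp_act lower_NF)

lemma NF_square_relations:
  assumes u: "params u" and z: "ocomp (NF u) (NF u) = (\<lambda>_ _. 0)"
  shows "u PS * u PEta = 0" "n \<ge> 1 \<Longrightarrow> t_theta_relation u n = 0" "n \<ge> 1 \<Longrightarrow> theta_theta_relation u n = 0"
proof -
  have r: "act (nf u j) (NF u) J = 0" if "j \<in> {1, 2, 3}" for j J
    using ocomp_NF_NF[OF that, of u J] z by simp
  have "u PEta * u PS = 0"
    using NFNF_2[OF u, of "(1, 0, 0)"] r[of 2] by (simp add: MI_iff)
  then show "u PS * u PEta = 0"
    using params_commute_PS[OF u] by simp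
  show "t_theta_relation u n = 0" if "n \<ge> 1" using NFNF_3_t[OF u, of "n - 1"] r[of 3] that by simp
  show "theta_theta_relation u n = 0" if "n \<ge> 1" using NFNF_3_theta[OF u, of "n - 1"] r[of 3] that by simp
qed

lemma brk_self: "brk 1 1 T T K J = ocomp T T K J + ocomp T T K J"
  by (simp add: brk_def)

lemma NF_square_zero:
  assumes u: "params u" and "u PS * u PEta = 0" "\<And>n. n \<ge> 1 \<Longrightarrow> t_theta_relation u n = 0" "\<And>n. n \<ge> 1 \<Longrightarrow> theta_theta_relation u n = 0"
  shows "brk 1 1 (NF u) (NF u) = (\<lambda>_ _. 0)"
proof (rule derivation_eqI)
  have l: "lower (brk 1 1 (NF u) (NF u))"
    unfolding lower_def brk_self
    using lowerD[OF lower_ocomp[OF lower_NF lower_NF]] by (metis add.right_neutral)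
  show "MIsupported (brk 1 1 (NF u) (NF u))" by (rule lower_MIsupported[OF l])
  show "derivation (1 + 1) (brk 1 1 (NF u) (NF u))"
    by (intro derivation_brk MIsupported_NF derivation_NF homogeneous_NF u)
  show "derivation (1 + 1) (\<lambda>_ _. 0 :: 'a)" by (simp add: derivation_def product_row_def rprod_def split_def)
  show "MIsupported (\<lambda>_ _. 0 :: 'a)" by (simp add: MIsupported_def)
  have e: "u PEta * u PS = 0"
    using params_commute_PS[OF u] assms(2) by simp
  fix j J assume j: "j \<in> {1, 2, 3 :: nat}" and J: "J \<in> MI"
  have "act (nf u j) (NF u) J = 0"
  proof -
    consider "j = 1" | "j = 2" | "j = 3" using j by auto
    then show ?thesis
    proof cases
      case 1 then show ?thesis using act_nf_1[of u "NF u" J] by simp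
    next
      case 2 then show ?thesis using NFNF_2[OF u J] e by simp
    next
      case 3
      obtain a b c where J': "J = (a, b, c)" by (cases J)
      consider b' where "b = Suc b'" | "b = 0" "a = 1" | c' where "b = 0" "a = 0" "c = Suc c'"
        using J by (cases b; cases c) (auto simp: J' MI_iff)
      then show ?thesis
      proof cases
        case 1 then show ?thesis using NFNF_3_b J 3 by (simp add: J')
      next
        case 2 then show ?thesis using NFNF_3_t[OF u] assms(3)[of "Suc c"] 3 by (simp add: J')
      next
        case (3 c')
        have "act (nf u 3) (NF u) (0, 0, Suc c') + act (nf u 3) (NF u) (0, 0, Suc c') = 0"
          using NFNF_3_theta[OF u, of c'] assms(4)[of "Suc c'"] by simp
        from half_zero[OF this] show ?thesis using 3 \<open>j = 3\<close> by (simp add: J')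
      qed
    qed
  qed
  then show "brk 1 1 (NF u) (NF u) (evec j) J = 0" unfolding brk_self by (simp add: ocomp_NF_NF[OF j])
qed

end

section \<open>Reduction of a deformation to the normal form\<close>

context formal_base
begin

definition small :: "(param \<Rightarrow> 'a) \<Rightarrow> bool" where
  "small u \<longleftrightarrow> (\<forall>x. u x \<in> filt A 1)"

definition near :: "(nat \<Rightarrow> mi \<Rightarrow> 'a) \<Rightarrow> bool" where
  "near \<gamma> \<longleftrightarrow> (\<forall>j\<in>{1, 2, 3}. \<forall>J. fcong 1 (\<gamma> j J) (rind (evec j) J))"

lemma nearD: "near \<gamma> \<Longrightarrow> j \<in> {1, 2, 3} \<Longrightarrow> fcong 1 (\<gamma> j J) (rind (evec j) J)"
  unfolding near_def by blast

lemma fcong_nf: "(\<And>x. fcong n (u x) (v x)) \<Longrightarrow> fcong n (nf u j J) (nf v j J)"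
  by (cases J) (simp add: nf_def)

lemma fcong_NF: "(\<And>x. fcong n (u x) (v x)) \<Longrightarrow> fcong n (NF u K J) (NF v K J)"
  unfolding NF_def by (intro fcong_field_matrix fcong_nf)

lemma small_NF: "small u \<Longrightarrow> fcong 1 (NF u K J) (NF (\<lambda>_. 0) K J)"
  by (rule fcong_NF) (simp add: small_def fcong_zero)

lemma near_morphism:
  assumes "vector_field 0 \<gamma>" "near \<gamma>" shows "fcong 1 (morphism \<gamma> K J) (oid K J)"
proof (rule fcong_multiplicative[OF MIsupported_morphism multiplicative_morphism[OF assms(1)] lower_MIsupported[OF lower_oid] multiplicative_oid])
  fix j :: nat and J assume j: "j \<in> {1, 2, 3}"
  then have "(oid (evec j) :: mi \<Rightarrow> 'a) = rind (evec j)" by (intro oid_rind evec_MI)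
  then show "fcong 1 (morphism \<gamma> (evec j) J) (oid (evec j) J)"
    using nearD[OF assms(2) j] by (simp add: morphism_evec[OF vector_field_MIfield[OF assms(1)] j])
qed

lemma lower_morphism: "vector_field 0 \<gamma> \<Longrightarrow> lower (morphism \<gamma>)"
  by (rule multiplicative_lower[OF MIsupported_morphism multiplicative_morphism])

end

locale deformed = formal_base A for A :: "'a::ring_1 salg" +
  fixes Q :: "'a opr"
  assumes Q: "MIsupported Q" "derivation 1 Q" "homogeneous 1 Q"
    and QQ: "ocomp Q Q = (\<lambda>_ _. 0)"
    and Q0: "\<And>K J. fcong 1 (Q K J) (NF (\<lambda>_. 0) K J)"
begin

lemma lower_Q: "lower Q"
  by (rule derivation_lower[OF Q(1,2)])

definition err :: "(nat \<Rightarrow> mi \<Rightarrow> 'a) \<Rightarrow> (param \<Rightarrow> 'a) \<Rightarrow> 'a opr" where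
  "err \<gamma> u K J = ocomp (NF u) (morphism \<gamma>) K J - ocomp (morphism \<gamma>) Q K J"

lemma err_act: "vector_field 0 \<gamma> \<Longrightarrow> err \<gamma> u K J = act (NF u K) (morphism \<gamma>) J - act (morphism \<gamma> K) Q J"
  by (simp add: err_def ocomp_act lower_morphism lower_Q)

lemma lower_err: "vector_field 0 \<gamma> \<Longrightarrow> lower (err \<gamma> u)"
  using lower_ocomp[OF lower_NF[of u] lower_morphism[of \<gamma>]] lower_ocomp[OF lower_morphism[of \<gamma>] lower_Q]
  unfolding lower_def err_def by (metis diff_zero)

lemma homogeneous_err:
  assumes "vector_field 0 \<gamma>" "params u" shows "homogeneous 1 (err \<gamma> u)"
  unfolding homogeneous_def err_def ocomp_def
proof (intro allI hpart_diff hpart_sum)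
  fix K J M
  show "NF u K M * morphism \<gamma> M J \<in> hpart A (1 + par K + par J)"
    by (rule hpart_mult'[OF hopD[OF homogeneous_NF[OF assms(2)]] hopD[OF homogeneous_morphism[OF assms(1)]]]) (simp, blast)
  show "morphism \<gamma> K M * Q M J \<in> hpart A (1 + par K + par J)"
    by (rule hpart_mult'[OF hopD[OF homogeneous_morphism[OF assms(1)]] hopD[OF Q(3)]]) (simp, blast)
qed

lemma product_row_err:
  assumes "vector_field 0 \<gamma>" "params u" "K \<in> MI" "L \<in> MI" "J \<in> MI"
  shows "product_row (err \<gamma> u) K L J = (-1) ^ ((1 + par K) * par L) * rprod (par L) (err \<gamma> u K) (morphism \<gamma> L) J +
    (-1) ^ (par K * par L) * rprod (1 + par L) (morphism \<gamma> K) (err \<gamma> u L) J"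
  by (rule product_row_intertwine[OF MIsupported_NF derivation_NF homogeneous_NF[OF assms(2)] Q MIsupported_morphism multiplicative_morphism[OF assms(1)]
        homogeneous_morphism[OF assms(1)] _ assms(3-5)]) (intro ext, simp add: err_def)

lemma err_filt:
  assumes \<gamma>: "vector_field 0 \<gamma>" and u: "params u"
    and e: "\<And>j J. j \<in> {1, 2, 3} \<Longrightarrow> err \<gamma> u (evec j) J \<in> filt A n"
  shows "err \<gamma> u K J \<in> filt A n"
proof (cases "K \<in> MI")
  case True
  then have "\<forall>J. err \<gamma> u K J \<in> filt A n"
  proof (induction rule: mi_induct)
    case (add K L)
    show ?case
    proof
      fix J show "err \<gamma> u (K + L) J \<in> filt A n"
      proof (cases "J \<in> MI")
        case True
        have "err \<gamma> u (K + L) J = product_row (err \<gamma> u) K L J" using add by (simp add: product_row_def)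
        also have "\<dots> \<in> filt A n"
          unfolding product_row_err[OF \<gamma> u add(1,2) True]
          by (intro filt_add filt_mult_left rprod_filt_left rprod_filt_right) (use add.IH in auto)
        finally show ?thesis .
      qed (simp add: lower_outside[OF lower_err[OF \<gamma>]])
    qed
  qed (use e in blast)
  then show ?thesis by blast
qed (simp add: lower_outside[OF lower_err[OF \<gamma>]])

definition good :: "nat \<Rightarrow> (nat \<Rightarrow> mi \<Rightarrow> 'a) \<times> (param \<Rightarrow> 'a) \<Rightarrow> bool" where
  "good n s \<longleftrightarrow> vector_field 0 (fst s) \<and> near (fst s) \<and> params (snd s) \<and> small (snd s) \<and>
     (\<forall>j\<in>{1, 2, 3}. \<forall>J. err (fst s) (snd s) (evec j) J \<in> filt A n)"

text \<open>
  The identity \<open>N E + E Q = N N g\<close> for \<open>E = N g - g Q\<close>: to first order it says that the error is a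
  cocycle, up to the value of \<open>N N\<close>.
\<close>

lemma err_identity:
  assumes "vector_field 0 \<gamma>"
  shows "act (NF u K) (err \<gamma> u) J + act (err \<gamma> u K) Q J = act (act (NF u K) (NF u)) (morphism \<gamma>) J"
proof -
  have lg: "lower (morphism \<gamma>)" using assms by (rule lower_morphism)
  have "err \<gamma> u = (\<lambda>K J. ocomp (NF u) (morphism \<gamma>) K J - ocomp (morphism \<gamma>) Q K J)"
    by (intro ext) (simp add: err_def)
  then have "act (NF u K) (err \<gamma> u) J =
      act (NF u K) (ocomp (NF u) (morphism \<gamma>)) J - act (NF u K) (ocomp (morphism \<gamma>) Q) J"
    by (simp only: act_diff_right)
  also have "\<dots> = act (act (NF u K) (NF u)) (morphism \<gamma>) J - act (act (NF u K) (morphism \<gamma>)) Q J"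
    by (simp only: act_act[OF lower_NF lg] act_act[OF lg lower_Q])
  finally have 1: "act (NF u K) (err \<gamma> u) J = \<dots>" .
  have "err \<gamma> u K = (\<lambda>J. act (NF u K) (morphism \<gamma>) J - act (morphism \<gamma> K) Q J)"
    by (rule ext) (rule err_act[OF assms])
  then have "act (err \<gamma> u K) Q J = act (act (NF u K) (morphism \<gamma>)) Q J - act (act (morphism \<gamma> K) Q) Q J"
    by (simp only: act_diff_left)
  moreover have "act (act (morphism \<gamma> K) Q) Q J = 0"
    unfolding act_act[OF lower_Q lower_Q] QQ by (simp add: act_def)
  ultimately show ?thesis using 1 by simp
qed

lemma err_cocycle:
  assumes s: "good n (\<gamma>, u)" and n: "n \<ge> 1"
  defines "E \<equiv> \<lambda>j. err \<gamma> u (evec j)"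
  shows "E 1 (0, b, c) \<in> filt A (Suc n)" "E 2 (0, 0, c) \<in> filt A (Suc n)"
    "E 1 (1, b, c) + of_nat b * E 2 (0, Suc b, c) \<in> filt A (Suc n)"
    "E 3 (0, Suc b, c) \<in> filt A (Suc n)"
proof -
  have \<gamma>: "vector_field 0 \<gamma>" "near \<gamma>" and u: "params u" "small u"
    and e: "\<And>j J. j \<in> {1, 2, 3} \<Longrightarrow> err \<gamma> u (evec j) J \<in> filt A n"
    using s by (auto simp: good_def)
  let ?E = "err \<gamma> u" and ?g = "morphism \<gamma>"
  have Ef: "?E K J \<in> filt A n" for K J by (rule err_filt[OF \<gamma>(1) u(1) e])
  have E0: "?E K (0, 0, 0) = 0" for K by (rule lower_outside[OF lower_err[OF \<gamma>(1)]]) (simp add: MI_iff)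
  have g1: "fcong 1 (?g K J) (oid K J)" for K J by (rule near_morphism[OF \<gamma>])
  define R where "R j = act (nf u j) (NF u)" for j
  have Roff: "R j J = 0" if "J \<notin> MI" for j J
    using that by (simp add: R_def act_def lower_outside[OF lower_NF])
  have main: "act (nf u j) ?E J + act (E j) Q J = act (R j) ?g J" if "j \<in> {1, 2, 3}" for j J
    using err_identity[OF \<gamma>(1), of u "evec j" J] that by (simp add: NF_evec R_def E_def)
  have Rg: "act (R j) ?g J \<in> filt A n" if "j \<in> {1, 2, 3}" for j J
    unfolding main[OF that, symmetric]
    by (intro filt_add act_filt_left act_filt_right) (simp_all add: E_def Ef)
  have actR: "act (R j) oid J = R j J" for j J
    using act_oid_fun[of "R j"] Roff by simp
  have Rk: "k \<le> n \<Longrightarrow> R j J \<in> filt A k" if "j \<in> {1, 2, 3}" for j J k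
  proof (induction k arbitrary: J)
    case (Suc k)
    have "R j M \<in> filt A k" for M using Suc by simp
    then have "fcong (Suc k) (act (R j) ?g J) (act (R j) oid J)"
      by (rule act_small_left[OF _ g1])
    then have "fcong (Suc k) (R j J) (act (R j) ?g J)" unfolding actR by (rule fcong_sym)
    moreover have "act (R j) ?g J \<in> filt A (Suc k)"
      using Rg[OF that] filt_mono[OF Suc.prems] by blast
    ultimately show ?case by (rule fcong_filt)
  qed simp
  have key: "fcong (Suc n) (act (nf (\<lambda>_. 0) j) ?E J + act (E j) (NF (\<lambda>_. 0)) J) (R j J)"
    if j: "j \<in> {1, 2, 3}" for j J
  proof -
    have "fcong (Suc n) (act (nf u j) ?E J) (act (nf (\<lambda>_. 0) j) ?E J)"
      by (rule act_small_right[OF Ef fcong_nf]) (use u(2) in \<open>simp add: small_def fcong_zero\<close>)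
    moreover have "fcong (Suc n) (act (E j) Q J) (act (E j) (NF (\<lambda>_. 0)) J)"
      by (rule act_small_left) (simp_all add: E_def Ef Q0)
    moreover have "fcong (Suc n) (act (R j) ?g J) (act (R j) oid J)"
      by (rule act_small_left[OF Rk[OF j order_refl] g1])
    then have "fcong (Suc n) (act (R j) ?g J) (R j J)" by (simp only: actR)
    ultimately show ?thesis
      using main[OF j, of J] fcong_add fcong_sym fcong_trans by metis
  qed
  have D: "act (E j) (NF (\<lambda>_. 0)) (0, b, c) = 0" if "(b, c) \<noteq> (0, 0)" for j b c
    using that by (subst act_NF_zero) (auto simp: MI_iff E_def E0)
  have D1: "act (E j) (NF (\<lambda>_. 0)) (1, b, c) = of_nat b * E j (0, b, c)" for j b c
    by (subst act_NF_zero) (auto simp: MI_iff E_def E0 mult_of_nat_commute)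
  have E110: "fcong (Suc n) (?E (1, 1, 0) J) (shift (0, 1, 0) (E 1) J - shift (1, 0, 0) (E 2) J)"
    if J: "J \<in> MI" for J
  proof -
    have J1: "fst J \<le> 1" using J by (auto simp: MI_def)
    have series_eval: "evec 1 = (1, 0, 0)" "evec 2 = (0, 1, 0)" by (simp_all add: evec_def)
    have 1: "?E (1, 1, 0) J = rprod 0 (E 1) (?g (evec 2)) J + rprod 1 (?g (evec 1)) (E 2) J"
    proof -
      have "?E (1, 1, 0) J = product_row ?E (evec 1) (evec 2) J" by (simp add: product_row_def series_eval MI_iff)
      then show ?thesis
        using product_row_err[OF \<gamma>(1) u(1) _ _ J, of "evec 1" "evec 2"] by (simp add: par_evec E_def)
    qed
    have 2: "rprod 0 (E 1) (rind (evec 2)) J + rprod 1 (rind (evec 1)) (E 2) J =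
        shift (0, 1, 0) (E 1) J - shift (1, 0, 0) (E 2) J"
      by (simp add: rprod_rind_left[OF J1] rprod_rind_right[OF J1] par_evec series_eval) (simp add: par_def)
    show ?thesis
      unfolding 1 2[symmetric]
    proof (rule fcong_add)
      show "fcong (Suc n) (rprod 0 (E 1) (?g (evec 2)) J) (rprod 0 (E 1) (rind (evec 2)) J)"
        by (rule rprod_small_left) (use g1[of "evec 2"] in \<open>simp_all add: E_def Ef oid_rind\<close>)
      show "fcong (Suc n) (rprod 1 (?g (evec 1)) (E 2) J) (rprod 1 (rind (evec 1)) (E 2) J)"
        by (rule rprod_small_right) (use g1[of "evec 1"] in \<open>simp_all add: E_def Ef oid_rind\<close>)
    qed
  qed
  have key2: "fcong (Suc n) (shift (0, 1, 0) (E 1) J - shift (1, 0, 0) (E 2) J + act (E 2) (NF (\<lambda>_. 0)) J) (R 2 J)"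
    if J: "J \<in> MI" for J
  proof -
    have "act (nf (\<lambda>_. 0) 2) ?E J = ?E (1, 1, 0) J"
      by (simp add: nf_zero_2 act_rind lower_err \<gamma>)
    then have "fcong (Suc n) (?E (1, 1, 0) J + act (E 2) (NF (\<lambda>_. 0)) J) (R 2 J)"
      using key[of 2 J] by simp
    with fcong_add[OF fcong_sym[OF E110[OF J]] fcong_refl] show ?thesis by (rule fcong_trans)
  qed
  have R2: "R 2 J = (if J = (1, 0, 0) then u PEta * u PS else 0)" if "J \<in> MI" for J
    unfolding R_def by (rule NFNF_2[OF u(1) that])
  show "E 1 (0, b, c) \<in> filt A (Suc n)"
    using key2[of "(0, Suc b, c)"] by (simp add: MI_iff R2 D shift_eq fcong_zero)
  show "E 2 (0, 0, c) \<in> filt A (Suc n)"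
  proof (cases "c = 0")
    case True
    then show ?thesis by (simp add: E_def E0)
  next
    case False
    then show ?thesis
      using key2[of "(1, 0, c)"] by (simp add: MI_iff R2 D1 shift_eq fcong_zero) (use filt_minus in fastforce)
  qed
  show "E 1 (1, b, c) + of_nat b * E 2 (0, Suc b, c) \<in> filt A (Suc n)"
    using key2[of "(1, Suc b, c)"] by (simp add: MI_iff R2 D1 shift_eq fcong_zero algebra_simps)
  show "E 3 (0, Suc b, c) \<in> filt A (Suc n)"
  proof -
    have "act (nf (\<lambda>_. 0) 3) ?E J = 0" for J by (simp add: nf_zero_13 act_def)
    moreover have "R 3 (1, Suc b, c) = 0" unfolding R_def by (rule NFNF_3_b) (simp add: MI_iff)
    ultimately have "of_nat (Suc b) * E 3 (0, Suc b, c) \<in> filt A (Suc n)"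
      using key[of 3 "(1, Suc b, c)"] D1[of 3 "Suc b" c] by (simp add: fcong_zero)
    then show ?thesis by (rule filt_of_nat_cancel[rotated]) simp
  qed
qed

text \<open>
  One step of the gauge fixing: \<open>u\<close> absorbs the harmonic part of the error, and \<open>\<beta>\<close> is the
  explicit homotopy for \<open>[d\<^sub>0, \<cdot>]\<close> applied to the rest.
\<close>

lemma improve:
  assumes s: "good n (\<gamma>, u)" and n: "n \<ge> 1"
  shows "\<exists>s'. good (Suc n) s' \<and> (\<forall>j\<in>{1, 2, 3}. \<forall>J. fcong n (fst s' j J) (\<gamma> j J)) \<and>
    (\<forall>x. fcong n (snd s' x) (u x))"
proof -
  have \<gamma>: "vector_field 0 \<gamma>" "near \<gamma>" and u: "params u" "small u"
    and e: "\<And>j J. j \<in> {1, 2, 3} \<Longrightarrow> err \<gamma> u (evec j) J \<in> filt A n"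
    using s by (auto simp: good_def)
  define E where "E j = err \<gamma> u (evec j)" for j
  have Ef: "E j J \<in> filt A n" for j J
    unfolding E_def by (rule err_filt[OF \<gamma>(1) u(1) e])
  have Eoff: "E j J = 0" if "J \<notin> MI" for j J
    unfolding E_def by (rule lower_outside[OF lower_err[OF \<gamma>(1)]]) (simp add: that)
  have Ehp: "E j J \<in> hpart A q" if "even (q + 1 + par (evec j) + par J)" for j J q
  proof -
    have "even (q + (1 + par (evec j) + par J))" using that by (simp only: add.assoc)
    from hpart_cong[OF this, of A] show ?thesis
      using hopD[OF homogeneous_err[OF \<gamma>(1) u(1)], of "evec j" J] by (simp add: E_def)
  qed
  note coc = err_cocycle[OF s n, folded E_def]
  define u' where "u' x = u x - (case x of PS \<Rightarrow> E 2 (1, 0, 0) | PEta \<Rightarrow> E 2 (0, 1, 0)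
      | PT c \<Rightarrow> E 3 (1, 0, c) | PTheta c \<Rightarrow> E 3 (0, 0, Suc c))" for x
  define \<beta> where "\<beta> j = (\<lambda>(a, b, c).
     if (a, b, c) \<notin> MI then 0
     else if j = 1 then - E 2 (a, Suc b, c)
     else if j = 2 then (if a = 0 \<and> b = 0 then - E 2 (1, 0, c) else 0)
     else if j = 3 then (if a = 0 \<and> b > 0 then scale A (1 / of_nat b) (E 3 (1, b, c)) else 0)
     else 0)" for j :: nat
  define \<gamma>' where "\<gamma>' j J = \<gamma> j J + \<beta> j J" for j J
  have \<beta>f: "\<beta> j J \<in> filt A n" for j J
    by (cases J) (auto simp: \<beta>_def Ef filt_minus filt_scale)
  have \<beta>1: "\<beta> j J \<in> filt A 1" for j J using \<beta>f filt_mono[OF n] by blast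
  have \<beta>hp: "\<beta> j J \<in> hpart A (par (evec j) + par J)" for j J
    by (cases J) (auto simp: \<beta>_def par_def evec_def MI_iff intro!: hpart_minus hpart_scale Ehp)
  have \<gamma>'vector_field: "vector_field 0 \<gamma>'"
  proof -
    have "MIfield \<gamma>'" unfolding MIfield_def \<gamma>'_def
      using moffD[OF vector_field_MIfield[OF \<gamma>(1)]] by (auto simp: \<beta>_def)
    moreover have "\<gamma>' j J \<in> hpart A (0 + par (evec j) + par J)" for j J
      unfolding \<gamma>'_def using vector_field_row[OF \<gamma>(1), of j J] \<beta>hp by (simp add: hpart_add)
    ultimately show ?thesis by (simp add: vector_field_def)
  qed
  have \<gamma>'\<gamma>: "fcong n (\<gamma>' j J) (\<gamma> j J)" for j J by (simp add: \<gamma>'_def fcong_def \<beta>f)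
  have \<gamma>'n: "near \<gamma>'"
    using \<gamma>(2) fcong_trans[OF fcong_mono[OF \<gamma>'\<gamma> n]] by (simp add: near_def)
  have u'u: "fcong n (u' x) (u x)" for x
    by (cases x) (simp_all add: u'_def fcong_def Ef filt_minus)
  have u's: "small u'"
    using u(2) fcong_filt[OF fcong_mono[OF u'u n]] by (simp add: small_def)
  have u'p: "params u'"
    unfolding params_def
  proof
    fix x show "u' x \<in> hpart A (ppar x)"
      unfolding u'_def
      by (rule hpart_diff, rule params_hpart[OF u(1) refl])
         (cases x; simp, intro Ehp, simp add: par_def evec_def)
  qed
  let ?g = "morphism \<gamma>" and ?g' = "morphism \<gamma>'" and ?N0 = "NF (\<lambda>_. 0)"
  define \<nu> where "\<nu> j J = nf u' j J - nf u j J" for j J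
  have \<nu>f: "\<nu> j J \<in> filt A n" for j J
    using fcong_nf[OF u'u] by (simp add: \<nu>_def fcong_def)
  have g'g: "fcong n (?g' K J) (?g K J)" for K J
    by (rule fcong_morphism[OF \<gamma>'vector_field \<gamma>(1) \<gamma>'\<gamma>])
  have delta110: "fcong (Suc n) (?g' (1, 1, 0) J - ?g (1, 1, 0) J) (shift (0, 1, 0) (\<beta> 1) J + shift (1, 0, 0) (\<beta> 2) J)"
    if J: "J \<in> MI" for J
  proof -
    have J1: "fst J \<le> 1" using J by (auto simp: MI_def)
    have series_eval: "evec 1 = (1, 0, 0)" "evec 2 = (0, 1, 0)" by (simp_all add: evec_def)
    have g110: "morphism \<alpha> (1, 1, 0) J = rprod 0 (\<alpha> 1) (\<alpha> 2) J" if "vector_field 0 \<alpha>" for \<alpha>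
    proof -
      have "morphism \<alpha> (1, 1, 0) J = product_row (morphism \<alpha>) (evec 1) (evec 2) J" by (simp add: product_row_def series_eval MI_iff)
      also have "\<dots> = rprod 0 (morphism \<alpha> (evec 1)) (morphism \<alpha> (evec 2)) J"
        using multiplicative_morphism[OF that] J evec_MI[of 1] evec_MI[of 2] by (simp add: multiplicative_def par_evec)
      finally show ?thesis by (simp add: morphism_evec[OF vector_field_MIfield[OF that]])
    qed
    have r: "\<gamma>' j = (\<lambda>J. \<gamma> j J + \<beta> j J)" for j by (rule ext) (simp add: \<gamma>'_def)
    have 1: "?g' (1, 1, 0) J - ?g (1, 1, 0) J = rprod 0 (\<beta> 1) (\<gamma>' 2) J + rprod 0 (\<gamma> 1) (\<beta> 2) J"
      unfolding g110[OF \<gamma>'vector_field] g110[OF \<gamma>(1)]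
      unfolding r[of 1] rprod_add_left
      unfolding r[of 2] rprod_add_right by (simp add: algebra_simps)
    have 2: "rprod 0 (\<beta> 1) (rind (evec 2)) J + rprod 0 (rind (evec 1)) (\<beta> 2) J =
        shift (0, 1, 0) (\<beta> 1) J + shift (1, 0, 0) (\<beta> 2) J"
      by (simp add: rprod_rind_left[OF J1] rprod_rind_right[OF J1] series_eval)
    show ?thesis
      unfolding 1 2[symmetric]
    proof (rule fcong_add)
      show "fcong (Suc n) (rprod 0 (\<beta> 1) (\<gamma>' 2) J) (rprod 0 (\<beta> 1) (rind (evec 2)) J)"
        by (rule rprod_small_left[OF \<beta>f]) (rule nearD[OF \<gamma>'n], simp)
      show "fcong (Suc n) (rprod 0 (\<gamma> 1) (\<beta> 2) J) (rprod 0 (rind (evec 1)) (\<beta> 2) J)"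
        by (rule rprod_small_right[OF \<beta>f]) (rule nearD[OF \<gamma>(2)], simp)
    qed
  qed
  define X where "X j J = (if j = 2 then shift (0, 1, 0) (\<beta> 1) J + shift (1, 0, 0) (\<beta> 2) J else 0)" for j :: nat and J
  have step: "fcong (Suc n) (err \<gamma>' u' (evec j) J) (E j J + \<nu> j J + X j J - act (\<beta> j) ?N0 J)"
    if j: "j \<in> {1, 2, 3}" and J: "J \<in> MI" for j J
  proof -
    have r: "\<gamma>' j = (\<lambda>J. \<gamma> j J + \<beta> j J)" by (rule ext) (simp add: \<gamma>'_def)
    have nu: "nf u' j = (\<lambda>J. nf u j J + \<nu> j J)" by (rule ext) (simp add: \<nu>_def)
    have 1: "err \<gamma>' u' (evec j) J - E j J =
        act (\<nu> j) ?g' J + act (nf u j) (\<lambda>K J. ?g' K J - ?g K J) J - act (\<beta> j) Q J"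
      unfolding E_def err_act[OF \<gamma>'vector_field] err_act[OF \<gamma>(1)] NF_evec[OF j]
        morphism_evec[OF vector_field_MIfield[OF \<gamma>'vector_field] j] morphism_evec[OF vector_field_MIfield[OF \<gamma>(1)] j]
      unfolding r nu act_add_left act_diff_right by (simp add: algebra_simps)
    have voff: "\<forall>M. M \<notin> MI \<longrightarrow> \<nu> j M = 0"
      by (simp add: \<nu>_def moffD[OF MIfield_nf])
    have a: "fcong (Suc n) (act (\<nu> j) ?g' J) (\<nu> j J)"
    proof -
      have "fcong (Suc n) (act (\<nu> j) ?g' J) (act (\<nu> j) oid J)"
        by (rule act_small_left[OF \<nu>f near_morphism[OF \<gamma>'vector_field \<gamma>'n]])
      then show ?thesis by (simp add: act_oid_fun[OF voff])
    qed
    have b: "fcong (Suc n) (act (nf u j) (\<lambda>K J. ?g' K J - ?g K J) J) (X j J)"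
    proof -
      have "fcong (Suc n) (act (nf u j) (\<lambda>K J. ?g' K J - ?g K J) J)
          (act (nf (\<lambda>_. 0) j) (\<lambda>K J. ?g' K J - ?g K J) J)"
        by (rule act_small_right[OF _ fcong_nf])
          (use g'g u(2) in \<open>simp_all add: fcong_def small_def\<close>)
      also have "fcong (Suc n) (act (nf (\<lambda>_. 0) j) (\<lambda>K J. ?g' K J - ?g K J) J) (X j J)"
      proof (cases "j = 2")
        case True
        have "act (nf (\<lambda>_. 0) 2) (\<lambda>K J. ?g' K J - ?g K J) J = ?g' (1, 1, 0) J - ?g (1, 1, 0) J"
          by (simp add: nf_zero_2 act_diff_right act_rind lower_morphism \<gamma> \<gamma>'vector_field)
        then show ?thesis using delta110[OF J] True by (simp add: X_def)
      next
        case False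
        then show ?thesis using j by (simp add: nf_zero_13 act_def X_def)
      qed
      finally show ?thesis .
    qed
    have c: "fcong (Suc n) (act (\<beta> j) Q J) (act (\<beta> j) ?N0 J)"
      by (rule act_small_left[OF \<beta>f Q0])
    have "fcong (Suc n) (E j J + (err \<gamma>' u' (evec j) J - E j J))
        (E j J + (\<nu> j J + X j J - act (\<beta> j) ?N0 J))"
      unfolding 1 by (intro fcong_add fcong_diff a b c fcong_refl)
    then show ?thesis by (simp add: algebra_simps)
  qed
  have b0: "\<beta> j (0, 0, 0) = 0" for j by (simp add: \<beta>_def MI_iff)
  have bN0: "act (\<beta> j) ?N0 (0, b, c) = 0" if "(0, b, c) \<in> MI" for j b c
    by (subst act_NF_zero) (use that in \<open>simp_all add: b0\<close>)
  have bN1: "act (\<beta> j) ?N0 (1, b, c) = \<beta> j (0, b, c) * of_nat b" for j b c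
    by (subst act_NF_zero) (simp_all add: b0 MI_iff)
  have \<beta>e: "\<beta> 1 (a, b, c) = (if (a, b, c) \<in> MI then - E 2 (a, Suc b, c) else 0)"
    "\<beta> 2 (a, b, c) = (if (a, b, c) \<in> MI \<and> a = 0 \<and> b = 0 then - E 2 (1, 0, c) else 0)" for a b c
    by (auto simp: \<beta>_def)
  have E21: "E 2 (0, Suc 0, 0) = E 2 (0, 1, 0)" by (simp add: One_nat_def)
  have fin: "E j J + \<nu> j J + X j J - act (\<beta> j) ?N0 J \<in> filt A (Suc n)"
    if j: "j \<in> {1, 2, 3}" and J: "J \<in> MI" for j J
  proof -
    consider c where "J = (0, 0, c)" | b c where "J = (0, Suc b, c)" | c where "J = (1, 0, c)" | b c where "J = (1, Suc b, c)"
      using J by (metis MI_cases not0_implies_Suc)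
    then show ?thesis
    proof cases
      case (1 c)
      then have c: "c > 0" using J by (simp add: MI_iff)
      consider "j = 1" | "j = 2" | "j = 3" using j by auto
      then show ?thesis
        by cases (use J coc(1)[of 0 c] coc(2)[of c] c in
          \<open>auto simp: 1 bN0 X_def \<nu>_def shift_eq u'_def algebra_simps\<close>)
    next
      case (2 b c)
      consider "j = 1" | "j = 2" | "j = 3" using j by auto
      then show ?thesis
        by cases (use J coc(1)[of "Suc b" c] coc(4)[of b c] in
          \<open>auto simp: 2 bN0 X_def \<nu>_def shift_eq u'_def \<beta>e E21 MI_iff algebra_simps\<close>)
    next
      case (3 c)
      consider "j = 1" | "j = 2" | "j = 3" using j by auto
      then show ?thesis
        by cases (use J coc(3)[of 0 c] in
          \<open>auto simp: 3 bN1 X_def \<nu>_def shift_eq u'_def \<beta>e E21 MI_iff algebra_simps\<close>)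
    next
      case (4 b c)
      consider "j = 1" | "j = 2" | "j = 3" using j by auto
      then show ?thesis
      proof cases
        case 1
        have "\<beta> 1 (0, Suc b, c) = - E 2 (0, Suc (Suc b), c)" by (simp add: \<beta>_def MI_iff)
        then have "act (\<beta> 1) ?N0 (1, Suc b, c) = - (of_nat (Suc b) * E 2 (0, Suc (Suc b), c))"
          by (simp only: bN1 mult_minus_left mult_of_nat_commute)
        then show ?thesis using coc(3)[of "Suc b" c] by (simp add: 1 4 X_def \<nu>_def)
      next
        case 2
        then show ?thesis by (simp add: 4 bN1 X_def \<nu>_def shift_eq \<beta>e MI_iff)
      next
        case 3
        have "\<beta> 3 (0, Suc b, c) = scale A (1 / of_nat (Suc b)) (E 3 (1, Suc b, c))" by (simp add: \<beta>_def MI_iff)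
        then have "act (\<beta> 3) ?N0 (1, Suc b, c) = of_nat (Suc b) * scale A (1 / of_nat (Suc b)) (E 3 (1, Suc b, c))"
          by (simp only: bN1 mult_of_nat_commute)
        also have "\<dots> = E 3 (1, Suc b, c)" unfolding of_nat_scale by (simp del: of_nat_Suc)
        finally show ?thesis by (simp add: 3 4 X_def \<nu>_def)
      qed
    qed
  qed
  have "good (Suc n) (\<gamma>', u')"
  proof -
    have "err \<gamma>' u' (evec j) J \<in> filt A (Suc n)" if j: "j \<in> {1, 2, 3}" for j J
    proof (cases "J \<in> MI")
      case True
      show ?thesis using fcong_filt[OF step[OF j True] fin[OF j True]] .
    qed (simp add: lower_outside[OF lower_err[OF \<gamma>'vector_field]])
    then show ?thesis using \<gamma>'vector_field \<gamma>'n u'p u's by (simp add: good_def)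
  qed
  then show ?thesis using \<gamma>'\<gamma> u'u by (intro exI[of _ "(\<gamma>', u')"]) simp
qed

lemma good_1: "good 1 (\<lambda>j. if j \<in> {1, 2, 3} then rind (evec j) else (\<lambda>_. 0), \<lambda>_. 0)"
proof -
  let ?\<gamma> = "\<lambda>j. if j \<in> {1, 2, 3} then rind (evec j) else (\<lambda>_. 0 :: 'a)"
  have vector_field: "vector_field 0 ?\<gamma>"
    unfolding vector_field_def
  proof (intro conjI allI)
    show "MIfield ?\<gamma>" using evec_MI by (auto simp: MIfield_def rind_def)
    fix j J
    have "1 \<in> hpart A (par (evec j) + par (evec j))"
      using one_even hpart_cong[of 0 "par (evec j) + par (evec j)" A] by simp
    then show "?\<gamma> j J \<in> hpart A (0 + par (evec j) + par J)" by (auto simp: rind_def)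
  qed
  have near: "near ?\<gamma>" by (simp add: near_def)
  have "err ?\<gamma> (\<lambda>_. 0) K J \<in> filt A 1" for K J
  proof -
    have 1: "fcong 1 (act (NF (\<lambda>_. 0) K) (morphism ?\<gamma>) J) (act (NF (\<lambda>_. 0) K) oid J)"
      by (intro fcong_act fcong_refl near_morphism vector_field near)
    have 2: "fcong 1 (act (morphism ?\<gamma> K) Q J) (act (oid K) (NF (\<lambda>_. 0)) J)"
      by (intro fcong_act Q0 near_morphism vector_field near)
    have 3: "act (NF (\<lambda>_. 0 :: 'a) K) oid J = NF (\<lambda>_. 0) K J"
      using fun_cong[OF fun_cong[OF ocomp_oid_right[OF lower_NF]]] by (simp add: ocomp_act lower_oid)
    have 4: "act (oid K) (NF (\<lambda>_. 0 :: 'a)) J = NF (\<lambda>_. 0) K J"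
      using fun_cong[OF fun_cong[OF ocomp_oid_left[OF lower_NF]]] by (simp add: ocomp_act lower_NF)
    have "fcong 1 (err ?\<gamma> (\<lambda>_. 0) K J) (NF (\<lambda>_. 0) K J - NF (\<lambda>_. 0) K J)"
      unfolding err_act[OF vector_field] using fcong_diff[OF 1 2] unfolding 3 4 .
    then show ?thesis by (simp add: fcong_zero)
  qed
  then show ?thesis using vector_field near params_zero by (simp add: good_def small_def)
qed

lemma normal_form:
  obtains \<gamma> u where "vector_field 0 \<gamma>" "near \<gamma>" "params u" "small u" "ocomp (NF u) (morphism \<gamma>) = ocomp (morphism \<gamma>) Q"
proof -
  define close where "close n s s' \<longleftrightarrow> (\<forall>j\<in>{1, 2, 3}. \<forall>J. fcong n (fst s' j J) (fst s j J)) \<and>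
    (\<forall>x. fcong n (snd s' x) (snd s x))" for n and s s' :: "(nat \<Rightarrow> mi \<Rightarrow> 'a) \<times> (param \<Rightarrow> 'a)"
  have "\<exists>S. \<forall>n. good (Suc n) (S n) \<and> close (Suc n) (S n) (S (Suc n))"
  proof (rule dependent_nat_choice)
    show "\<exists>s. good (Suc 0) s" using good_1 unfolding One_nat_def by blast
    show "\<exists>s'. good (Suc (Suc n)) s' \<and> close (Suc n) s s'" if "good (Suc n) s" for s n
      using improve[of "Suc n" "fst s" "snd s"] that by (simp add: close_def)
  qed
  then obtain S where S: "\<And>n. good (Suc n) (S n)" "\<And>n. close (Suc n) (S n) (S (Suc n))" by blast
  have c\<gamma>: "fcong n (fst (S (Suc n)) j J) (fst (S n) j J)" if "j \<in> {1, 2, 3}" for n j J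
    using S(2)[of n] that fcong_mono[of "Suc n" _ _ n] by (auto simp: close_def)
  have cu: "fcong n (snd (S (Suc n)) x) (snd (S n) x)" for n x
    using S(2)[of n] fcong_mono[of "Suc n" _ _ n] by (auto simp: close_def)
  have "\<exists>l. \<forall>n. fcong n l (snd (S n) x)" for x by (rule limit_exists[of "\<lambda>n. snd (S n) x", OF cu]) blast
  then obtain u where u: "\<And>n x. fcong n (u x) (snd (S n) x)" by metis
  have "\<exists>l. j \<in> {1, 2, 3} \<longrightarrow> (\<forall>n. fcong n l (fst (S n) j J))" for j J
  proof (cases "j \<in> {1, 2, 3}")
    case True
    show ?thesis by (rule limit_exists[of "\<lambda>n. fst (S n) j J", OF c\<gamma>[OF True]]) blast
  qed blast
  then obtain \<gamma>0 where \<gamma>0: "\<And>n j J. j \<in> {1, 2, 3} \<Longrightarrow> fcong n (\<gamma>0 j J) (fst (S n) j J)" by metis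
  define \<gamma> where "\<gamma> j = (if j \<in> {1, 2, 3} then \<gamma>0 j else (\<lambda>_. 0))" for j
  have \<gamma>: "fcong n (\<gamma> j J) (fst (S n) j J)" if "j \<in> {1, 2, 3}" for n j J
    using \<gamma>0[OF that] that by (simp add: \<gamma>_def)
  have Sp: "vector_field 0 (fst (S n))" "near (fst (S n))" "params (snd (S n))" "small (snd (S n))" for n
    using S(1)[of n] by (auto simp: good_def)
  have vector_field\<gamma>: "vector_field 0 \<gamma>"
    unfolding vector_field_def
  proof (intro conjI allI)
    show "MIfield \<gamma>" unfolding MIfield_def
    proof (intro allI impI)
      fix j J assume J: "J \<notin> MI"
      show "\<gamma> j J = 0"
      proof (cases "j \<in> {1, 2, 3}")
        case True
        show ?thesis
        proof (rule fcong_all)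
          fix n show "fcong n (\<gamma> j J) 0"
            using \<gamma>[OF True, of n J] moffD[OF vector_field_MIfield[OF Sp(1)] J, of n j] by simp
        qed
      qed (auto simp: \<gamma>_def)
    qed
    fix j J
    show "\<gamma> j J \<in> hpart A (0 + par (evec j) + par J)"
    proof (cases "j \<in> {1, 2, 3}")
      case True
      show ?thesis
        by (rule hpart_closed[of _ "\<lambda>n. fst (S n) j J"])
          (use \<gamma>[OF True] vector_field_hpart[OF Sp(1)] in \<open>auto simp: fcong_def\<close>)
    qed (auto simp: \<gamma>_def)
  qed
  have near: "near \<gamma>"
    unfolding near_def using Sp(2)[of 1] \<gamma>[of _ 1] by (meson fcong_trans near_def)
  have pu: "params u"
    unfolding params_def
  proof
    fix x show "u x \<in> hpart A (ppar x)"
      by (rule hpart_closed[of _ "\<lambda>n. snd (S n) x"]) (use u Sp(3) in \<open>auto simp: fcong_def params_def\<close>)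
  qed
  have su: "small u"
    using fcong_filt[OF u[of 1]] Sp(4)[of 1] by (simp add: small_def)
  have "err \<gamma> u (evec j) J \<in> filt A n" if j: "j \<in> {1, 2, 3}" for j J n
  proof -
    have "fcong n (err \<gamma> u (evec j) J) (err (fst (S n)) (snd (S n)) (evec j) J)"
      unfolding err_act[OF vector_field\<gamma>] err_act[OF Sp(1)]
      by (intro fcong_diff fcong_act fcong_NF fcong_morphism u vector_field\<gamma> Sp \<gamma> fcong_refl)
    moreover have "err (fst (S n)) (snd (S n)) (evec j) J \<in> filt A n"
      using S(1)[of n] j filt_mono[of n "Suc n"] by (auto simp: good_def)
    ultimately show ?thesis by (rule fcong_filt)
  qed
  then have "err \<gamma> u K J \<in> filt A n" for K J n by (rule err_filt[OF vector_field\<gamma> pu])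
  then have "err \<gamma> u K J = 0" for K J by (rule filt_Inter)
  then have "ocomp (NF u) (morphism \<gamma>) = ocomp (morphism \<gamma>) Q"
    by (intro ext) (simp add: err_def)
  then show ?thesis using that vector_field\<gamma> near pu su by blast
qed

end

section \<open>The base of the deformation is a formal base\<close>

lift_definition fword :: "param list \<Rightarrow> fser" is "\<lambda>w v. if v = w then 1 else 0"
  subgoal for w n by (rule finite_subset[of _ "{w}"]) auto
  done

lift_definition ftrunc :: "nat \<Rightarrow> fser \<Rightarrow> fser" is "\<lambda>n f w. if length w < n then f w else 0"
  subgoal for n f m by (rule finite_subset[of _ "{w. length w = m \<and> f w \<noteq> 0}"]) auto
  done

lift_definition fpar :: "fser \<Rightarrow> fser" is "\<lambda>f w. (-1) ^ sum_list (map ppar w) * f w"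
  subgoal for f m by simp
  done

lemma fser_eqI: "(\<And>w. fcoeff f w = fcoeff g w) \<Longrightarrow> f = g"
  by (metis fcoeff_inject ext)

lemmas fcoeff_simps [simp] = plus_fser.rep_eq minus_fser.rep_eq uminus_fser.rep_eq zero_fser.rep_eq
  one_fser.rep_eq fscale.rep_eq fword.rep_eq ftrunc.rep_eq fpar.rep_eq

lemma fcoeff_sum: "fcoeff (sum f S) w = (\<Sum>i\<in>S. fcoeff (f i) w)"
  by (induction S rule: infinite_finite_induct) simp_all

lemma fvar_fword: "fvar x = fword [x]"
  by (rule fser_eqI) (simp add: fvar.rep_eq)

lemma fword_Nil: "fword [] = 1"
  by (rule fser_eqI) simp

lemma fword_mult: "fword u * fword v = fword (u @ v)"
proof (rule fser_eqI)
  fix w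
  have "fcoeff (fword u * fword v) w = (\<Sum>p\<in>wsplits w. if p = (u, v) then 1 else 0)"
    unfolding fcoeff_mult by (rule sum.cong) (auto simp: split_def)
  also have "\<dots> = fcoeff (fword (u @ v)) w"
    by (simp add: sum.delta) (auto simp: wsplits_def)
  finally show "fcoeff (fword u * fword v) w = fcoeff (fword (u @ v)) w" .
qed

lemma fscale_mult_left: "fscale c (f * g) = fscale c f * g"
  by (rule fser_eqI) (simp add: fcoeff_mult sum_distrib_left split_def mult.assoc)

lemma fscale_mult_right: "fscale c (f * g) = f * fscale c g"
  by (rule fser_eqI) (simp add: fcoeff_mult sum_distrib_left split_def mult.left_commute)

lemma vector_space_fscale: "vector_space fscale"
  by unfold_locales (auto intro!: fser_eqI simp: algebra_simps)

interpretation fs: vector_space fscale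
  by (rule vector_space_fscale)

lemma fscale_sgn: "(-1) ^ n * f = fscale ((-1) ^ n) f"
  by (simp add: minus_one_power_iff)

lemma fscale_ford: "f \<in> ford n \<Longrightarrow> fscale c f \<in> ford n"
  by (simp add: ford_def)

lemma ford_zero: "0 \<in> ford n"
  by (simp add: ford_def)

lemma ford_diff: "f \<in> ford n \<Longrightarrow> g \<in> ford n \<Longrightarrow> f - g \<in> ford n"
  by (simp add: ford_def)

lemma ford_0: "ford 0 = UNIV"
  by (simp add: ford_def)

lemma ford_mono: "m \<le> n \<Longrightarrow> ford n \<subseteq> ford m"
  by (auto simp: ford_def)

lemma ford_mult: "f \<in> ford m \<Longrightarrow> g \<in> ford n \<Longrightarrow> f * g \<in> ford (m + n)"
  unfolding ford_def mem_Collect_eq fcoeff_mult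
proof (intro allI impI sum.neutral ballI)
  fix w :: "param list" and p :: "param list \<times> param list"
  assume f: "\<forall>w. length w < m \<longrightarrow> fcoeff f w = 0" and g: "\<forall>w. length w < n \<longrightarrow> fcoeff g w = 0"
    and w: "length w < m + n" and p: "p \<in> wsplits w"
  have "length (fst p) < m \<or> length (snd p) < n" using w p by (auto simp: wsplits_def)
  then show "(case p of (u, v) \<Rightarrow> fcoeff f u * fcoeff g v) = 0" using f g by (auto simp: split_def)
qed

lemma fword_ford: "n \<le> length w \<Longrightarrow> fword w \<in> ford n"
  by (auto simp: ford_def)

definition fsupp :: "nat \<Rightarrow> fser \<Rightarrow> param list set" where
  "fsupp n f = {w. length w < n \<and> fcoeff f w \<noteq> 0}"

lemma finite_fsupp [simp]: "finite (fsupp n f)"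
proof -
  have "fsupp n f = (\<Union>i<n. {w. length w = i \<and> fcoeff f w \<noteq> 0})" by (auto simp: fsupp_def)
  moreover have "finite {w. length w = i \<and> fcoeff f w \<noteq> 0}" for i
    using fcoeff[of f] by blast
  ultimately show ?thesis by simp
qed

lemma ftrunc_sum: "ftrunc n f = (\<Sum>w\<in>fsupp n f. fscale (fcoeff f w) (fword w))"
proof (rule fser_eqI)
  fix v
  have "fcoeff (\<Sum>w\<in>fsupp n f. fscale (fcoeff f w) (fword w)) v =
      (\<Sum>w\<in>fsupp n f. if w = v then fcoeff f v else 0)"
    unfolding fcoeff_sum by (rule sum.cong) auto
  also have "\<dots> = fcoeff (ftrunc n f) v" by simp (auto simp: fsupp_def)
  finally show "fcoeff (ftrunc n f) v = fcoeff (\<Sum>w\<in>fsupp n f. fscale (fcoeff f w) (fword w)) v" ..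
qed

lemma ftrunc_ford: "f - ftrunc n f \<in> ford n"
  by (simp add: ford_def)

lemma fpar_mult: "fpar (f * g) = fpar f * fpar g"
proof (rule fser_eqI)
  fix w
  show "fcoeff (fpar (f * g)) w = fcoeff (fpar f * fpar g) w"
    unfolding fcoeff_mult fpar.rep_eq sum_distrib_left
    by (rule sum.cong) (auto simp: wsplits_def power_add)
qed

lemma fpar_add: "fpar (f + g) = fpar f + fpar g"
  by (rule fser_eqI) (simp add: algebra_simps)

lemma fpar_diff: "fpar (f - g) = fpar f - fpar g"
  by (rule fser_eqI) (simp add: algebra_simps)

lemma fpar_zero: "fpar 0 = 0"
  by (rule fser_eqI) simp

lemma fpar_ford: "f \<in> ford n \<Longrightarrow> fpar f \<in> ford n"
  by (simp add: ford_def)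

lemma fhpart_iff: "f \<in> fhpart p \<longleftrightarrow> fpar f = fscale ((-1) ^ p) f"
proof
  assume f: "f \<in> fhpart p"
  show "fpar f = fscale ((-1) ^ p) f"
  proof (rule fser_eqI)
    fix w show "fcoeff (fpar f) w = fcoeff (fscale ((-1) ^ p) f) w"
      using f by (cases "even (sum_list (map ppar w) + p)") (auto simp: fhpart_def intro: sgn_cong)
  qed
next
  assume f: "fpar f = fscale ((-1) ^ p) f"
  show "f \<in> fhpart p"
    unfolding fhpart_def
  proof (intro CollectI allI impI)
    fix w assume w: "odd (sum_list (map ppar w) + p)"
    have "(-1) ^ sum_list (map ppar w) * fcoeff f w = (-1) ^ p * fcoeff f w"
      using arg_cong[OF f, of "\<lambda>g. fcoeff g w"] by simp
    then show "fcoeff f w = 0" using w by (auto simp: minus_one_power_iff split: if_splits)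
  qed
qed

lemma fhpart_fword: "fword w \<in> fhpart (sum_list (map ppar w))"
  by (auto simp: fhpart_def)

lemma fhpart_fvar: "fvar x \<in> fhpart (ppar x)"
  using fhpart_fword[of "[x]"] by (simp add: fvar_fword)

lemma fhpart_cong: "even (p + q) \<Longrightarrow> fhpart p = fhpart q"
  by (auto simp: fhpart_def)

lemma fhpart_add: "f \<in> fhpart p \<Longrightarrow> g \<in> fhpart p \<Longrightarrow> f + g \<in> fhpart p"
  by (simp add: fhpart_def)

lemma fhpart_scale: "f \<in> fhpart p \<Longrightarrow> fscale c f \<in> fhpart p"
  by (simp add: fhpart_def)

lemma fhpart_mult: "f \<in> fhpart p \<Longrightarrow> g \<in> fhpart q \<Longrightarrow> f * g \<in> fhpart (p + q)"
  unfolding fhpart_iff fpar_mult power_add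
  by (simp flip: fscale_mult_left fscale_mult_right)

definition base_gen :: "fser set" where
  "base_gen = ideal_gen (graded_commutators \<union> base_relations)"

lemma base_gen_ideal: "base_gen \<subseteq> base_ideal"
  unfolding base_ideal_def closed_ideal_gen_def base_gen_def
  using ford_zero by (auto intro!: bexI)

lemma base_gen_closed: "(\<And>n. \<exists>g\<in>base_gen. f - g \<in> ford n) \<Longrightarrow> f \<in> base_ideal"
  unfolding base_ideal_def closed_ideal_gen_def base_gen_def by blast

lemma base_idealD: "f \<in> base_ideal \<Longrightarrow> \<exists>g\<in>base_gen. f - g \<in> ford n"
  unfolding base_ideal_def closed_ideal_gen_def base_gen_def by blast

lemma base_gen_scale: "f \<in> base_gen \<Longrightarrow> fscale c f \<in> base_gen"
  using ideal_gen_mult_left[of f _ "fscale c 1"] by (simp add: base_gen_def flip: fscale_mult_left)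

lemma base_gen_add: "f \<in> base_gen \<Longrightarrow> g \<in> base_gen \<Longrightarrow> f + g \<in> base_gen"
  by (simp add: base_gen_def ideal_gen.add)

lemma base_gen_zero: "0 \<in> base_gen"
  by (simp add: base_gen_def ideal_gen.zero)

lemma base_gen_sum: "(\<And>i. i \<in> S \<Longrightarrow> f i \<in> base_gen) \<Longrightarrow> sum f S \<in> base_gen"
  by (induction S rule: infinite_finite_induct) (auto intro: base_gen_add base_gen_zero)

lemma base_gen_mult_left: "f \<in> base_gen \<Longrightarrow> h * f \<in> base_gen"
  by (simp add: base_gen_def ideal_gen_mult_left)

lemma base_gen_mult_right: "f \<in> base_gen \<Longrightarrow> f * h \<in> base_gen"
  by (simp add: base_gen_def ideal_gen_mult_right)

lemma base_gen_gen: "f \<in> graded_commutators \<union> base_relations \<Longrightarrow> f \<in> base_gen"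
  using ideal_gen.gen[of f _ 1 1] by (simp add: base_gen_def)

lemma fhpart_sum: "(\<And>i. i \<in> S \<Longrightarrow> f i \<in> fhpart p) \<Longrightarrow> sum f S \<in> fhpart p"
  by (induction S rule: infinite_finite_induct) (auto intro: fhpart_add simp: fhpart_def)

lemma of_int_fser: "of_int z * f = fscale (of_int z) f"
proof -
  have n: "of_nat n * f = fscale (of_nat n) f" for n
    by (induction n) (simp_all add: distrib_right fs.scale_left_distrib)
  show ?thesis by (cases z) (simp_all add: n fs.scale_minus_left distrib_right fs.scale_left_diff_distrib
    left_diff_distrib fs.scale_left_distrib)
qed

lemma generators_homogeneous:
  assumes "r \<in> graded_commutators \<union> base_relations" obtains p where "r \<in> fhpart p"
proof -
  have t: "ft k * ftheta l \<in> fhpart 1" "ftheta k * ftheta l \<in> fhpart 2" for k l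
    using fhpart_mult[OF fhpart_fvar fhpart_fvar, of "PT (k - 1)" "PTheta (l - 1)"]
      fhpart_mult[OF fhpart_fvar fhpart_fvar, of "PTheta (k - 1)" "PTheta (l - 1)"]
    by (simp_all add: ft_def ftheta_def numeral_2_eq_2 One_nat_def)
  have s: "fvar PS * fvar PEta \<in> fhpart 1"
    using fhpart_mult[OF fhpart_fvar fhpart_fvar, of PS PEta] by simp
  have c: "fvar x * fvar y - (-1) ^ (ppar x * ppar y) * (fvar y * fvar x) \<in> fhpart (ppar x + ppar y)" for x y
    using fhpart_add[OF fhpart_mult[OF fhpart_fvar fhpart_fvar, of x y] fhpart_scale[OF
        fhpart_mult[OF fhpart_fvar fhpart_fvar, of y x], of "- ((-1) ^ (ppar x * ppar y))",
        unfolded add.commute[of "ppar y"]]]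
    by (simp add: fscale_sgn fs.scale_minus_left)
  show ?thesis
    using assms that s c t
    unfolding graded_commutators_def base_relations_def Let_def of_int_fser
    by (auto intro!: fhpart_sum fhpart_scale) (metis (mono_tags, lifting) fhpart_scale fhpart_sum)+
qed

lemma fpar_base_gen: "f \<in> base_gen \<Longrightarrow> fpar f \<in> base_gen"
  unfolding base_gen_def
proof (induction rule: ideal_gen.induct)
  case (gen r a b)
  obtain p where "r \<in> fhpart p" using generators_homogeneous[OF gen] .
  then have "fpar (a * r * b) = fscale ((-1) ^ p) (fpar a * r * fpar b)"
    by (simp add: fpar_mult fhpart_iff flip: fscale_mult_left fscale_mult_right)
  then show ?case
    using base_gen_scale[unfolded base_gen_def, OF ideal_gen.gen[OF gen]] by simp
qed (simp_all add: fpar_zero fpar_add ideal_gen.zero ideal_gen.add)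

lemma fpar_base_ideal: "f \<in> base_ideal \<Longrightarrow> fpar f \<in> base_ideal"
  by (rule base_gen_closed) (metis base_idealD fpar_base_gen fpar_diff fpar_ford)

lemma base_ideal_scale: "f \<in> base_ideal \<Longrightarrow> fscale c f \<in> base_ideal"
  using base_ideal_mult_left[of f "fscale c 1"] by (simp flip: fscale_mult_left)

lemma even_component_in_ideal:
  assumes "f \<in> fhpart 0" "g \<in> fhpart 1" "f + g \<in> base_ideal"
  shows "f \<in> base_ideal"
proof -
  have "fscale (1 / 2) ((f + g) + fpar (f + g)) = f"
    using assms(1,2) by (intro fser_eqI) (simp add: fhpart_iff fpar_add fs.scale_minus_left)
  then show ?thesis
    using base_ideal_scale[OF base_ideal_add[OF assms(3) fpar_base_ideal[OF assms(3)]]] by metis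
qed

lemma fword_Cons: "fword (x # w) = fvar x * fword w"
  by (simp add: fvar_fword fword_mult)

lemma fvar_fword_commute:
  "fvar x * fword v - fscale ((-1) ^ (ppar x * sum_list (map ppar v))) (fword v * fvar x) \<in> base_gen"
proof (induction v)
  case Nil
  then show ?case by (simp add: fword_Nil base_gen_zero)
next
  case (Cons y v)
  let ?s = "(-1) ^ (ppar x * ppar y) :: complex" and ?t = "(-1) ^ (ppar x * sum_list (map ppar v)) :: complex"
  have c: "fvar x * fvar y - fscale ?s (fvar y * fvar x) \<in> base_gen"
    by (rule base_gen_gen) (auto simp: graded_commutators_def fscale_sgn)
  have "fvar x * fword (y # v) - fscale ((-1) ^ (ppar x * sum_list (map ppar (y # v)))) (fword (y # v) * fvar x) =
    (fvar x * fvar y - fscale ?s (fvar y * fvar x)) * fword v +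
    fscale ?s (fvar y * (fvar x * fword v - fscale ?t (fword v * fvar x)))"
    by (simp add: fword_Cons distrib_left power_add algebra_simps fs.scale_right_diff_distrib
        flip: fscale_mult_left fscale_mult_right)
  then show ?case
    using base_gen_add[OF base_gen_mult_right[OF c] base_gen_scale[OF base_gen_mult_left[OF Cons]]] by simp
qed

lemma fword_fword_commute:
  "fword u * fword v - fscale ((-1) ^ (sum_list (map ppar u) * sum_list (map ppar v))) (fword v * fword u)
    \<in> base_gen"
proof (induction u)
  case Nil
  then show ?case by (simp add: fword_Nil base_gen_zero)
next
  case (Cons x u)
  let ?s = "(-1) ^ (ppar x * sum_list (map ppar v)) :: complex"
  let ?t = "(-1) ^ (sum_list (map ppar u) * sum_list (map ppar v)) :: complex"
  have "fword (x # u) * fword v -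
      fscale ((-1) ^ (sum_list (map ppar (x # u)) * sum_list (map ppar v))) (fword v * fword (x # u)) =
    fvar x * (fword u * fword v - fscale ?t (fword v * fword u)) +
    fscale ?t ((fvar x * fword v - fscale ?s (fword v * fvar x)) * fword u)"
    by (simp add: fword_Cons distrib_right power_add algebra_simps fs.scale_right_diff_distrib
        flip: fscale_mult_left fscale_mult_right)
  then show ?case
    using base_gen_add[OF base_gen_mult_left[OF Cons]
        base_gen_scale[OF base_gen_mult_right[OF fvar_fword_commute]]] by simp
qed

lemma fser_supercommute:
  assumes f: "f \<in> fhpart p" and g: "g \<in> fhpart q"
  shows "f * g - fscale ((-1) ^ (p * q)) (g * f) \<in> base_ideal"
proof (rule base_gen_closed)
  fix n
  let ?s = "(-1) ^ (p * q) :: complex"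
  let ?f = "ftrunc n f" and ?g = "ftrunc n g"
  have "?f * ?g - fscale ?s (?g * ?f) = (\<Sum>u\<in>fsupp n f. \<Sum>v\<in>fsupp n g.
      fscale (fcoeff f u * fcoeff g v) (fword u * fword v - fscale ?s (fword v * fword u)))"
  proof -
    have "?f * ?g = (\<Sum>u\<in>fsupp n f. \<Sum>v\<in>fsupp n g. fscale (fcoeff f u * fcoeff g v) (fword u * fword v))"
      by (simp add: ftrunc_sum sum_product flip: fscale_mult_left fscale_mult_right) (simp add: mult.commute)
    moreover have "?g * ?f = (\<Sum>u\<in>fsupp n f. \<Sum>v\<in>fsupp n g. fscale (fcoeff f u * fcoeff g v) (fword v * fword u))"
      by (simp add: ftrunc_sum sum_product flip: fscale_mult_left fscale_mult_right)
         (subst sum.swap, simp)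
    ultimately show ?thesis
      by (simp add: sum_subtractf fs.scale_right_diff_distrib fs.scale_sum_right mult.commute)
  qed
  also have "\<dots> \<in> base_gen"
  proof (intro base_gen_sum base_gen_scale)
    fix u v assume uv: "u \<in> fsupp n f" "v \<in> fsupp n g"
    have "even (sum_list (map ppar u) + p)" "even (sum_list (map ppar v) + q)"
      using uv f g by (auto simp: fhpart_def fsupp_def)
    then have "?s = (-1) ^ (sum_list (map ppar u) * sum_list (map ppar v))"
      by (intro sgn_cong) auto
    then show "fword u * fword v - fscale ?s (fword v * fword u) \<in> base_gen"
      using fword_fword_commute by metis
  qed
  finally have 1: "?f * ?g - fscale ?s (?g * ?f) \<in> base_gen" .
  have "f * g - ?f * ?g \<in> ford n"
  proof -
    have "f * g - ?f * ?g = (f - ?f) * g + ?f * (g - ?g)" by (simp add: algebra_simps)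
    then show ?thesis using ford_add[OF ford_mult_right ford_mult_left] ftrunc_ford by metis
  qed
  moreover have "g * f - ?g * ?f \<in> ford n"
  proof -
    have "g * f - ?g * ?f = (g - ?g) * f + ?g * (f - ?f)" by (simp add: algebra_simps)
    then show ?thesis using ford_add[OF ford_mult_right ford_mult_left] ftrunc_ford by metis
  qed
  ultimately have "(f * g - ?f * ?g) - fscale ?s (g * f - ?g * ?f) \<in> ford n"
    by (rule ford_diff[OF _ fscale_ford])
  then have "(f * g - fscale ?s (g * f)) - (?f * ?g - fscale ?s (?g * ?f)) \<in> ford n"
    by (simp add: fs.scale_right_diff_distrib algebra_simps)
  with 1 show "\<exists>h\<in>base_gen. (f * g - fscale ?s (g * f)) - h \<in> ford n" by blast
qed

lemma abs_base_eq_iff: "abs_base f = abs_base g \<longleftrightarrow> f - g \<in> base_ideal"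
  by (rule base.abs_eq_iff)

lemma abs_base_simps:
  "abs_base f + abs_base g = abs_base (f + g)" "abs_base f - abs_base g = abs_base (f - g)"
  "abs_base f * abs_base g = abs_base (f * g)" "bscale c (abs_base f) = abs_base (fscale c f)"
  "- abs_base f = abs_base (- f)" "1 = abs_base 1" "0 = abs_base 0" "baug (abs_base f) = fcoeff f []"
  by (simp_all add: plus_base.abs_eq minus_base.abs_eq times_base.abs_eq bscale.abs_eq uminus_base.abs_eq
      one_base.abs_eq zero_base.abs_eq baug.abs_eq)

lemma base_cases: obtains f where "x = abs_base f"
  using base.abs_induct[of "\<lambda>x. \<exists>f. x = abs_base f" x] by blast

lemma abs_base_sum: "abs_base (sum f S) = (\<Sum>i\<in>S. abs_base (f i))"
  by (induction S rule: infinite_finite_induct)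
     (simp_all add: zero_base.abs_eq flip: plus_base.abs_eq)

lemma versal_base_simps [simp]:
  "scale versal_base = bscale" "aug versal_base = baug" "filt versal_base n = abs_base ` ford n"
  by (simp_all add: versal_base_def)

lemma hpart_versal_base: "hpart versal_base p = abs_base ` fhpart p"
  using fhpart_cong[of p 0] fhpart_cong[of p 1] by (simp add: hpart_def versal_base_def)

lemma vector_space_bscale: "vector_space bscale"
proof
  fix a b :: complex and x y :: base
  obtain f where x: "x = abs_base f" by (rule base_cases)
  obtain g where y: "y = abs_base g" by (rule base_cases)
  show "bscale a (x + y) = bscale a x + bscale a y"
    by (simp add: x y abs_base_simps fs.scale_right_distrib)
  show "bscale (a + b) x = bscale a x + bscale b x"
    by (simp add: x abs_base_simps fs.scale_left_distrib)
  show "bscale a (bscale b x) = bscale (a * b) x" by (simp add: x abs_base_simps)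
  show "bscale 1 x = x" by (simp add: x abs_base_simps)
qed

interpretation bs: vector_space bscale
  by (rule vector_space_bscale)

lemma base_complete:
  assumes "\<And>n. s (Suc n) - s n \<in> abs_base ` ford n"
  shows "\<exists>l. \<forall>n. l - s n \<in> abs_base ` ford n"
proof -
  obtain f0 where f0: "s 0 = abs_base f0" by (rule base_cases)
  have "\<forall>n. \<exists>d. d \<in> ford n \<and> s (Suc n) - s n = abs_base d" using assms by blast
  then obtain d where d: "\<And>n. d n \<in> ford n" "\<And>n. s (Suc n) - s n = abs_base (d n)" by metis
  have s: "s n = abs_base (f0 + (\<Sum>i<n. d i))" for n
  proof (induction n)
    case (Suc n)
    have "s (Suc n) = s n + abs_base (d n)" using d(2)[of n] by (simp add: algebra_simps)
    then show ?case unfolding Suc abs_base_simps by (simp add: add.assoc)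
  qed (simp add: f0)
  define L where "L = Fser (\<lambda>w. fcoeff f0 w + (\<Sum>i\<le>length w. fcoeff (d i) w))"
  have fin: "finite {w. length w = n \<and> fcoeff f0 w + (\<Sum>i\<le>length w. fcoeff (d i) w) \<noteq> 0}" for n
  proof (rule finite_subset)
    show "{w. length w = n \<and> fcoeff f0 w + (\<Sum>i\<le>length w. fcoeff (d i) w) \<noteq> 0}
      \<subseteq> fsupp (Suc n) f0 \<union> (\<Union>i\<le>n. fsupp (Suc n) (d i))"
      by (auto simp: fsupp_def)
  qed auto
  have L: "fcoeff L w = fcoeff f0 w + (\<Sum>i\<le>length w. fcoeff (d i) w)" for w
    unfolding L_def by (subst Fser_inverse) (use fin in auto)
  have "L - (f0 + (\<Sum>i<n. d i)) \<in> ford n" for n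
    unfolding ford_def
  proof (intro CollectI allI impI)
    fix w :: "param list" assume w: "length w < n"
    have "(\<Sum>i<n. fcoeff (d i) w) = (\<Sum>i\<le>length w. fcoeff (d i) w)"
      by (rule sum.mono_neutral_right) (use w d(1) in \<open>auto simp: ford_def\<close>)
    then show "fcoeff (L - (f0 + (\<Sum>i<n. d i))) w = 0" by (simp add: L fcoeff_sum)
  qed
  then have "abs_base L - s n \<in> abs_base ` ford n" for n
    unfolding s abs_base_simps by blast
  then show ?thesis by blast
qed

lemma base_separated:
  assumes "\<And>n. x \<in> abs_base ` ford n" shows "x = 0"
proof -
  obtain f where x: "x = abs_base f" by (rule base_cases)
  have "f \<in> base_ideal"
  proof (rule base_gen_closed)
    fix n
    obtain g where g: "g \<in> ford n" "f - g \<in> base_ideal"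
      using assms[of n] by (auto simp: x abs_base_eq_iff)
    obtain h where h: "h \<in> base_gen" "f - g - h \<in> ford n" using base_idealD[OF g(2)] by blast
    have "f - h = (f - g - h) + g" by simp
    then have "f - h \<in> ford n" using ford_add[OF h(2) g(1)] by simp
    then show "\<exists>h\<in>base_gen. f - h \<in> ford n" using h(1) by blast
  qed
  then show ?thesis by (simp add: x abs_base_simps(7) abs_base_eq_iff)
qed

lemma base_filt_subspace: "bs.subspace (abs_base ` ford n)"
proof (rule bs.subspaceI)
  show "0 \<in> abs_base ` ford n" unfolding abs_base_simps(7) using ford_zero by blast
  show "x + y \<in> abs_base ` ford n" if "x \<in> abs_base ` ford n" "y \<in> abs_base ` ford n" for x y
    using that ford_add by (auto simp: abs_base_simps)
  show "bscale c x \<in> abs_base ` ford n" if "x \<in> abs_base ` ford n" for c x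
    using that fscale_ford by (auto simp: abs_base_simps)
qed

lemma base_unit:
  assumes "baug x \<noteq> 0" shows "\<exists>y. x * y = 1 \<and> y * x = 1"
proof -
  obtain f where x: "x = abs_base f" by (rule base_cases)
  let ?c = "fcoeff f []"
  have c: "?c \<noteq> 0" using assms by (simp add: x abs_base_simps)
  define h where "h = 1 - fscale (1 / ?c) f"
  define H where "H = abs_base h"
  have h1: "h \<in> ford 1" using c by (simp add: ford_def h_def)
  have hn: "h ^ n \<in> ford n" for n
  proof (induction n)
    case (Suc n)
    show ?case using ford_mult[OF h1 Suc] by (simp add: plus_1_eq_Suc)
  qed (simp add: ford_0)
  have Hn: "H ^ n = abs_base (h ^ n)" for n
    by (induction n) (simp_all add: H_def abs_base_simps flip: abs_base_simps(6))
  have Hf: "H ^ n \<in> abs_base ` ford n" for n unfolding Hn using hn by blast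
  define s where "s n = (\<Sum>i<n. H ^ i)" for n
  have "s (Suc n) - s n = H ^ n" for n by (simp add: s_def)
  then obtain l where l: "\<And>n. l - s n \<in> abs_base ` ford n"
    using base_complete[of s] Hf by metis
  have s1: "(1 - H) * s n = 1 - H ^ n" for n
  proof (induction n)
    case (Suc n)
    have "(1 - H) * s (Suc n) = (1 - H) * s n + (1 - H) * H ^ n" by (simp add: s_def distrib_left)
    also have "\<dots> = 1 - H ^ n + (1 - H) * H ^ n" by (simp only: Suc)
    finally show ?case by (simp add: left_diff_distrib)
  qed (simp add: s_def)
  have s2: "s n * (1 - H) = 1 - H ^ n" for n
  proof (induction n)
    case (Suc n)
    have "s (Suc n) * (1 - H) = s n * (1 - H) + H ^ n * (1 - H)" by (simp add: s_def distrib_right)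
    also have "\<dots> = 1 - H ^ n + H ^ n * (1 - H)" by (simp only: Suc)
    finally show ?case by (simp add: right_diff_distrib power_commutes)
  qed (simp add: s_def)
  have mult: "y * z \<in> abs_base ` ford n" "z * y \<in> abs_base ` ford n" if "z \<in> abs_base ` ford n" for y z n
  proof -
    obtain g where "y = abs_base g" by (rule base_cases)
    then show "y * z \<in> abs_base ` ford n" "z * y \<in> abs_base ` ford n"
      using that ford_mult_left ford_mult_right by (auto simp: abs_base_simps)
  qed
  have 1: "(1 - H) * l = 1"
  proof -
    have "(1 - H) * l - 1 \<in> abs_base ` ford n" for n
    proof -
      have "(1 - H) * l - 1 = (1 - H) * (l - s n) - H ^ n"
        using s1[of n] by (simp add: right_diff_distrib)
      then show ?thesis using bs.subspace_diff[OF base_filt_subspace mult(1)[OF l] Hf] by simp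
    qed
    then show ?thesis using base_separated[of "(1 - H) * l - 1"] by simp
  qed
  have 2: "l * (1 - H) = 1"
  proof -
    have "l * (1 - H) - 1 \<in> abs_base ` ford n" for n
    proof -
      have "l * (1 - H) - 1 = (l - s n) * (1 - H) - H ^ n"
        using s2[of n] by (simp add: left_diff_distrib)
      then show ?thesis using bs.subspace_diff[OF base_filt_subspace mult(2)[OF l] Hf] by simp
    qed
    then show ?thesis using base_separated[of "l * (1 - H) - 1"] by simp
  qed
  have H: "1 - H = bscale (1 / ?c) x"
    unfolding H_def h_def x abs_base_simps by simp
  have sc: "bscale r (y * z) = bscale r y * z" "bscale r (y * z) = y * bscale r z" for r y z
  proof -
    obtain g where y: "y = abs_base g" by (rule base_cases)
    obtain k where z: "z = abs_base k" by (rule base_cases)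
    show "bscale r (y * z) = bscale r y * z" by (simp add: y z abs_base_simps fscale_mult_left)
    show "bscale r (y * z) = y * bscale r z" by (simp add: y z abs_base_simps fscale_mult_right)
  qed
  have "x * bscale (1 / ?c) l = 1" "bscale (1 / ?c) l * x = 1"
    using 1 2 unfolding H by (simp_all flip: sc)
  then show ?thesis by blast
qed

lemma superalgebra_versal_base: "local_superalgebra versal_base"
proof (intro local_superalgebra.intro local_superalgebra_axioms.intro)
  show "vector_space (scale versal_base)" using vector_space_bscale by simp
  fix x y :: base and c p q
  obtain f where x: "x = abs_base f" by (rule base_cases)
  obtain g where y: "y = abs_base g" by (rule base_cases)
  show "scale versal_base c (x * y) = scale versal_base c x * y"
    by (simp add: x y abs_base_simps fscale_mult_left)
  show "scale versal_base c (x * y) = x * scale versal_base c y"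
    by (simp add: x y abs_base_simps fscale_mult_right)
  show "module.subspace (scale versal_base) (hpart versal_base p)"
    unfolding versal_base_simps hpart_versal_base
  proof (rule bs.subspaceI)
    show "0 \<in> abs_base ` fhpart p" unfolding abs_base_simps(7) by (auto simp: fhpart_def)
    show "u + v \<in> abs_base ` fhpart p" if "u \<in> abs_base ` fhpart p" "v \<in> abs_base ` fhpart p" for u v
      using that fhpart_add by (auto simp: abs_base_simps)
    show "bscale c u \<in> abs_base ` fhpart p" if "u \<in> abs_base ` fhpart p" for c u
      using that fhpart_scale by (auto simp: abs_base_simps)
  qed
  show "even_part versal_base \<inter> odd_part versal_base = {0}"
  proof -
    have "z = 0" if z: "z \<in> abs_base ` fhpart 0" "z \<in> abs_base ` fhpart 1" for z
    proof -
      obtain f g where f: "z = abs_base f" "f \<in> fhpart 0" and g: "z = abs_base g" "g \<in> fhpart 1"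
        using z by blast
      have "abs_base f = abs_base g" using f(1) g(1) by simp
      then have "f + fscale (-1) g \<in> base_ideal" by (simp add: abs_base_eq_iff)
      then have "f \<in> base_ideal" by (rule even_component_in_ideal[OF f(2) fhpart_scale[OF g(2)]])
      then show ?thesis by (simp add: f(1) abs_base_simps(7) abs_base_eq_iff)
    qed
    moreover have "0 \<in> abs_base ` fhpart p" for p unfolding abs_base_simps(7) by (auto simp: fhpart_def)
    ultimately show ?thesis by (auto simp: versal_base_def)
  qed
  show "\<exists>a\<in>even_part versal_base. \<exists>b\<in>odd_part versal_base. x = a + b"
  proof -
    let ?a = "fscale (1 / 2) (f + fpar f)" and ?b = "fscale (1 / 2) (f - fpar f)"
    have "?a \<in> fhpart 0" "?b \<in> fhpart 1" by (auto simp: fhpart_def minus_one_power_iff)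
    moreover have "x = abs_base ?a + abs_base ?b"
      unfolding x abs_base_simps by (rule arg_cong[of _ _ abs_base], rule fser_eqI) (simp add: field_simps)
    ultimately show ?thesis by (auto simp: versal_base_def)
  qed
  show "aug versal_base (x * y) = aug versal_base x * aug versal_base y"
    by (simp add: x y abs_base_simps fcoeff_Nil_mult)
  show "aug versal_base 1 = 1" by (simp add: abs_base_simps(6,8))
  show "x \<in> odd_part versal_base \<Longrightarrow> aug versal_base x = 0"
    by (auto simp: versal_base_def abs_base_simps fhpart_def)
  show "x \<notin> mideal versal_base \<Longrightarrow> \<exists>y. x * y = 1 \<and> y * x = 1"
    using base_unit[of x] by (simp add: mideal_def)
  show "x \<in> hpart versal_base p \<Longrightarrow> y \<in> hpart versal_base q \<Longrightarrow> x * y \<in> hpart versal_base (p + q)"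
    unfolding hpart_versal_base using fhpart_mult by (auto simp: abs_base_simps)
  show "x \<in> hpart versal_base p \<Longrightarrow> y \<in> hpart versal_base q \<Longrightarrow> x * y = (-1) ^ (p * q) * (y * x)"
  proof -
    assume "x \<in> hpart versal_base p" "y \<in> hpart versal_base q"
    then obtain f g where f: "x = abs_base f" "f \<in> fhpart p" and g: "y = abs_base g" "g \<in> fhpart q"
      unfolding hpart_versal_base by blast
    have "(-1) ^ n * z = bscale ((-1) ^ n) z" for n and z :: base by (simp add: minus_one_power_iff)
    then show ?thesis
      using fser_supercommute[OF f(2) g(2)] by (simp add: f(1) g(1) abs_base_simps abs_base_eq_iff)
  qed
  show "Vector_Spaces.linear (scale versal_base) (*) (aug versal_base)"
  proof (intro Vector_Spaces.linear.intro module_hom.intro module_hom_axioms.intro)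
    show "vector_space (scale versal_base)" by (simp add: vector_space_bscale)
    show "vector_space ((*) :: complex \<Rightarrow> complex \<Rightarrow> complex)" by unfold_locales (auto simp: algebra_simps)
    then show "module ((*) :: complex \<Rightarrow> complex \<Rightarrow> complex)" by (simp add: vector_space_def module_def)
    show "module (scale versal_base)" using vector_space_bscale by (simp add: vector_space_def module_def)
    fix c and u v :: base
    obtain f where u: "u = abs_base f" by (rule base_cases)
    obtain g where v: "v = abs_base g" by (rule base_cases)
    show "aug versal_base (u + v) = aug versal_base u + aug versal_base v" by (simp add: u v abs_base_simps)
    show "aug versal_base (scale versal_base c u) = c * aug versal_base u" by (simp add: u abs_base_simps)
  qed
qed

lemma abs_fword_mpow: "n \<le> length w \<Longrightarrow> abs_base (fword w) \<in> mpow versal_base n"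
proof (induction n arbitrary: w)
  case (Suc n)
  then obtain x v where w: "w = x # v" "n \<le> length v" by (cases w) auto
  have "abs_base (fvar x) \<in> mideal versal_base"
    by (simp add: mideal_def abs_base_simps fvar.rep_eq)
  then show ?case
    unfolding w(1) fword_Cons abs_base_simps(3)[symmetric] mpow.simps versal_base_simps
    using Suc.IH[OF w(2)] by (intro bs.span_base) blast
qed simp

lemma mpow_versal_base: "mpow versal_base n \<subseteq> abs_base ` ford n"
proof (induction n)
  case (Suc n)
  show ?case
    unfolding mpow.simps versal_base_simps
  proof (rule bs.span_minimal[OF _ base_filt_subspace], clarify)
    fix a b :: base assume a: "a \<in> mideal versal_base" and "b \<in> mpow versal_base n"
    then obtain g where g: "b = abs_base g" "g \<in> ford n" using Suc by blast
    obtain f where f: "a = abs_base f" by (rule base_cases)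
    have "f \<in> ford 1" using a by (simp add: f mideal_def abs_base_simps ford_def)
    then show "a * b \<in> abs_base ` ford (Suc n)"
      using ford_mult[OF _ g(2), of f 1] by (auto simp: f g(1) abs_base_simps plus_1_eq_Suc)
  qed
qed (simp, metis UNIV_I base_cases ford_0 rangeI subsetI)

lemma formal_base_versal_base: "formal_base versal_base"
proof (intro formal_base.intro formal_base_axioms.intro superalgebra_versal_base)
  fix n and x y :: base
  show "module.subspace (scale versal_base) (filt versal_base n)"
    using base_filt_subspace by simp
  show "y * x \<in> filt versal_base n \<and> x * y \<in> filt versal_base n" if "x \<in> filt versal_base n"
  proof -
    obtain g where "y = abs_base g" by (rule base_cases)
    then show ?thesis using that ford_mult_left ford_mult_right by (auto simp: abs_base_simps)
  qed
  show "a \<in> filt versal_base n"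
    if "a \<in> even_part versal_base" "b \<in> odd_part versal_base" "a + b \<in> filt versal_base n" for a b
  proof -
    obtain f g h where f: "a = abs_base f" "f \<in> fhpart 0" and g: "b = abs_base g" "g \<in> fhpart 1"
      and h: "a + b = abs_base h" "h \<in> ford n"
      using \<open>a \<in> even_part versal_base\<close> \<open>b \<in> odd_part versal_base\<close> \<open>a + b \<in> filt versal_base n\<close>
      by (auto simp: versal_base_def)
    let ?h0 = "fscale (1 / 2) (h + fpar h)" and ?h1 = "fscale (1 / 2) (h - fpar h)"
    have hp: "?h0 \<in> fhpart 0" "?h1 \<in> fhpart 1" by (auto simp: fhpart_def minus_one_power_iff)
    have "(f + fscale (-1) ?h0) + (g + fscale (-1) ?h1) = f + g - h"
      by (rule fser_eqI) (simp add: field_simps)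
    also have "\<dots> \<in> base_ideal" using h(1) by (simp add: f(1) g(1) abs_base_simps abs_base_eq_iff)
    finally have "f + fscale (-1) ?h0 \<in> base_ideal"
      by (rule even_component_in_ideal[OF fhpart_add[OF f(2) fhpart_scale[OF hp(1)]]
            fhpart_add[OF g(2) fhpart_scale[OF hp(2)]]])
    then have "a = abs_base ?h0" by (simp add: f(1) abs_base_eq_iff)
    moreover have "?h0 \<in> ford n" using h(2) by (intro fscale_ford ford_add fpar_ford)
    ultimately show ?thesis by auto
  qed
  show "filt versal_base (Suc n) \<subseteq> filt versal_base n" using ford_mono[of n "Suc n"] by auto
  show "filt versal_base n = (\<Inter>k. {x + y |x y. x \<in> mpow versal_base n \<and> y \<in> filt versal_base k})"
  proof
    show "filt versal_base n \<subseteq> (\<Inter>k. {x + y |x y. x \<in> mpow versal_base n \<and> y \<in> filt versal_base k})"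
    proof (intro subsetI INT_I)
      fix z and k :: nat assume "z \<in> filt versal_base n"
      then obtain f where f: "z = abs_base f" "f \<in> ford n" by auto
      have "bs.subspace (mpow versal_base n)"
        by (cases n) (simp_all add: bs.subspace_UNIV bs.subspace_span)
      then have "abs_base (ftrunc k f) \<in> mpow versal_base n"
        unfolding ftrunc_sum abs_base_sum abs_base_simps(4)[symmetric]
        by (intro bs.subspace_sum bs.subspace_scale abs_fword_mpow)
           (use f(2) in \<open>auto simp: fsupp_def ford_def not_less[symmetric]\<close>)
      moreover have "abs_base (f - ftrunc k f) \<in> filt versal_base k" using ftrunc_ford by simp
      moreover have "z = abs_base (ftrunc k f) + abs_base (f - ftrunc k f)" by (simp add: f(1) abs_base_simps)
      ultimately show "z \<in> {x + y |x y. x \<in> mpow versal_base n \<and> y \<in> filt versal_base k}" by blast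
    qed
    show "(\<Inter>k. {x + y |x y. x \<in> mpow versal_base n \<and> y \<in> filt versal_base k}) \<subseteq> filt versal_base n"
    proof
      fix z assume "z \<in> (\<Inter>k. {x + y |x y. x \<in> mpow versal_base n \<and> y \<in> filt versal_base k})"
      then obtain x y where "z = x + y" "x \<in> mpow versal_base n" "y \<in> filt versal_base n" by blast
      then show "z \<in> filt versal_base n"
        using mpow_versal_base[of n] bs.subspace_add[OF base_filt_subspace] by auto
    qed
  qed
  fix s :: "nat \<Rightarrow> base" assume s: "\<And>n. s (Suc n) - s n \<in> filt versal_base n"
  show "\<exists>!l. \<forall>n. l - s n \<in> filt versal_base n"
  proof (rule ex_ex1I)
    show "\<exists>l. \<forall>n. l - s n \<in> filt versal_base n" using base_complete[of s] s by simp
    fix l l' assume l: "\<forall>n. l - s n \<in> filt versal_base n" and l': "\<forall>n. l' - s n \<in> filt versal_base n"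
    have "l - l' \<in> abs_base ` ford n" for n
    proof -
      have "l - l' = (l - s n) - (l' - s n)" by simp
      then show ?thesis using l l' bs.subspace_diff[OF base_filt_subspace] by (metis versal_base_simps(3))
    qed
    then show "l = l'" using base_separated[of "l - l'"] by simp
  qed
qed

section \<open>Homomorphisms out of the base\<close>

context formal_base
begin

lemma of_int_scale: "of_int z * x = scale A (of_int z) x"
  by (cases z) (simp_all add: of_nat_scale scale_left_distrib distrib_right left_diff_distrib
      scale_left_diff_distrib)

lemma infinitesimal_filt_2: "infinitesimal A \<Longrightarrow> filt A 2 = {0}"
proof -
  assume i: "infinitesimal A"
  have "x = 0" if "x \<in> filt A 2" for x
  proof -
    have "x \<in> {x + y |x y. x \<in> mpow A 2 \<and> y \<in> filt A k}" for k
      using that by (subst (asm) filt_closure) blast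
    then have "x \<in> filt A k" for k using i by (auto simp: infinitesimal_def)
    then show ?thesis by (rule filt_Inter)
  qed
  then show ?thesis by auto
qed

end

locale parameter_values = formal_base A for A :: "'a::ring_1 salg" +
  fixes u :: "param \<Rightarrow> 'a"
  assumes params: "params u" and small: "small u"
begin

definition word_value :: "param list \<Rightarrow> 'a" where
  "word_value w = prod_list (map u w)"

lemma word_value_append: "word_value (v @ w) = word_value v * word_value w"
  by (simp add: word_value_def)

lemma word_value_filt: "n \<le> length w \<Longrightarrow> word_value w \<in> filt A n"
proof (induction n arbitrary: w)
  case (Suc n)
  then obtain x v where w: "w = x # v" "n \<le> length v" by (cases w) auto
  then show ?case
    using filt_Suc_mult_left[OF small[unfolded small_def, rule_format] Suc.IH[OF w(2)], of x]
    by (simp add: word_value_def)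
qed simp

lemma word_value_hpart: "word_value w \<in> hpart A (sum_list (map ppar w))"
proof (induction w)
  case Nil
  then show ?case using one_even by (simp add: word_value_def)
next
  case (Cons x w)
  then show ?case using hpart_mult[OF params_hpart[OF params refl] Cons, of x] by (simp add: word_value_def)
qed

definition word_sum :: "param list set \<Rightarrow> fser \<Rightarrow> 'a" where
  "word_sum S F = (\<Sum>w\<in>S. scale A (fcoeff F w) (word_value w))"

lemma fcong_sum_superset:
  assumes "finite S" "T \<subseteq> S" "\<And>x. x \<in> S - T \<Longrightarrow> f x \<in> filt A n"
  shows "fcong n (sum f S) (sum f T)"
proof -
  have "sum f S = sum f (S - T) + sum f T" using assms by (simp add: sum.subset_diff)
  then show ?thesis using filt_sum[of "S - T" f n] assms(3) by (simp add: fcong_def)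
qed

lemma fcong_word_sum: "finite S \<Longrightarrow> fsupp n F \<subseteq> S \<Longrightarrow> fcong n (word_sum S F) (word_sum (fsupp n F) F)"
  unfolding word_sum_def
proof (rule fcong_sum_superset)
  fix w assume "w \<in> S - fsupp n F"
  then have "n \<le> length w \<or> fcoeff F w = 0" by (auto simp: fsupp_def)
  then show "scale A (fcoeff F w) (word_value w) \<in> filt A n" using word_value_filt by (auto intro: filt_scale)
qed

definition series_eval :: "fser \<Rightarrow> 'a" where
  "series_eval F = (SOME l. \<forall>n. fcong n l (word_sum (fsupp n F) F))"

lemma series_eval_fcong: "fcong n (series_eval F) (word_sum (fsupp n F) F)"
proof -
  have "fsupp n F \<subseteq> fsupp (Suc n) F" for n by (auto simp: fsupp_def)
  then have "fcong n (word_sum (fsupp (Suc n) F) F) (word_sum (fsupp n F) F)" for n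
    by (rule fcong_word_sum[OF finite_fsupp])
  then have "\<exists>l. \<forall>n. fcong n l (word_sum (fsupp n F) F)" by (rule limit_exists) blast
  then show ?thesis unfolding series_eval_def by (rule someI2_ex) blast
qed

lemma series_eval_cl': "finite S \<Longrightarrow> fsupp n F \<subseteq> S \<Longrightarrow> fcong n (series_eval F) (word_sum S F)"
  using fcong_trans[OF series_eval_fcong fcong_sym[OF fcong_word_sum]] .

lemma series_eval_add: "series_eval (F + G) = series_eval F + series_eval G"
proof (rule fcong_all)
  fix n
  let ?S = "fsupp n F \<union> fsupp n G \<union> fsupp n (F + G)"
  have "word_sum ?S (F + G) = word_sum ?S F + word_sum ?S G"
    by (simp add: word_sum_def scale_left_distrib sum.distrib)
  moreover have "fcong n (series_eval (F + G)) (word_sum ?S (F + G))" by (rule series_eval_cl') auto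
  moreover have "fcong n (series_eval F + series_eval G) (word_sum ?S F + word_sum ?S G)" by (intro fcong_add series_eval_cl') auto
  ultimately show "fcong n (series_eval (F + G)) (series_eval F + series_eval G)" using fcong_trans fcong_sym by metis
qed

lemma series_eval_scale: "series_eval (fscale c F) = scale A c (series_eval F)"
proof (rule fcong_all)
  fix n
  let ?S = "fsupp n F \<union> fsupp n (fscale c F)"
  have "word_sum ?S (fscale c F) = scale A c (word_sum ?S F)"
    by (simp add: word_sum_def scale_sum_right)
  moreover have "fcong n (series_eval (fscale c F)) (word_sum ?S (fscale c F))" by (rule series_eval_cl') auto
  moreover have "fcong n (scale A c (series_eval F)) (scale A c (word_sum ?S F))"
    using filt_scale[of "series_eval F - word_sum ?S F" n c] series_eval_cl'[of ?S n F]
    by (simp add: fcong_def scale_right_diff_distrib)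
  ultimately show "fcong n (series_eval (fscale c F)) (scale A c (series_eval F))" using fcong_trans fcong_sym by metis
qed

lemma series_eval_mult: "series_eval (F * G) = series_eval F * series_eval G"
proof (rule fcong_all)
  fix n
  define h where "h p = scale A (fcoeff F (fst p) * fcoeff G (snd p)) (word_value (fst p @ snd p))" for p
  let ?P = "fsupp n F \<times> fsupp n G"
  let ?S = "(\<lambda>p. fst p @ snd p) ` ?P \<union> fsupp n (F * G)"
  let ?Q = "SIGMA w:?S. wsplits w"
  have 1: "word_sum (fsupp n F) F * word_sum (fsupp n G) G = sum h ?P"
    by (simp add: word_sum_def sum_product sum.cartesian_product h_def word_value_append split_def mult.commute
        flip: scale_mult_left scale_mult_right)
  have inj: "inj_on snd ?Q" by (auto simp: inj_on_def wsplits_def)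
  have "word_sum ?S (F * G) = (\<Sum>w\<in>?S. \<Sum>p\<in>wsplits w. h p)"
    unfolding word_sum_def fcoeff_mult split_def scale_sum_left
    by (intro sum.cong refl) (auto simp: h_def wsplits_def)
  also have "\<dots> = (\<Sum>p\<in>?Q. h (snd p))" by (subst sum.Sigma) (auto simp: split_def)
  also have "\<dots> = sum h (snd ` ?Q)" by (simp only: sum.reindex[OF inj] comp_def)
  finally have 2: "word_sum ?S (F * G) = sum h (snd ` ?Q)" .
  have "fcong n (sum h (snd ` ?Q)) (sum h ?P)"
  proof (rule fcong_sum_superset)
    show "finite (snd ` ?Q)" by auto
    show "?P \<subseteq> snd ` ?Q"
    proof
      fix p assume p: "p \<in> ?P"
      then have "(fst p @ snd p, p) \<in> ?Q" by (auto simp: wsplits_def split_def)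
      then show "p \<in> snd ` ?Q" by force
    qed
    fix p assume "p \<in> snd ` ?Q - ?P"
    then have "fst p \<notin> fsupp n F \<or> snd p \<notin> fsupp n G" by (auto simp: mem_Times_iff)
    then have "fcoeff F (fst p) * fcoeff G (snd p) = 0 \<or> n \<le> length (fst p @ snd p)"
      by (auto simp: fsupp_def)
    then show "h p \<in> filt A n"
    proof
      show "fcoeff F (fst p) * fcoeff G (snd p) = 0 \<Longrightarrow> h p \<in> filt A n" by (auto simp: h_def)
      show "n \<le> length (fst p @ snd p) \<Longrightarrow> h p \<in> filt A n"
        unfolding h_def by (rule filt_scale[OF word_value_filt])
    qed
  qed
  then have 3: "fcong n (word_sum ?S (F * G)) (word_sum (fsupp n F) F * word_sum (fsupp n G) G)"
    unfolding 1 2 .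
  have "fcong n (series_eval (F * G)) (word_sum ?S (F * G))" by (rule series_eval_cl') auto
  from fcong_trans[OF this 3] show "fcong n (series_eval (F * G)) (series_eval F * series_eval G)"
    by (rule fcong_trans[OF _ fcong_sym[OF fcong_mult[OF series_eval_fcong series_eval_fcong]]])
qed

lemma series_eval_fword: "series_eval (fword w) = word_value w"
proof (rule fcong_all)
  fix n
  have "word_sum (fsupp n (fword w) \<union> {w}) (fword w) = (\<Sum>v\<in>{w}. scale A (fcoeff (fword w) v) (word_value v))"
    unfolding word_sum_def by (rule sum.mono_neutral_right) auto
  then have "word_sum (fsupp n (fword w) \<union> {w}) (fword w) = word_value w" by simp
  moreover have "fcong n (series_eval (fword w)) (word_sum (fsupp n (fword w) \<union> {w}) (fword w))"
    by (rule series_eval_cl') auto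
  ultimately show "fcong n (series_eval (fword w)) (word_value w)" by simp
qed

lemma series_eval_fvar: "series_eval (fvar x) = u x"
  by (simp add: fvar_fword series_eval_fword word_value_def)

lemma series_eval_one: "series_eval 1 = 1"
  using series_eval_fword[of "[]"] by (simp add: fword_Nil word_value_def)

lemma series_eval_zero: "series_eval 0 = 0"
  using series_eval_scale[of 0 0] by simp

lemma series_eval_diff: "series_eval (F - G) = series_eval F - series_eval G"
  using series_eval_add[of "F - G" G] by simp

lemma series_eval_sum: "series_eval (sum f S) = (\<Sum>i\<in>S. series_eval (f i))"
  by (induction S rule: infinite_finite_induct) (simp_all add: series_eval_zero series_eval_add)

lemma series_eval_aug: "aug A (series_eval F) = fcoeff F []"
proof -
  have "word_sum {[]} F = scale A (fcoeff F []) 1" by (simp add: word_sum_def word_value_def)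
  moreover have "fcong 1 (series_eval F) (word_sum {[]} F)" by (rule series_eval_cl') (auto simp: fsupp_def)
  ultimately have "aug A (series_eval F - scale A (fcoeff F []) 1) = 0"
    unfolding fcong_def filt_1 mideal_def by simp
  then show ?thesis by (simp add: aug_one)
qed

lemma series_eval_hpart: "F \<in> fhpart p \<Longrightarrow> series_eval F \<in> hpart A p"
proof (rule hpart_closed)
  show "series_eval F - word_sum (fsupp n F) F \<in> filt A n" for n using series_eval_fcong by (simp add: fcong_def)
  show "word_sum (fsupp n F) F \<in> hpart A p" if F: "F \<in> fhpart p" for n
    unfolding word_sum_def
  proof (intro hpart_sum hpart_scale)
    fix w assume "w \<in> fsupp n F"
    then have "even (sum_list (map ppar w) + p)" using F by (auto simp: fsupp_def fhpart_def)
    from hpart_cong[OF this, of A] show "word_value w \<in> hpart A p" using word_value_hpart[of w] by simp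
  qed
qed

lemma series_eval_ford: "F \<in> ford n \<Longrightarrow> series_eval F \<in> filt A n"
proof -
  assume "F \<in> ford n"
  then have "fsupp n F = {}" by (auto simp: fsupp_def ford_def)
  then show ?thesis using series_eval_fcong[of n F] by (simp add: word_sum_def fcong_zero)
qed

end

locale parameter_solution = parameter_values A u for A :: "'a::ring_1 salg" and u +
  assumes s_eta_relation: "u PS * u PEta = 0"
    and t_theta_relation: "\<And>n. n \<ge> 1 \<Longrightarrow> t_theta_relation u n = 0"
    and theta_theta_relation: "\<And>n. n \<ge> 1 \<Longrightarrow> theta_theta_relation u n = 0"
begin

lemma series_eval_generators:
  assumes "r \<in> graded_commutators \<union> base_relations" shows "series_eval r = 0"
proof -
  have c: "series_eval (fvar x * fvar y - (-1) ^ (ppar x * ppar y) * (fvar y * fvar x)) = 0" for x y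
    by (simp only: fscale_sgn series_eval_diff series_eval_scale series_eval_mult series_eval_fvar sgn_scale[symmetric] diff_self
        supercommute[OF params_hpart[OF params refl, of x] params_hpart[OF params refl, of y]])
  have 1: "series_eval (\<Sum>k=1..n. let l = n + 1 - k in of_int (int k - int l - 1) * (ft k * ftheta l)) = t_theta_relation u n" for n
    by (simp only: t_theta_relation_def Let_def series_eval_sum of_int_fser series_eval_scale series_eval_mult ft_def ftheta_def series_eval_fvar of_int_scale)
  have 2: "series_eval (\<Sum>k=1..n. let l = n + 1 - k in of_int (int k - int l) * (ftheta k * ftheta l)) = theta_theta_relation u n" for n
    by (simp only: theta_theta_relation_def Let_def series_eval_sum of_int_fser series_eval_scale series_eval_mult ftheta_def series_eval_fvar of_int_scale)
  from assms consider x y where "r = fvar x * fvar y - (-1) ^ (ppar x * ppar y) * (fvar y * fvar x)"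
    | "r = fvar PS * fvar PEta"
    | n where "n \<ge> 1" "r = (\<Sum>k=1..n. let l = n + 1 - k in of_int (int k - int l - 1) * (ft k * ftheta l))"
    | n where "n \<ge> 1" "r = (\<Sum>k=1..n. let l = n + 1 - k in of_int (int k - int l) * (ftheta k * ftheta l))"
    unfolding graded_commutators_def base_relations_def by blast
  then show ?thesis
    by cases (simp_all only: c 1 2 s_eta_relation t_theta_relation theta_theta_relation series_eval_mult series_eval_fvar)
qed

lemma series_eval_base_gen: "F \<in> base_gen \<Longrightarrow> series_eval F = 0"
  unfolding base_gen_def
  by (induction rule: ideal_gen.induct) (simp_all add: series_eval_zero series_eval_mult series_eval_add series_eval_generators)

lemma series_eval_base_ideal: "F \<in> base_ideal \<Longrightarrow> series_eval F = 0"
proof (rule filt_Inter)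
  fix n assume "F \<in> base_ideal"
  then obtain g where g: "g \<in> base_gen" "F - g \<in> ford n" using base_idealD by blast
  then show "series_eval F \<in> filt A n" using series_eval_ford[OF g(2)] by (simp add: series_eval_diff series_eval_base_gen)
qed

definition base_eval :: "base \<Rightarrow> 'a" where
  "base_eval x = series_eval (SOME F. x = abs_base F)"

lemma base_eval_abs: "base_eval (abs_base F) = series_eval F"
proof -
  have "abs_base F = abs_base (SOME G. abs_base F = abs_base G)" by (rule someI) (rule refl)
  then have "F - (SOME G. abs_base F = abs_base G) \<in> base_ideal" by (simp only: abs_base_eq_iff)
  then show ?thesis using series_eval_base_ideal by (fastforce simp: base_eval_def series_eval_diff)
qed

lemma base_eval_bpar: "base_eval (bpar x) = u x"
  by (simp add: bpar_def base_eval_abs series_eval_fvar)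

lemma base_hom_base_eval: "base_hom versal_base A base_eval"
  unfolding base_hom_def versal_base_simps
proof (intro conjI allI)
  show "Vector_Spaces.linear bscale (scale A) base_eval"
  proof (intro Vector_Spaces.linear.intro module_hom.intro module_hom_axioms.intro)
    show "vector_space bscale" by (rule vector_space_bscale)
    show "vector_space (scale A)" by unfold_locales
    show "module (scale A)" by unfold_locales
    show "module bscale" using vector_space_bscale by (simp add: vector_space_def module_def)
    fix c and x y :: base
    obtain f where x: "x = abs_base f" by (rule base_cases)
    obtain g where y: "y = abs_base g" by (rule base_cases)
    show "base_eval (x + y) = base_eval x + base_eval y" by (simp add: x y abs_base_simps base_eval_abs series_eval_add)
    show "base_eval (bscale c x) = scale A c (base_eval x)" by (simp add: x abs_base_simps base_eval_abs series_eval_scale)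
  qed
  fix x y :: base and p n
  obtain f where x: "x = abs_base f" by (rule base_cases)
  obtain g where y: "y = abs_base g" by (rule base_cases)
  show "base_eval (x * y) = base_eval x * base_eval y" by (simp add: x y abs_base_simps base_eval_abs series_eval_mult)
  show "base_eval 1 = 1" unfolding abs_base_simps(6) base_eval_abs by (rule series_eval_one)
  show "base_eval ` hpart versal_base p \<subseteq> hpart A p"
    using series_eval_hpart by (auto simp: hpart_versal_base base_eval_abs)
  show "aug A (base_eval x) = baug x" by (simp add: x abs_base_simps base_eval_abs series_eval_aug)
  show "base_eval ` abs_base ` ford n \<subseteq> filt A n" using series_eval_ford by (auto simp: base_eval_abs)
qed

end

section \<open>The matrix of the deformation\<close>

definition param_direction :: "param \<Rightarrow> nat" where
  "param_direction x = (case x of PS \<Rightarrow> 2 | PEta \<Rightarrow> 2 | PT _ \<Rightarrow> 3 | PTheta _ \<Rightarrow> 3)"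

definition param_mi :: "param \<Rightarrow> mi" where
  "param_mi x = (case x of PS \<Rightarrow> (1, 0, 0) | PEta \<Rightarrow> (0, 1, 0) | PT m \<Rightarrow> (1, 0, m) | PTheta m \<Rightarrow> (0, 0, Suc m))"

definition mi_component :: "nat \<Rightarrow> mi \<Rightarrow> nat" where
  "mi_component j K = (if j = 1 then fst K else if j = 2 then fst (snd K) else snd (snd K))"

lemma delta_eq: "delta x = phi (param_mi x) (param_direction x)"
  by (cases x) (simp_all add: param_mi_def param_direction_def xi_def sigma_def psik_def phik_def One_nat_def)

lemma coder_phi:
  assumes I: "I \<in> MI" and j: "j \<in> {1, 2, 3}"
  shows "coder (phi I j) K J =
    (if K \<in> MI \<and> J \<in> MI \<and> J + evec j = K + I
     then of_nat (mi_component j K) * of_nat (mfact J) / of_nat (mfact K) else 0)"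
proof (cases "K \<in> MI \<and> J \<in> MI")
  case True
  let ?S = "{(I', N, j'). I' \<in> MI \<and> j' \<in> {1, 2, 3} \<and> I' + N = J \<and> N + evec j' = K}"
  let ?f = "\<lambda>t. of_nat (mbinom J (fst t)) * phi I j (fst t) (snd (snd t)) :: complex"
  have "?S \<subseteq> (\<lambda>(p, j'). (fst p, snd p, j')) ` (msplits J \<times> {1, 2, 3})"
  proof
    fix t assume "t \<in> ?S"
    then show "t \<in> (\<lambda>(p, j'). (fst p, snd p, j')) ` (msplits J \<times> {1, 2, 3})"
      by (intro image_eqI[where x = "((fst t, fst (snd t)), snd (snd t))"]) (auto simp: msplits_iff)
  qed
  then have fin: "finite ?S" by (rule finite_subset) auto
  have c: "coder (phi I j) K J = sum ?f ?S"
    using True by (simp add: coder_def split_def)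
  show ?thesis
  proof (cases "\<exists>N. I + N = J \<and> N + evec j = K")
    case True
    then obtain N where N: "I + N = J" "N + evec j = K" by blast
    have "sum ?f ?S = sum ?f {(I, N, j)}"
    proof (rule sum.mono_neutral_right[OF fin])
      show "{(I, N, j)} \<subseteq> ?S" using I j N by auto
      show "\<forall>t\<in>?S - {(I, N, j)}. ?f t = 0"
      proof
        fix t assume t: "t \<in> ?S - {(I, N, j)}"
        obtain I' N' j' where t': "t = (I', N', j')" by (cases t)
        have "N' = N" if "I' = I" using t that N(1) by (auto simp: t')
        then have "\<not> (I' = I \<and> j' = j)" using t by (auto simp: t')
        then show "?f t = 0" by (auto simp: t' phi_def)
      qed
    qed
    also have "\<dots> = of_nat (mfact J) / of_nat (mfact N)"
      using mbinom_mfact[of I N] by (simp add: phi_def N(1))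
    also have "\<dots> = of_nat (mi_component j K) * of_nat (mfact J) / of_nat (mfact K)"
    proof -
      have "mfact K = mi_component j K * mfact N"
        using j by (cases N) (auto simp: N(2)[symmetric] evec_def mi_component_def mfact_def One_nat_def algebra_simps)
      moreover have "mi_component j K \<noteq> 0" using j by (auto simp: N(2)[symmetric] evec_def mi_component_def)
      ultimately show ?thesis by (simp add: field_simps)
    qed
    finally show ?thesis using c \<open>K \<in> MI \<and> J \<in> MI\<close> N by (auto simp: add.commute add.left_commute)
  next
    case False
    have "sum ?f ?S = 0"
    proof (rule sum.neutral, rule ballI)
      fix t assume t: "t \<in> ?S"
      obtain I' N' j' where t': "t = (I', N', j')" by (cases t)
      have "\<not> (I' = I \<and> j' = j)" using t False by (auto simp: t')
      then show "?f t = 0" by (auto simp: t' phi_def)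
    qed
    moreover have "mi_component j K = 0" if "J + evec j = K + I"
    proof (rule ccontr)
      assume nz: "mi_component j K \<noteq> 0"
      define N where "N = K - evec j"
      have N: "N + evec j = K"
        using nz j by (cases K) (auto simp: N_def mi_component_def evec_def)
      then have "J + evec j = (I + N) + evec j" using that by (simp add: ac_simps)
      then have "I + N = J" by simp
      with N False show False by blast
    qed
    ultimately show ?thesis using c by auto
  qed
qed (auto simp: coder_def)

definition param_weight :: "param \<Rightarrow> mi \<Rightarrow> mi \<Rightarrow> nat" where
  "param_weight x K J = (if K \<in> MI \<and> J \<in> MI \<and> J + evec (param_direction x) = K + param_mi x then mi_component (param_direction x) K else 0)"

lemma param_mi_MI: "param_mi x \<in> MI"
  by (cases x) (auto simp: param_mi_def MI_iff)

lemma param_direction_range: "param_direction x \<in> {1, 2, 3}"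
  by (cases x) (auto simp: param_direction_def)

lemma coder_delta: "coder (delta x) K J = of_nat (param_weight x K J) * (of_nat (mfact J) / of_nat (mfact K))"
  by (simp add: delta_eq coder_phi[OF param_mi_MI param_direction_range] param_weight_def)

lemma param_weight_sign: "param_weight x K J \<noteq> 0 \<Longrightarrow> even (ppar x * par J + par K)"
  by (cases x; cases K; cases J)
     (auto simp: param_weight_def param_direction_def param_mi_def mi_component_def evec_def par_def MI_iff split: if_splits)

definition param_range :: "nat \<Rightarrow> param set" where
  "param_range n = {PS, PEta} \<union> PT ` {..<n} \<union> PTheta ` {..<n}"

lemma finite_param_range [simp]: "finite (param_range n)"
  by (simp add: param_range_def)

lemma param_weight_range: "param_weight x K J \<noteq> 0 \<Longrightarrow> x \<in> param_range (deg J)"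
  by (cases x; cases K; cases J)
     (auto simp: param_weight_def param_range_def param_direction_def param_mi_def mi_component_def evec_def deg_def split: if_splits)

lemma sum_param_range:
  "sum f (param_range n) = f PS + f PEta + (\<Sum>m<n. f (PT m)) + (\<Sum>m<n. f (PTheta m))"
proof -
  have "sum f (param_range n) = sum f {PS, PEta} + sum f (PT ` {..<n}) + sum f (PTheta ` {..<n})"
    unfolding param_range_def by (subst sum.union_disjoint; (subst sum.union_disjoint)?; auto)
  then show ?thesis by (simp add: sum.reindex inj_on_def)
qed

definition harmonic :: "(param \<Rightarrow> 'b::ring_1) \<Rightarrow> nat \<Rightarrow> mi \<Rightarrow> 'b" where
  "harmonic u j J = nf u j J - nf (\<lambda>_. 0) j J"

lemma harmonic_simps [simp]:
  "harmonic u 2 (0, b, c) = (if b = 1 \<and> c = 0 then u PEta else 0)"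
  "harmonic u 2 (1, b, c) = (if b = 0 \<and> c = 0 then u PS else 0)"
  "harmonic u 3 (1, b, c) = (if b = 0 then u (PT c) else 0)"
  "harmonic u 3 (0, b, c) = (if b = 0 \<and> c > 0 then u (PTheta (c - 1)) else 0)"
  "harmonic u 1 J = 0"
  by (auto simp: harmonic_def)

lemma harmonic_param_mi: "harmonic u (param_direction x) (param_mi x) = u x"
  by (cases x) (simp_all add: param_direction_def param_mi_def)

lemma MIfield_harmonic: "MIfield (harmonic u)"
  by (simp add: MIfield_def harmonic_def moffD[OF MIfield_nf])

lemma field_matrix_harmonic:
  "field_matrix p (harmonic u) K J = (-1) ^ (p * par K) * (\<Sum>x\<in>param_range (deg J). of_nat (param_weight x K J) * u x)"
proof (cases "K \<in> MI \<and> J \<in> MI")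
  case True
  obtain a b c where K: "K = (a, b, c)" by (cases K)
  obtain a' b' c' where J: "J = (a', b', c')" by (cases J)
  let ?n = "deg J"
  have a: "a = 0 \<or> a = 1" "a' = 0 \<or> a' = 1" using True by (auto simp: K J MI_iff)
  have PT: "(\<Sum>m<?n. of_nat (param_weight (PT m) K J) * u (PT m)) =
      of_nat c * shift (a, b, c - 1) (\<lambda>(i, j, k). if i = 1 \<and> j = 0 then u (PT k) else 0) J"
  proof -
    have "(\<Sum>m<?n. of_nat (param_weight (PT m) K J) * u (PT m)) =
      (\<Sum>m<?n. if m = c' + 1 - c then (if a' = a + 1 \<and> b' = b \<and> c \<le> c' + 1 then of_nat c * u (PT m) else 0) else 0)"
      using True by (intro sum.cong) (auto simp: param_weight_def param_direction_def param_mi_def mi_component_def evec_def K J)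
    also have "\<dots> = (if c' + 1 - c < ?n then (if a' = a + 1 \<and> b' = b \<and> c \<le> c' + 1 then of_nat c * u (PT (c' + 1 - c)) else 0) else 0)"
      by (simp add: sum.delta')
    also have "\<dots> = of_nat c * shift (a, b, c - 1) (\<lambda>(i, j, k). if i = 1 \<and> j = 0 then u (PT k) else 0) J"
      by (cases c) (auto simp: J shift_eq deg_def One_nat_def)
    finally show ?thesis .
  qed
  have PTh: "(\<Sum>m<?n. of_nat (param_weight (PTheta m) K J) * u (PTheta m)) =
      of_nat c * shift (a, b, c - 1) (\<lambda>(i, j, k). if i = 0 \<and> j = 0 \<and> k > 0 then u (PTheta (k - 1)) else 0) J"
  proof -
    have "(\<Sum>m<?n. of_nat (param_weight (PTheta m) K J) * u (PTheta m)) =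
      (\<Sum>m<?n. if m = c' - c then (if a' = a \<and> b' = b \<and> c \<le> c' then of_nat c * u (PTheta m) else 0) else 0)"
      using True by (intro sum.cong) (auto simp: param_weight_def param_direction_def param_mi_def mi_component_def evec_def K J One_nat_def)
    also have "\<dots> = (if c' - c < ?n then (if a' = a \<and> b' = b \<and> c \<le> c' then of_nat c * u (PTheta (c' - c)) else 0) else 0)"
      by (simp add: sum.delta')
    also have "\<dots> = of_nat c * shift (a, b, c - 1) (\<lambda>(i, j, k). if i = 0 \<and> j = 0 \<and> k > 0 then u (PTheta (k - 1)) else 0) J"
      by (cases c) (auto simp: J shift_eq deg_def One_nat_def)
    finally show ?thesis .
  qed
  have 3: "shift L (harmonic u 3) J = shift L (\<lambda>(i, j, k). if i = 1 \<and> j = 0 then u (PT k) else 0) J +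
      shift L (\<lambda>(i, j, k). if i = 0 \<and> j = 0 \<and> k > 0 then u (PTheta (k - 1)) else 0) J" for L
    unfolding shift_plus[symmetric]
    by (rule shift_cong, rename_tac M, case_tac M) (auto simp: harmonic_def nf_def)
  have 2: "of_nat b * shift (a, b - 1, c) (harmonic u 2) J =
      of_nat (param_weight PS K J) * u PS + of_nat (param_weight PEta K J) * u PEta"
    using True a
    by (cases b) (auto simp: param_weight_def param_direction_def param_mi_def mi_component_def evec_def K J shift_eq harmonic_def nf_def One_nat_def split: if_splits)
  have 1: "shift L (harmonic u 1) J = 0" for L by (simp add: shift_def)
  show ?thesis
    using True
    by (simp add: field_matrix_def field_row_def K 1 2[unfolded K] 3 sum_param_range PT[unfolded K] PTh[unfolded K] par_def
        distrib_left add.assoc)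
next
  case False
  then have "param_weight x K J = 0" for x by (auto simp: param_weight_def)
  moreover have "field_matrix p (harmonic u) K J = 0" using False by (auto simp: field_matrix_def)
  ultimately show ?thesis by simp
qed

lemma field_matrix_add: "field_matrix p (\<lambda>j J. X j J + Y j J) K J = field_matrix p X K J + field_matrix p Y K J"
  by (cases "K \<in> MI \<and> J \<in> MI"; cases K) (auto simp: field_matrix_def field_row_def shift_plus algebra_simps)

lemma NF_harmonic: "NF u K J = NF (\<lambda>_. 0) K J + field_matrix 1 (harmonic u) K J"
proof -
  have "nf u = (\<lambda>j J. nf (\<lambda>_. 0) j J + harmonic u j J)" by (intro ext) (simp add: harmonic_def)
  then show ?thesis unfolding NF_def by (subst \<open>nf u = _\<close>) (rule field_matrix_add)
qed

lemma d0_eq: "d0 K J = NF (\<lambda>_. 0) K J"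
proof -
  have "d0 K J = (if K \<in> MI \<and> J \<in> MI \<and> J + evec 2 = K + (1, 1, 0)
     then of_nat (mi_component 2 K) * of_nat (mfact J) / of_nat (mfact K) else 0)"
    unfolding d0_def by (rule coder_phi) (auto simp: MI_iff)
  moreover obtain a b c where K: "K = (a, b, c)" by (cases K)
  moreover obtain a' b' c' where J: "J = (a', b', c')" by (cases J)
  ultimately show ?thesis
    by (auto simp: NF_zero_eq K J evec_def mi_component_def MI_iff mfact_def)
qed

lemma NF_zero_fact: "NF (\<lambda>_. 0) K J \<noteq> 0 \<Longrightarrow> mfact K = mfact J"
  by (auto simp: NF_zero_eq mfact_def split: if_splits prod.splits)

context local_superalgebra
begin

lemma normalized_brk: "normalized A (brk p q T U) = brk p q (normalized A T) (normalized A U)"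
proof (intro ext)
  fix K J
  let ?c = "of_nat (mfact K) / of_nat (mfact J) :: complex"
  have o: "scale A ?c (ocomp V W K J) = ocomp (normalized A V) (normalized A W) K J" for V W
    using fun_cong[OF fun_cong[OF normalized_ocomp[of V W]], of K J] by (simp add: normalized_def[of A "ocomp V W"])
  show "normalized A (brk p q T U) K J = brk p q (normalized A T) (normalized A U) K J"
    by (simp only: normalized_def[of A "brk p q T U"] brk_def scale_right_diff_distrib sgn_scale
        scale_left_commute[of ?c] o)
qed

lemma NF_zero_scale: "NF (\<lambda>_. 0) K J = scale A (NF (\<lambda>_. 0) K J) 1"
  using of_nat_scale[of _ 1] by (auto simp: NF_zero_eq split: prod.splits)

lemma NF_zero_ratio:
  "scale A (of_nat (mfact J) / of_nat (mfact K)) (NF (\<lambda>_. 0) K J) = NF (\<lambda>_. 0) K J"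
  using NF_zero_fact[of K J, where 'a = 'a] by (cases "NF (\<lambda>_. 0 :: 'a) K J = 0") auto

lemma aug_NF_zero: "aug A (NF (\<lambda>_. 0) K J) = d0 K J"
  by (subst NF_zero_scale) (simp add: aug_one d0_eq)

lemma denormalized_NF:
  "denormalized A (NF u) K J = scale A (d0 K J) 1 +
     (\<Sum>x\<in>param_range (deg J). ctens A (ppar x) (delta x) (u x) K J)"
proof -
  let ?c = "of_nat (mfact J) / of_nat (mfact K) :: complex"
  have "ctens A (ppar x) (delta x) (u x) K J =
      scale A ?c ((-1) ^ (1 * par K) * (of_nat (param_weight x K J) * u x))" for x
  proof (cases "param_weight x K J = 0")
    case True
    then show ?thesis by (simp add: ctens_def coder_delta)
  next
    case False
    then have "(-1) ^ (ppar x * par J) = ((-1) ^ (1 * par K) :: complex)"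
      using param_weight_sign[OF False] by (intro sgn_cong) simp
    then show ?thesis
      by (simp add: ctens_def coder_delta sgn_scale of_nat_scale mult.commute mult.left_commute)
  qed
  then have "(\<Sum>x\<in>param_range (deg J). ctens A (ppar x) (delta x) (u x) K J) =
      scale A ?c (field_matrix 1 (harmonic u) K J)"
    unfolding field_matrix_harmonic by (simp only: sum_distrib_left scale_sum_right)
  moreover have "scale A (d0 K J) 1 = scale A ?c (NF (\<lambda>_. 0) K J)"
    unfolding NF_zero_ratio d0_eq NF_zero_scale[symmetric] ..
  ultimately show ?thesis
    unfolding denormalized_def NF_harmonic[of u] by (simp only: scale_right_distrib)
qed

end

lemma d1_sum:
  "d1 K J = scale versal_base (d0 K J) 1 +
     (\<Sum>x\<in>param_range (deg J). ctens versal_base (ppar x) (delta x) (bpar x) K J)"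
proof -
  have 1: "(\<Sum>k=1..deg J. ctens versal_base 0 (psik k) (bpar (PT (k - 1))) K J) =
      (\<Sum>m<deg J. ctens versal_base (ppar (PT m)) (delta (PT m)) (bpar (PT m)) K J)"
    by (rule sum.reindex_bij_witness[of _ Suc "\<lambda>k. k - 1"]) (auto simp: One_nat_def)
  have 2: "(\<Sum>k=1..deg J. ctens versal_base 1 (phik k) (bpar (PTheta (k - 1))) K J) =
      (\<Sum>m<deg J. ctens versal_base (ppar (PTheta m)) (delta (PTheta m)) (bpar (PTheta m)) K J)"
    by (rule sum.reindex_bij_witness[of _ Suc "\<lambda>k. k - 1"]) (auto simp: One_nat_def)
  show ?thesis unfolding d1_def 1 2 sum_param_range by (simp add: add.assoc)
qed

interpretation vb: formal_base versal_base
  by (rule formal_base_versal_base)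

lemma d1_eq: "d1 = denormalized versal_base (NF bpar)"
  by (intro ext) (simp only: d1_sum vb.denormalized_NF)

lemma bpar_params: "vb.params bpar"
  unfolding vb.params_def hpart_versal_base bpar_def using fhpart_fvar by blast

lemma bpar_small: "vb.small bpar"
  unfolding vb.small_def versal_base_simps bpar_def fvar_fword
  using fword_ford[of 1 "[_]"] by (simp add: One_nat_def)

lemma bpar_relations:
  "bpar PS * bpar PEta = 0" "n \<ge> 1 \<Longrightarrow> t_theta_relation bpar n = 0" "n \<ge> 1 \<Longrightarrow> theta_theta_relation bpar n = 0"
proof -
  have z: "abs_base r = 0" if "r \<in> base_relations" for r
    using that base_gen_gen base_gen_ideal by (auto simp: abs_base_simps(7) abs_base_eq_iff)
  have i: "of_int k * abs_base f = abs_base (of_int k * f)" for k f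
    by (simp only: vb.of_int_scale versal_base_simps abs_base_simps of_int_fser)
  show "bpar PS * bpar PEta = 0"
    unfolding bpar_def abs_base_simps(3) by (rule z) (simp add: base_relations_def)
  assume n: "n \<ge> 1"
  have "t_theta_relation bpar n = abs_base (\<Sum>k=1..n. let l = n + 1 - k in of_int (int k - int l - 1) * (ft k * ftheta l))"
    by (simp only: t_theta_relation_def abs_base_sum Let_def ft_def ftheta_def bpar_def abs_base_simps(3) i)
  also have "\<dots> = 0" by (rule z) (use n in \<open>auto simp: base_relations_def\<close>)
  finally show "t_theta_relation bpar n = 0" .
  have "theta_theta_relation bpar n = abs_base (\<Sum>k=1..n. let l = n + 1 - k in of_int (int k - int l) * (ftheta k * ftheta l))"
    by (simp only: theta_theta_relation_def abs_base_sum Let_def ftheta_def bpar_def abs_base_simps(3) i)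
  also have "\<dots> = 0" by (rule z) (use n in \<open>auto simp: base_relations_def\<close>)
  finally show "theta_theta_relation bpar n = 0" .
qed

lemma deformation_d1: "deformation versal_base d0 d1"
  unfolding deformation_def linf_structure_def
proof (intro conjI allI)
  have "NF bpar \<in> oprs versal_base 1"
    using vb.oprs_lower[OF lower_NF] vb.homogeneous_NF[OF bpar_params] MIsupported_NF by blast
  then have "d1 \<in> oprs versal_base 1" using vb.normalized_oprs[of d1 1] by (simp add: d1_eq)
  then show "coderivation versal_base 1 d1"
    unfolding vb.coderivation_iff by (simp add: d1_eq derivation_NF)
  have "normalized versal_base (brk 1 1 d1 d1) = (\<lambda>_ _. 0)"
    unfolding vb.normalized_brk d1_eq vb.normalized_denormalized
    by (rule vb.NF_square_zero[OF bpar_params bpar_relations])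
  then show "brk 1 1 d1 d1 = (\<lambda>K J. 0)"
    using vb.normalized_eq_0 by (intro ext) metis
  fix K J
  have "vb.fcong 1 (NF bpar K J) (NF (\<lambda>_. 0) K J)" by (rule vb.small_NF[OF bpar_small])
  then have "aug versal_base (NF bpar K J - NF (\<lambda>_. 0) K J) = 0"
    unfolding vb.fcong_def vb.filt_1 mideal_def by simp
  then have a: "aug versal_base (NF bpar K J) = aug versal_base (NF (\<lambda>_. 0) K J)"
    by (simp only: vb.aug_simps) simp
  have "aug versal_base (d1 K J) = of_nat (mfact J) / of_nat (mfact K) * aug versal_base (NF (\<lambda>_. 0) K J)"
    unfolding d1_eq denormalized_def vb.aug_simps a ..
  also have "\<dots> = aug versal_base (NF (\<lambda>_. 0) K J)"
    unfolding vb.aug_simps(5)[symmetric] vb.NF_zero_ratio ..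
  finally show "aug versal_base (d1 K J) = d0 K J" by (simp only: vb.aug_NF_zero)
qed

section \<open>Versality\<close>

lemma push_d1:
  assumes f: "base_hom versal_base B f" and B: "local_superalgebra B"
  shows "push f d1 = denormalized B (NF (\<lambda>x. f (bpar x)))"
proof -
  interpret B: local_superalgebra B by (rule B)
  interpret f: Vector_Spaces.linear bscale "scale B" f
    using f by (simp add: base_hom_def)
  have m: "f (x * y) = f x * f y" "f 1 = 1" for x y using f by (auto simp: base_hom_def)
  have n: "f (of_nat k * x) = of_nat k * f x" for k x
    by (induction k) (simp_all add: distrib_right f.add f.zero)
  have s: "f ((-1) ^ k * x) = (-1) ^ k * f x" for k x
    by (simp add: minus_one_power_iff f.neg)
  have nf: "f (nf bpar j J) = nf (\<lambda>x. f (bpar x)) j J" for j J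
    by (cases J) (simp add: nf_def m f.zero)
  have shift: "f (shift L (nf bpar j) J) = shift L (nf (\<lambda>x. f (bpar x)) j) J" for L j J
    by (simp add: shift_def nf f.zero)
  have NF: "f (NF bpar K J) = NF (\<lambda>x. f (bpar x)) K J" for K J
    by (cases "K \<in> MI \<and> J \<in> MI"; cases K)
       (auto simp: NF_def field_matrix_def field_row_def f.add f.diff f.neg f.zero n s shift)
  show ?thesis
    by (intro ext) (simp add: push_def d1_eq denormalized_def f.scale NF)
qed

context formal_base
begin

lemma fcong_1_iff: "fcong 1 x y \<longleftrightarrow> aug A x = aug A y"
  by (simp add: fcong_def filt_1 mideal_def)

lemma deformation_deformed:
  assumes "deformation A d0 d'"
  shows "deformed A (normalized A d')"
proof unfold_locales
  have c: "coderivation A 1 d'" and b: "brk 1 1 d' d' = (\<lambda>K J. 0)" and a: "\<And>K J. aug A (d' K J) = d0 K J"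
    using assms by (auto simp: deformation_def linf_structure_def)
  have o: "normalized A d' \<in> oprs A 1" "derivation 1 (normalized A d')" using c by (auto simp: coderivation_iff normalized_oprs)
  show "MIsupported (normalized A d')" "homogeneous 1 (normalized A d')" using oprs_homogeneous[OF o(1)] by auto
  show "derivation 1 (normalized A d')" by fact
  show "ocomp (normalized A d') (normalized A d') = (\<lambda>_ _. 0)"
  proof (intro ext)
    fix K J
    have "ocomp d' d' K J + ocomp d' d' K J = 0" using fun_cong[OF fun_cong[OF b]] by (simp only: brk_self)
    then have "ocomp d' d' K J = 0" by (rule half_zero)
    then show "ocomp (normalized A d') (normalized A d') K J = 0" unfolding normalized_ocomp[symmetric] by simp
  qed
  fix K J
  have "aug A (normalized A d' K J) = of_nat (mfact K) / of_nat (mfact J) * aug A (NF (\<lambda>_. 0) K J)"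
    by (simp add: normalized_def a aug_NF_zero)
  also have "\<dots> = aug A (scale A (of_nat (mfact K) / of_nat (mfact J)) (NF (\<lambda>_. 0) K J))" by simp
  also have "scale A (of_nat (mfact K) / of_nat (mfact J)) (NF (\<lambda>_. 0) K J) = NF (\<lambda>_. 0 :: 'a) K J"
    using NF_zero_fact[of K J, where 'a = 'a] by (cases "NF (\<lambda>_. 0 :: 'a) K J = 0") auto
  finally show "fcong 1 (normalized A d' K J) (NF (\<lambda>_. 0) K J)" by (simp only: fcong_1_iff)
qed

lemma deformation_classified:
  assumes "deformation A d0 d'"
  shows "\<exists>f. base_hom versal_base A f \<and> equivalent A (push f d1) d'"
proof -
  interpret deformed A "normalized A d'" by (rule deformation_deformed[OF assms])
  obtain \<gamma> u where \<gamma>: "vector_field 0 \<gamma>" "near \<gamma>" and u: "params u" "small u"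
    and eq: "ocomp (NF u) (morphism \<gamma>) = ocomp (morphism \<gamma>) (normalized A d')"
    by (rule normal_form)
  let ?g = "morphism \<gamma>"
  have lg: "lower ?g" by (rule lower_morphism[OF \<gamma>(1)])
  obtain h where h: "lower h" "homogeneous 0 h" "ocomp ?g h = oid" "ocomp h ?g = oid"
    by (rule neumann_inverse[OF lg homogeneous_morphism[OF \<gamma>(1)] near_morphism[OF \<gamma>]])
  have z: "ocomp T (\<lambda>_ _. 0) = (\<lambda>_ _. 0)" "ocomp (\<lambda>_ _. 0) T = (\<lambda>_ _. 0)" for T :: "'a opr"
    by (intro ext, simp add: ocomp_def)+
  have "ocomp (ocomp (NF u) (NF u)) ?g = ocomp (NF u) (ocomp ?g (normalized A d'))"
    by (simp only: ocomp_assoc[OF lower_NF lg] eq)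
  also have "\<dots> = ocomp (ocomp ?g (normalized A d')) (normalized A d')"
    by (simp only: ocomp_assoc[OF lg lower_Q, symmetric] eq)
  also have "\<dots> = (\<lambda>_ _. 0)" by (simp only: ocomp_assoc[OF lower_Q lower_Q] QQ z)
  finally have "ocomp (ocomp (ocomp (NF u) (NF u)) ?g) h = (\<lambda>_ _. 0)" by (simp only: z)
  then have NN: "ocomp (NF u) (NF u) = (\<lambda>_ _. 0)"
    by (simp add: ocomp_assoc[OF lg h(1)] h(3) ocomp_oid_right lower_ocomp lower_NF)
  interpret parameter_solution A u
    by unfold_locales (use u NF_square_relations[OF u(1) NN] in auto)
  have B: "local_superalgebra A" by unfold_locales
  have p: "push base_eval d1 = denormalized A (NF u)"
    using push_d1[OF base_hom_base_eval B] by (simp add: base_eval_bpar)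
  have "equivalent A (push base_eval d1) d'"
    unfolding equivalent_def
  proof (intro exI[of _ "denormalized A ?g"] conjI allI)
    have o: "denormalized A T \<in> oprs A 0" if "lower T" "homogeneous 0 T" for T
      using normalized_oprs[of "denormalized A T" 0] oprs_lower[OF that(1), of 0] that lower_MIsupported[OF that(1)] by simp
    have gh: "ocomp (denormalized A ?g) (denormalized A h) = oid" "ocomp (denormalized A h) (denormalized A ?g) = oid"
      by (simp_all add: normalized_inject[symmetric] normalized_ocomp h del: normalized_inject)
    show "coalgebra_automorphism A (denormalized A ?g)"
      unfolding coalgebra_automorphism_iff
      using o[OF lg homogeneous_morphism[OF \<gamma>(1)]] o[OF h(1,2)] gh multiplicative_morphism[OF \<gamma>(1)] by auto
    show "aug A (denormalized A ?g K J) = oid K J" for K J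
      using near_morphism[OF \<gamma>, of K J] by (auto simp: denormalized_def fcong_1_iff oid_def aug_one)
    show "ocomp (push base_eval d1) (denormalized A ?g) = ocomp (denormalized A ?g) d'"
      by (simp add: p normalized_inject[symmetric] normalized_ocomp eq del: normalized_inject)
  qed
  then show ?thesis using base_hom_base_eval by blast
qed

lemma infinitesimal_parameters:
  assumes i: "infinitesimal A" and d: "deformation A d0 d'"
    and f: "base_hom versal_base A f" and e: "equivalent A (push f d1) d'"
  shows "f (bpar x) = normalized A d' (evec (param_direction x)) (param_mi x)"
proof -
  interpret deformed A "normalized A d'" by (rule deformation_deformed[OF d])
  let ?Q = "normalized A d'" and ?j = "param_direction x" and ?J = "param_mi x"
  define u where "u = (\<lambda>x. f (bpar x))"
  have cl2: "fcong (Suc 1) x y \<longleftrightarrow> x = y" for x y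
    using infinitesimal_filt_2[OF i] by (simp add: fcong_def numeral_2_eq_2 One_nat_def)
  have small: "small u"
  proof -
    have "aug A (u x) = 0" for x
      using f bpar_small unfolding vb.small_def vb.filt_1
      by (simp add: u_def base_hom_def mideal_def)
    then show ?thesis by (simp add: small_def filt_1 mideal_def)
  qed
  have B: "local_superalgebra A" by unfold_locales
  obtain G where G: "coalgebra_automorphism A G" "\<And>K J. aug A (G K J) = oid K J"
    "ocomp (push f d1) G = ocomp G d'"
    using e by (auto simp: equivalent_def)
  define g where "g = normalized A G"
  have "g \<in> oprs A 0" and cg: "multiplicative g" using G(1) by (auto simp: coalgebra_automorphism_iff g_def normalized_oprs)
  then have mg: "MIsupported g" using oprs_homogeneous by blast
  have lg: "lower g" by (rule multiplicative_lower[OF mg cg])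
  have g1: "fcong 1 (g K J) (oid K J)" for K J
    by (auto simp: fcong_1_iff g_def normalized_def G(2) oid_def aug_one)
  have "normalized A (ocomp (denormalized A (NF u)) G) = normalized A (ocomp G d')"
    using G(3) push_d1[OF f B] by (simp add: u_def)
  then have eq: "ocomp (NF u) g = ocomp g ?Q" by (simp add: normalized_ocomp g_def)
  have j: "?j \<in> {1, 2, 3}" by (rule param_direction_range)
  have J: "?J \<in> MI" by (rule param_mi_MI)
  have L: "ocomp (NF u) g (evec ?j) ?J = u x"
  proof -
    have "ocomp (NF u) g (evec ?j) ?J = act (nf u ?j) g ?J"
      using NF_evec[OF j, of u] by (simp add: ocomp_act[OF lg])
    also have "nf u ?j = (\<lambda>J. nf (\<lambda>_. 0) ?j J + harmonic u ?j J)" by (rule ext) (simp add: harmonic_def)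
    also have "act (\<lambda>J. nf (\<lambda>_. 0) ?j J + harmonic u ?j J) g ?J = act (nf (\<lambda>_. 0) ?j) g ?J + act (harmonic u ?j) g ?J"
      by (rule act_add_left)
    also have "act (nf (\<lambda>_. 0) ?j) g ?J = 0"
    proof (cases "?j = 2")
      case True
      have "g (1, 1, 0) ?J = 0"
        by (rule lower_below[OF lg]) (use True in \<open>cases x; simp add: param_direction_def param_mi_def below_iff deg_def\<close>)
      then show ?thesis using True by (simp add: nf_zero_2 act_rind[OF lg])
    next
      case False
      then show ?thesis using j by (simp add: nf_zero_13 act_def)
    qed
    also have "act (harmonic u ?j) g ?J = act (harmonic u ?j) oid ?J"
    proof -
      have hs: "harmonic u ?j J \<in> filt A 1" for J
        using fcong_nf[of 1 u "\<lambda>_. 0" ?j J] small by (simp add: harmonic_def fcong_def small_def)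
      have "fcong (Suc 1) (act (harmonic u ?j) g ?J) (act (harmonic u ?j) oid ?J)"
        by (rule act_small_left[OF hs g1])
      then show ?thesis by (simp only: cl2)
    qed
    also have "act (harmonic u ?j) oid ?J = u x" by (simp add: act_oid[OF J] harmonic_param_mi)
    finally show ?thesis by simp
  qed
  have R: "ocomp g ?Q (evec ?j) ?J = ?Q (evec ?j) ?J"
  proof -
    define b where "b M = g (evec ?j) M - oid (evec ?j) M" for M
    have b1: "b M \<in> filt A 1" for M using g1 by (simp add: b_def fcong_def)
    have b0: "b (0, 0, 0) = 0" using mivanD[OF mg, of _ "(0, 0, 0)"] by (simp add: b_def oid_def MI_iff)
    have "g (evec ?j) = (\<lambda>M. oid (evec ?j) M + b M)" by (rule ext) (simp add: b_def)
    then have "ocomp g ?Q (evec ?j) ?J = act (oid (evec ?j)) ?Q ?J + act b ?Q ?J"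
      by (simp only: ocomp_act[OF lower_Q] act_add_left)
    moreover have "act (oid (evec ?j)) ?Q ?J = ?Q (evec ?j) ?J"
      using act_oid_left[OF lower_Q evec_MI[OF j]] by simp
    moreover have "act b ?Q ?J = act b (NF (\<lambda>_. 0)) ?J"
    proof -
      have "fcong (Suc 1) (act b ?Q ?J) (act b (NF (\<lambda>_. 0)) ?J)" by (rule act_small_left[OF b1 Q0])
      then show ?thesis by (simp only: cl2)
    qed
    moreover have "act b (NF (\<lambda>_. 0)) ?J = 0"
      unfolding act_NF_zero[of b, OF b0 J] by (cases x) (simp_all add: param_mi_def)
    ultimately show ?thesis by simp
  qed
  show ?thesis using L R eq by (simp add: u_def)
qed

lemma base_hom_unique:
  assumes i: "infinitesimal A" and f: "base_hom versal_base A f" "base_hom versal_base A f'"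
    and eq: "\<And>x. f (bpar x) = f' (bpar x)"
  shows "f = f'"
proof
  fix x
  obtain F where x: "x = abs_base F" by (rule base_cases)
  have *: "h (abs_base F) = (\<Sum>w\<in>fsupp 2 F. scale A (fcoeff F w) (h (abs_base (fword w))))"
    if h: "base_hom versal_base A h" for h
  proof -
    interpret h: Vector_Spaces.linear bscale "scale A" h using h by (simp add: base_hom_def)
    have "abs_base F - abs_base (ftrunc 2 F) \<in> filt versal_base 2"
      using ftrunc_ford[of F 2] by (simp add: abs_base_simps)
    moreover have "h ` filt versal_base 2 \<subseteq> filt A 2" using h unfolding base_hom_def by blast
    ultimately have "h (abs_base F - abs_base (ftrunc 2 F)) \<in> filt A 2" by blast
    then have "h (abs_base F) = h (abs_base (ftrunc 2 F))"
      using infinitesimal_filt_2[OF i] by (simp add: h.diff)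
    then show ?thesis
      by (simp add: ftrunc_sum abs_base_sum h.sum h.scale flip: abs_base_simps(4))
  qed
  have w: "f (abs_base (fword w)) = f' (abs_base (fword w))" if "w \<in> fsupp 2 F" for w
  proof -
    have "length w < 2" using that by (simp add: fsupp_def)
    then consider "w = []" | y where "w = [y]" by (cases w; cases "tl w") auto
    then show ?thesis
    proof cases
      case 1
      then show ?thesis using f by (simp add: fword_Nil base_hom_def flip: abs_base_simps(6))
    next
      case 2
      then show ?thesis using eq[of y] by (simp add: bpar_def fvar_fword)
    qed
  qed
  show "f x = f' x" unfolding x *[OF f(1)] *[OF f(2)] by (rule sum.cong) (simp_all add: w)
qed

end

lemma miniversal_d1: "miniversal TYPE('b::ring_1) versal_base d0 d1"
  unfolding miniversal_def versal_def
proof (intro conjI allI impI formal_base_versal_base deformation_d1)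
  fix B :: "'b salg" and d'
  show "\<exists>f. base_hom versal_base B f \<and> equivalent B (push f d1) d'"
    if "formal_base B \<and> deformation B d0 d'"
    using that formal_base.deformation_classified by blast
  show "\<exists>!f. base_hom versal_base B f \<and> equivalent B (push f d1) d'"
    if *: "formal_base B \<and> infinitesimal B \<and> deformation B d0 d'"
  proof (rule ex_ex1I)
    show "\<exists>f. base_hom versal_base B f \<and> equivalent B (push f d1) d'"
      using * formal_base.deformation_classified by blast
    fix f f' assume f: "base_hom versal_base B f \<and> equivalent B (push f d1) d'"
      "base_hom versal_base B f' \<and> equivalent B (push f' d1) d'"
    interpret formal_base B using * by blast
    have "f (bpar x) = f' (bpar x)" for x
      using infinitesimal_parameters[of d' f x] infinitesimal_parameters[of d' f' x] * f by simp
    then show "f = f'" using base_hom_unique * f by blast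
  qed
qed

section \<open>Cohomology\<close>

lemma superalgebra_trivial_base: "local_superalgebra trivial_base"
proof (intro local_superalgebra.intro local_superalgebra_axioms.intro)
  show v: "vector_space (scale trivial_base)"
    unfolding trivial_base_def by unfold_locales (auto simp: algebra_simps)
  then interpret v: vector_space "scale trivial_base" .
  show "module.subspace (scale trivial_base) (hpart trivial_base p)" for p
    by (rule v.subspaceI) (auto simp: hpart_def trivial_base_def)
  show "Vector_Spaces.linear (scale trivial_base) (*) (aug trivial_base)"
    by (intro Vector_Spaces.linear.intro module_hom.intro module_hom_axioms.intro)
       (use v in \<open>auto simp: trivial_base_def vector_space_def module_def\<close>)
  show "x \<notin> mideal trivial_base \<Longrightarrow> \<exists>y. x * y = 1 \<and> y * x = 1" for x
    by (intro exI[of _ "1 / x"]) (simp add: mideal_def trivial_base_def)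
qed (auto simp: trivial_base_def hpart_def split: if_splits)

interpretation tb: local_superalgebra trivial_base
  by (rule superalgebra_trivial_base)

lemma hpart_trivial_base: "x \<in> hpart trivial_base p \<longleftrightarrow> (odd p \<longrightarrow> x = 0)"
  by (simp add: hpart_def trivial_base_def)

lemma scale_trivial_base [simp]: "scale trivial_base c x = c * x"
  by (simp add: trivial_base_def)

lemma derivation_parity_cong: "even (p + q) \<Longrightarrow> derivation p T = derivation q T"
proof -
  assume e: "even (p + q)"
  have "(-1) ^ ((p + k) * l) = ((-1) ^ ((q + k) * l) :: 'a)" for k l
    using e by (intro sgn_cong) auto
  moreover have "rprod (p + l) f h = rprod (q + l) f h" for l and f h :: "mi \<Rightarrow> 'a"
    using e by (intro rprod_parity_cong) auto
  ultimately show ?thesis by (simp add: derivation_def)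
qed

lemma derivation_add: "derivation p T \<Longrightarrow> derivation p U \<Longrightarrow> derivation p (\<lambda>K J. T K J + U K J)"
  unfolding derivation_def
proof (intro ballI)
  fix K L J
  assume T: "\<forall>K\<in>MI. \<forall>L\<in>MI. \<forall>J\<in>MI. product_row T K L J =
      (-1) ^ ((p + par K) * par L) * rprod (par L) (T K) (oid L) J +
      (-1) ^ (par K * par L) * rprod (p + par L) (oid K) (T L) J"
    and U: "\<forall>K\<in>MI. \<forall>L\<in>MI. \<forall>J\<in>MI. product_row U K L J =
      (-1) ^ ((p + par K) * par L) * rprod (par L) (U K) (oid L) J +
      (-1) ^ (par K * par L) * rprod (p + par L) (oid K) (U L) J"
    and KLJ: "K \<in> MI" "L \<in> MI" "J \<in> MI"
  have "product_row (\<lambda>K J. T K J + U K J) K L J = product_row T K L J + product_row U K L J" by (simp add: product_row_def)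
  then show "product_row (\<lambda>K J. T K J + U K J) K L J =
      (-1) ^ ((p + par K) * par L) * rprod (par L) (\<lambda>J. T K J + U K J) (oid L) J +
      (-1) ^ (par K * par L) * rprod (p + par L) (oid K) (\<lambda>J. T L J + U L J) J"
    using T U KLJ by (simp add: rprod_add_left rprod_add_right distrib_left)
qed

lemma brk_NF_zero:
  assumes t: "MIsupported t" "derivation p t" and j: "j \<in> {1, 2, 3}" and J: "(a, b, c) \<in> MI"
  shows "brk p 1 t (NF (\<lambda>_. 0)) (evec j) (a, b, c) =
    (if a = 1 then t (evec j) (0, b, c) * of_nat b else 0) -
    (-1) ^ p * (if j = 2 then shift (0, 1, 0) (t (evec 1)) (a, b, c) +
      (-1) ^ p * shift (1, 0, 0) (t (evec 2)) (a, b, c) else 0)"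
proof -
  have lt: "lower t" by (rule derivation_lower[OF t])
  have z: "t (evec j) (0, 0, 0) = 0" by (rule mivanD[OF t(1)]) (simp add: MI_iff)
  have 1: "ocomp t (NF (\<lambda>_. 0)) (evec j) (a, b, c) = (if a = 1 then t (evec j) (0, b, c) * of_nat b else 0)"
    unfolding ocomp_act[OF lower_NF] act_NF_zero[where f = "t (evec j)", OF z J] by simp
  have "t (1, 1, 0) (a, b, c) = shift (0, 1, 0) (t (evec 1)) (a, b, c) +
      (-1) ^ p * shift (1, 0, 0) (t (evec 2)) (a, b, c)"
    by (subst derivation_unique[OF t]) (use J in \<open>simp add: field_matrix_def field_row_def MI_iff[of 1]\<close>)
  then have 2: "ocomp (NF (\<lambda>_. 0)) t (evec j) (a, b, c) = (if j = 2 then shift (0, 1, 0) (t (evec 1)) (a, b, c) +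
      (-1) ^ p * shift (1, 0, 0) (t (evec 2)) (a, b, c) else 0)"
    using j NF_evec[OF j, of "\<lambda>_. 0 :: 'a"]
    by (auto simp: ocomp_act[OF lt] nf_zero_2 nf_zero_13 act_rind[OF lt]) (simp_all add: act_def)
  show ?thesis by (simp only: brk_def 1 2 mult_1_right)
qed

lemma coder_delta_range: "coder (delta x) K J \<noteq> 0 \<Longrightarrow> x \<in> param_range (deg J)"
  using param_weight_range[of x K J] by (simp add: coder_delta)

lemma finite_coder_delta: "finite {x. coder (delta x) K J \<noteq> 0}"
  using coder_delta_range by (intro finite_subset[OF _ finite_param_range[of "deg J"]] subsetI) blast

definition opposite_parity :: "nat \<Rightarrow> (param \<Rightarrow> complex) \<Rightarrow> bool" where
  "opposite_parity p c \<longleftrightarrow> (\<forall>i. even (ppar i + p) \<longrightarrow> c i = 0)"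

lemma vector_field_harmonic: "opposite_parity p c \<Longrightarrow> tb.vector_field p (harmonic c)"
  unfolding tb.vector_field_def
proof (intro conjI allI)
  assume c: "opposite_parity p c"
  fix j :: nat and J :: mi
  obtain x y z where J: "J = (x, y, z)" by (cases J)
  have "odd (ppar i + p)" if "c i \<noteq> 0" for i using c that by (auto simp: opposite_parity_def)
  from this[of PS] this[of PEta] this[of "PT z"] this[of "PTheta (z - 1)"]
  show "harmonic c j J \<in> hpart trivial_base (p + par (evec j) + par J)"
    by (auto simp: hpart_trivial_base harmonic_def nf_def J par_def evec_def)
qed (rule MIfield_harmonic)

lemma sum_delta:
  assumes "opposite_parity p c"
  shows "(\<Sum>i | coder (delta i) K J \<noteq> 0. c i * coder (delta i) K J) =
    denormalized trivial_base (field_matrix p (harmonic c)) K J"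
proof -
  have "(\<Sum>i | coder (delta i) K J \<noteq> 0. c i * coder (delta i) K J) =
      (\<Sum>i\<in>param_range (deg J). c i * coder (delta i) K J)"
    by (rule sum.mono_neutral_left) (auto dest: coder_delta_range)
  also have "\<dots> = (\<Sum>i\<in>param_range (deg J). of_nat (mfact J) / of_nat (mfact K) *
      ((-1) ^ (p * par K) * (of_nat (param_weight i K J) * c i)))"
  proof (rule sum.cong[OF refl])
    fix i
    have "(-1) ^ (p * par K) = (1 :: complex)" if "param_weight i K J \<noteq> 0" "c i \<noteq> 0"
    proof -
      have "odd (ppar i + p)" using assms that(2) by (auto simp: opposite_parity_def)
      then have "even (p * par K)" using param_weight_sign[OF that(1)] by (cases i) auto
      then show ?thesis by simp
    qed
    then show "c i * coder (delta i) K J = of_nat (mfact J) / of_nat (mfact K) *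
        ((-1) ^ (p * par K) * (of_nat (param_weight i K J) * c i))"
      by (cases "param_weight i K J = 0 \<or> c i = 0") (auto simp: coder_delta)
  qed
  also have "\<dots> = denormalized trivial_base (field_matrix p (harmonic c)) K J"
    by (simp add: denormalized_def field_matrix_harmonic sum_distrib_left)
  finally show ?thesis .
qed

lemma normalized_d0: "normalized trivial_base d0 = NF (\<lambda>_. 0)"
proof (intro ext)
  fix K J
  show "normalized trivial_base d0 K J = NF (\<lambda>_. 0) K J"
    using NF_zero_fact[of K J, where 'a = complex]
    by (cases "NF (\<lambda>_. 0 :: complex) K J = 0") (auto simp: normalized_def d0_eq)
qed

lemma homogeneous_NF_zero: "tb.homogeneous 1 (NF (\<lambda>_. 0))"
  by (rule tb.homogeneous_NF[OF tb.params_zero])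

lemma derivation_brk_trivial:
  assumes "MIsupported t" "derivation p t" "tb.homogeneous p t"
  shows "derivation (p + 1) (brk p 1 t (NF (\<lambda>_. 0)))" "MIsupported (brk p 1 t (NF (\<lambda>_. 0)))"
proof -
  show "derivation (p + 1) (brk p 1 t (NF (\<lambda>_. 0)))"
    by (rule tb.derivation_brk[OF assms MIsupported_NF derivation_NF homogeneous_NF_zero])
  have l: "lower t" by (rule derivation_lower[OF assms(1,2)])
  show "MIsupported (brk p 1 t (NF (\<lambda>_. 0)))"
    unfolding MIsupported_def brk_def
    using lower_outside[OF lower_ocomp[OF l lower_NF]] lower_outside[OF lower_ocomp[OF lower_NF l]] by simp
qed

lemma brk_harmonic:
  assumes "opposite_parity p c"
  shows "brk p 1 (field_matrix p (harmonic c)) (NF (\<lambda>_. 0)) = (\<lambda>_ _. 0)"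
proof -
  let ?t = "field_matrix p (harmonic c)"
  have t: "MIsupported ?t" "derivation p ?t" "tb.homogeneous p ?t"
    by (rule MIsupported_field_matrix derivation_field_matrix[OF MIfield_harmonic] tb.homogeneous_field_matrix[OF vector_field_harmonic[OF assms]])+
  show ?thesis
  proof (rule derivation_eqI)
    show "derivation (p + 1) (brk p 1 ?t (NF (\<lambda>_. 0)))" "MIsupported (brk p 1 ?t (NF (\<lambda>_. 0)))"
      by (rule derivation_brk_trivial[OF t])+
    show "derivation (p + 1) (\<lambda>_ _. 0 :: complex)" by (simp add: derivation_def product_row_def rprod_def split_def)
    show "MIsupported (\<lambda>_ _. 0 :: complex)" by (simp add: MIsupported_def)
    fix j J assume j: "j \<in> {1, 2, 3 :: nat}" and J: "J \<in> MI"
    obtain x y z where J': "J = (x, y, z)" by (cases J)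
    have r: "?t (evec j) = harmonic c j" if "j \<in> {1, 2, 3}" for j
      using field_matrix_evec[OF MIfield_harmonic that] by blast
    have s: "(-1) ^ p * ((-1) ^ p * w) = (w :: complex)" for w
      by (simp add: minus_one_power_iff)
    have h1: "shift L (harmonic c 1) M = 0" for L M by (simp add: shift_def)
    have "(if x = 1 then harmonic c j (0, y, z) * of_nat y else 0) -
        (-1) ^ p * (if j = 2 then (-1) ^ p * shift (1, 0, 0) (harmonic c 2) (x, y, z) else 0) = 0"
    proof (cases "j = 2")
      case True
      then show ?thesis using J by (auto simp: s shift_eq J' MI_iff)
    next
      case False
      then show ?thesis using j by (auto simp: harmonic_def nf_def)
    qed
    then show "brk p 1 ?t (NF (\<lambda>_. 0)) (evec j) J = 0"
      unfolding J' brk_NF_zero[OF t(1,2) j J[unfolded J']] r[OF j] r[of 1, simplified] r[of 2, simplified]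
        h1 add_0_left .
  qed
qed

lemma delta_cocycle:
  "coderivation trivial_base (ppar i + 1) (coder (delta i))"
  "brk (ppar i + 1) 1 (coder (delta i)) d0 = (\<lambda>K J. 0)"
proof -
  let ?p = "ppar i + 1"
  define c where "c x = (if x = i then 1 else 0 :: complex)" for x
  have pc: "opposite_parity ?p c" by (auto simp: opposite_parity_def c_def)
  let ?t = "field_matrix ?p (harmonic c)"
  have "coder (delta i) K J = denormalized trivial_base ?t K J" for K J
  proof -
    have "(\<Sum>x | coder (delta x) K J \<noteq> 0. c x * coder (delta x) K J) =
        (\<Sum>x | coder (delta x) K J \<noteq> 0. if x = i then coder (delta x) K J else 0)"
      by (rule sum.cong) (auto simp: c_def)
    also have "\<dots> = coder (delta i) K J"
      using finite_coder_delta by (simp add: sum.delta)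
    finally show ?thesis by (simp add: sum_delta[OF pc])
  qed
  then have e: "coder (delta i) = denormalized trivial_base ?t" by blast
  have vector_field: "tb.vector_field ?p (harmonic c)" by (rule vector_field_harmonic[OF pc])
  have t: "MIsupported ?t" "derivation ?p ?t" "tb.homogeneous ?p ?t"
    by (rule MIsupported_field_matrix derivation_field_matrix[OF MIfield_harmonic] tb.homogeneous_field_matrix[OF vector_field])+
  show "coderivation trivial_base ?p (coder (delta i))"
    unfolding tb.coderivation_iff e tb.normalized_denormalized
    using tb.normalized_oprs[of "denormalized trivial_base ?t" ?p] tb.field_matrix_oprs[OF vector_field] t(2) by simp
  have "brk ?p 1 ?t (NF (\<lambda>_. 0)) = (\<lambda>_ _. 0)" by (rule brk_harmonic[OF pc])
  then have "normalized trivial_base (brk ?p 1 (coder (delta i)) d0) = (\<lambda>_ _. 0)"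
    by (simp add: tb.normalized_brk e normalized_d0)
  then show "brk ?p 1 (coder (delta i)) d0 = (\<lambda>K J. 0)"
    using tb.normalized_eq_0 by (intro ext) metis
qed

lemma coboundary_at_param:
  assumes "MIsupported t" "derivation p t"
  shows "brk p 1 t (NF (\<lambda>_. 0)) (evec (param_direction i)) (param_mi i) = 0"
proof -
  have "t K (0, 0, 0) = 0" for K by (rule mivanD[OF assms(1)]) (simp add: MI_iff)
  then show ?thesis
    using brk_NF_zero[OF assms param_direction_range[of i], of "fst (param_mi i)" "fst (snd (param_mi i))" "snd (snd (param_mi i))"] param_mi_MI[of i]
    by (cases i) (auto simp: param_mi_def param_direction_def shift_eq)
qed

lemma cocycle_decomposition:
  assumes T: "coderivation trivial_base p T" "brk p 1 T d0 = (\<lambda>K J. 0)"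
  shows "\<exists>!c. (\<forall>i. even (ppar i + p) \<longrightarrow> c i = 0) \<and>
    (\<exists>U. coderivation trivial_base (p + 1) U \<and>
      T = (\<lambda>K J. (\<Sum>i | coder (delta i) K J \<noteq> 0. c i * coder (delta i) K J) + brk (p + 1) 1 U d0 K J))"
proof -
  let ?N0 = "NF (\<lambda>_. 0) :: complex opr"
  define t where "t = normalized trivial_base T"
  have t: "MIsupported t" "derivation p t" "tb.homogeneous p t"
    using T(1) tb.oprs_homogeneous[of t p] by (auto simp: tb.coderivation_iff t_def tb.normalized_oprs)
  have bt: "brk p 1 t ?N0 K J = 0" for K J
  proof -
    have "brk p 1 t ?N0 = normalized trivial_base (brk p 1 T d0)" by (simp only: tb.normalized_brk normalized_d0 t_def)
    then show ?thesis by (simp add: T(2) normalized_def)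
  qed
  define E where "E j = t (evec j)" for j
  have Eoff: "E j J = 0" if "J \<notin> MI" for j J unfolding E_def by (rule mivanD[OF t(1)]) (simp add: that)
  have Epar: "E j J = 0" if "odd (p + par (evec j) + par J)" for j J
    using tb.hopD[OF t(3), of "evec j" J] that by (simp add: hpart_trivial_base E_def)
  have row: "(if a = 1 then E j (0, b, c) * of_nat b else 0) =
    (-1) ^ p * (if j = 2 then shift (0, 1, 0) (E 1) (a, b, c) + (-1) ^ p * shift (1, 0, 0) (E 2) (a, b, c) else 0)"
    if "j \<in> {1, 2, 3}" "(a, b, c) \<in> MI" for j a b c
    using brk_NF_zero[OF t(1,2) that] unfolding bt E_def by simp
  have ss: "(-1) ^ p * ((-1) ^ p * w) = (w :: complex)" for w
    by (simp add: minus_one_power_iff)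
  have c1: "E 1 (0, b, c) = 0" for b c
    using row[of 2 0 "Suc b" c] by (simp add: MI_iff shift_eq)
  have c2: "E 2 (0, 0, c) = 0" for c
    using row[of 2 1 0 c] by (simp add: MI_iff shift_eq ss distrib_left)
  have c3: "of_nat b * E 2 (0, Suc b, c) = (-1) ^ p * E 1 (1, b, c)" for b c
    using row[of 2 1 "Suc b" c] by (simp add: MI_iff shift_eq ss distrib_left algebra_simps)
  have c4: "E 3 (0, Suc b, c) = 0" for b c
    using row[of 3 1 "Suc b" c] by (simp add: MI_iff del: of_nat_Suc)
  show ?thesis
  proof (rule ex_ex1I)
    define k where "k i = E (param_direction i) (param_mi i)" for i
    have pc: "opposite_parity p k"
      unfolding opposite_parity_def k_def
    proof (intro allI impI, rule Epar)
      fix i assume "even (ppar i + p)"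
      then show "odd (p + par (evec (param_direction i)) + par (param_mi i))"
        by (cases i) (auto simp: param_direction_def param_mi_def par_def evec_def)
    qed
    define Y where "Y j = (\<lambda>(a, b, c).
      if (a, b, c) \<notin> MI then 0
      else if j = 1 then (-1) ^ p * E 2 (a, Suc b, c)
      else if j = 2 then (if a = 0 \<and> b = 0 then - E 2 (1, 0, c) else 0)
      else if j = 3 then (if a = 0 \<and> b > 0 then E 3 (1, b, c) / of_nat b else 0)
      else 0)" for j :: nat
    have Ye: "Y 1 (a, b, c) = (if (a, b, c) \<in> MI then (-1) ^ p * E 2 (a, Suc b, c) else 0)"
      "Y 2 (a, b, c) = (if (a, b, c) \<in> MI \<and> a = 0 \<and> b = 0 then - E 2 (1, 0, c) else 0)"
      "Y 3 (a, b, c) = (if (a, b, c) \<in> MI \<and> a = 0 \<and> b > 0 then E 3 (1, b, c) / of_nat b else 0)"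
      for a b c by (auto simp: Y_def)
    have MIfield: "MIfield Y" unfolding MIfield_def by (auto simp: Y_def)
    have vfY: "tb.vector_field (p + 1) Y"
      unfolding tb.vector_field_def
    proof (intro conjI allI MIfield)
      fix j :: nat and J :: mi
      obtain x y z where J: "J = (x, y, z)" by (cases J)
      show "Y j J \<in> hpart trivial_base (p + 1 + par (evec j) + par J)"
        using Epar[of 2 "(x, Suc y, z)"] Epar[of 2 "(1, 0, z)"] Epar[of 3 "(1, y, z)"]
        by (auto simp: hpart_trivial_base Y_def J par_def evec_def MI_iff)
    qed
    let ?y = "field_matrix (p + 1) Y"
    have y: "MIsupported ?y" "derivation (p + 1) ?y" "tb.homogeneous (p + 1) ?y"
      by (rule MIsupported_field_matrix derivation_field_matrix[OF MIfield] tb.homogeneous_field_matrix[OF vfY])+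
    have yr: "?y (evec j) = Y j" if "j \<in> {1, 2, 3}" for j using field_matrix_evec[OF MIfield that] by blast
    have dec: "t = (\<lambda>K J. field_matrix p (harmonic k) K J + brk (p + 1) 1 ?y ?N0 K J)"
    proof (rule derivation_eqI[OF t(1) _ t(2)])
      show "MIsupported (\<lambda>K J. field_matrix p (harmonic k) K J + brk (p + 1) 1 ?y ?N0 K J)"
        using mivanD[OF MIsupported_field_matrix[of p "harmonic k"]] mivanD[OF derivation_brk_trivial(2)[OF y]] by (auto simp: MIsupported_def)
      have "derivation p (brk (p + 1) 1 ?y ?N0)"
        using derivation_brk_trivial(1)[OF y] by (subst derivation_parity_cong[of p "p + 1 + 1"]) simp_all
      then show "derivation p (\<lambda>K J. field_matrix p (harmonic k) K J + brk (p + 1) 1 ?y ?N0 K J)"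
        by (rule derivation_add[OF derivation_field_matrix[OF MIfield_harmonic]])
      fix j J assume j: "j \<in> {1, 2, 3 :: nat}" and J: "J \<in> MI"
      have kk: "k PS = E 2 (1, 0, 0)" "k PEta = E 2 (0, 1, 0)" "k (PT n) = E 3 (1, 0, n)"
        "k (PTheta n) = E 3 (0, 0, Suc n)" for n
        by (simp_all add: k_def param_direction_def param_mi_def)
      have E21: "E 2 (0, Suc 0, 0) = E 2 (0, 1, 0)" by (simp add: One_nat_def)
      have sg: "(-1) ^ (p + 1) * ((-1) ^ p * w) = - w" "(-1) ^ (p + 1) * ((-1) ^ (p + 1) * w) = w"
        "(-1) ^ p * ((-1) ^ (p + 1) * w) = - w" for w :: complex
        by (simp_all add: minus_one_power_iff)
      obtain a b c where J': "J = (a, b, c)" by (cases J)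
      have h: "field_matrix p (harmonic k) (evec j) J = harmonic k j J" by (rule field_matrix_evec[OF MIfield_harmonic j])
      have main: "E j (a, b, c) = harmonic k j (a, b, c) + ((if a = 1 then Y j (0, b, c) * of_nat b else 0) -
        (-1) ^ (p + 1) * (if j = 2 then shift (0, 1, 0) (Y 1) (a, b, c) + (-1) ^ (p + 1) * shift (1, 0, 0) (Y 2) (a, b, c) else 0))"
      proof -
        consider "a = 0" "b = 0" "c > 0" | b' where "a = 0" "b = Suc b'" | "a = 1" "b = 0" | b' where "a = 1" "b = Suc b'"
          using J by (cases b) (auto simp: J' MI_iff)
        then show ?thesis
        proof cases
          case 1
          then show ?thesis using j c1[of 0 c] c2[of c] by (auto simp: kk shift_eq)
        next
          case (2 b')
          then show ?thesis using j c1[of "Suc b'" c] c4[of b' c]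
            by (auto simp: kk shift_eq Ye MI_iff sg E21 distrib_left)
        next
          case 3
          then show ?thesis using j c3[of 0 c]
            by (auto simp: kk shift_eq Ye MI_iff sg distrib_left)
        next
          case (4 b')
          have "(-1) ^ p * (of_nat (Suc b') * E 2 (0, Suc (Suc b'), c)) = E 1 (1, Suc b', c)"
            unfolding c3 ss ..
          then show ?thesis using j 4
            by (auto simp: kk shift_eq Ye MI_iff sg distrib_left mult.commute mult.left_commute simp del: of_nat_Suc)
        qed
      qed
      show "t (evec j) J = field_matrix p (harmonic k) (evec j) J + brk (p + 1) 1 ?y ?N0 (evec j) J"
        unfolding h unfolding J' brk_NF_zero[OF y(1,2) j J[unfolded J']] yr[OF j] yr[of 1, simplified]
          yr[of 2, simplified] E_def[symmetric] by (rule main)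
    qed
    have "T = (\<lambda>K J. (\<Sum>i | coder (delta i) K J \<noteq> 0. k i * coder (delta i) K J) +
        brk (p + 1) 1 (denormalized trivial_base ?y) d0 K J)"
    proof (intro ext)
      fix K J
      have "brk (p + 1) 1 (denormalized trivial_base ?y) d0 = denormalized trivial_base (brk (p + 1) 1 ?y ?N0)"
        by (rule tb.normalized_inject[THEN iffD1]) (simp add: tb.normalized_brk normalized_d0)
      moreover have "T K J = denormalized trivial_base t K J" by (simp add: t_def)
      ultimately show "T K J = (\<Sum>i | coder (delta i) K J \<noteq> 0. k i * coder (delta i) K J) +
          brk (p + 1) 1 (denormalized trivial_base ?y) d0 K J"
        using fun_cong[OF fun_cong[OF dec], of K J] by (simp add: sum_delta[OF pc] denormalized_def distrib_left)
    qed
    moreover have "coderivation trivial_base (p + 1) (denormalized trivial_base ?y)"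
      unfolding tb.coderivation_iff
      using tb.normalized_oprs[of "denormalized trivial_base ?y" "p + 1"] tb.field_matrix_oprs[OF vfY] y(2) by simp
    ultimately show "\<exists>c. (\<forall>i. even (ppar i + p) \<longrightarrow> c i = 0) \<and>
      (\<exists>U. coderivation trivial_base (p + 1) U \<and>
        T = (\<lambda>K J. (\<Sum>i | coder (delta i) K J \<noteq> 0. c i * coder (delta i) K J) + brk (p + 1) 1 U d0 K J))"
      by (intro exI[of _ k] conjI exI[of _ "denormalized trivial_base ?y"] pc[unfolded opposite_parity_def])
  next
    have det: "c i = E (param_direction i) (param_mi i)"
      if c: "\<forall>i. even (ppar i + p) \<longrightarrow> c i = 0" and U: "coderivation trivial_base (p + 1) U"
        and eq: "T = (\<lambda>K J. (\<Sum>i | coder (delta i) K J \<noteq> 0. c i * coder (delta i) K J) + brk (p + 1) 1 U d0 K J)"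
      for c i U
    proof -
      have pc: "opposite_parity p c" using c by (simp add: opposite_parity_def)
      let ?u = "normalized trivial_base U"
      have u: "MIsupported ?u" "derivation (p + 1) ?u"
        using U tb.oprs_homogeneous[of ?u "p + 1"] by (auto simp: tb.coderivation_iff tb.normalized_oprs)
      have bU: "brk (p + 1) 1 U d0 = denormalized trivial_base (brk (p + 1) 1 ?u ?N0)"
        by (rule tb.normalized_inject[THEN iffD1]) (simp add: tb.normalized_brk normalized_d0)
      have "t K J = field_matrix p (harmonic c) K J + brk (p + 1) 1 ?u ?N0 K J" for K J
      proof -
        have "T K J = denormalized trivial_base (field_matrix p (harmonic c)) K J + denormalized trivial_base (brk (p + 1) 1 ?u ?N0) K J"
          by (subst eq) (simp only: sum_delta[OF pc] bU)
        then show ?thesis by (simp add: t_def normalized_def[of _ T] denormalized_def distrib_left)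
      qed
      then show ?thesis
        using coboundary_at_param[OF u, of i]
        by (simp add: E_def field_matrix_evec[OF MIfield_harmonic param_direction_range] harmonic_param_mi)
    qed
    fix c c'
    assume "(\<forall>i. even (ppar i + p) \<longrightarrow> c i = 0) \<and>
      (\<exists>U. coderivation trivial_base (p + 1) U \<and>
        T = (\<lambda>K J. (\<Sum>i | coder (delta i) K J \<noteq> 0. c i * coder (delta i) K J) + brk (p + 1) 1 U d0 K J))"
      and "(\<forall>i. even (ppar i + p) \<longrightarrow> c' i = 0) \<and>
      (\<exists>U. coderivation trivial_base (p + 1) U \<and>
        T = (\<lambda>K J. (\<Sum>i | coder (delta i) K J \<noteq> 0. c' i * coder (delta i) K J) + brk (p + 1) 1 U d0 K J))"
    then obtain U U' where "\<forall>i. even (ppar i + p) \<longrightarrow> c i = 0" "coderivation trivial_base (p + 1) U"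
        "T = (\<lambda>K J. (\<Sum>i | coder (delta i) K J \<noteq> 0. c i * coder (delta i) K J) + brk (p + 1) 1 U d0 K J)"
      and "\<forall>i. even (ppar i + p) \<longrightarrow> c' i = 0" "coderivation trivial_base (p + 1) U'"
        "T = (\<lambda>K J. (\<Sum>i | coder (delta i) K J \<noteq> 0. c' i * coder (delta i) K J) + brk (p + 1) 1 U' d0 K J)"
      by (elim conjE exE)
    from det[OF this(1-3)] det[OF this(4-6)] show "c = c'" by (intro ext) simp
  qed
qed

lemma cohomology_basis_delta: "cohomology_basis d0 ppar delta"
  unfolding cohomology_basis_def
proof (intro conjI allI impI)
  show "finite {i. coder (delta i) K J \<noteq> 0}" for K J
    by (rule finite_coder_delta)
qed (use delta_cocycle cocycle_decomposition in blast)+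

lemma universal_infinitesimal_d1: "universal_infinitesimal versal_base d0 ppar delta bpar d1"
  unfolding universal_infinitesimal_def
proof (intro conjI allI ext cohomology_basis_delta)
  show "bpar i \<in> hpart versal_base (ppar i)" for i
    using bpar_params by (simp add: vb.params_def)
  fix K J
  have "(\<Sum>i\<in>param_range (deg J). ctens versal_base (ppar i) (delta i) (bpar i) K J) =
      (\<Sum>i | coder (delta i) K J \<noteq> 0. ctens versal_base (ppar i) (delta i) (bpar i) K J)"
    by (rule sum.mono_neutral_right) (auto dest: coder_delta_range simp: ctens_def)
  then show "d1 K J = scale versal_base (d0 K J) 1 +
      (\<Sum>i | coder (delta i) K J \<noteq> 0. ctens versal_base (ppar i) (delta i) (bpar i) K J)"
    by (simp only: d1_sum)
qed

theorem mainTheorem10: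
  shows "universal_infinitesimal versal_base d0 ppar delta bpar d1 \<and>
         miniversal TYPE('b::ring_1) versal_base d0 d1"
  using universal_infinitesimal_d1 miniversal_d1 by blast

end
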